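(* Let $\mathcal{E}$ be a Boolean topos with a local state classifier $\{\xi_X\colon X\to\Xi\}_{X\in\mathrm{ob}(\mathcal{E})}$ (for example, an arbitrary Boolean Grothendieck topos). Then the following three concepts correspond bijectively: (1) quotients of $\mathcal{E}$; (2) internal filters of $\Xi$; (3) internal semilattice homomorphisms $\Xi\to\Omega$, where $\Omega$ is the subobject classifier of $\mathcal{E}$.
   Context: "Topos" means elementary topos. Local state classifier: for a category $\mathcal{C}$, let $\mathcal{C}_{\mathrm{mono}}$ be the subcategory with the same objects and all monomorphisms of $\mathcal{C}$. A local state classifier of $\mathcal{C}$ is a colimit $\Xi$ (if it exists) of the (possibly large) inclusion functor $\mathcal{C}_{\mathrm{mono}}\to\mathcal{C}$, with colimit cocone $\{\xi_X\colon X\to\Xi\}_{X\in\mathrm{ob}(\mathcal{C})}$. A quotient of $\mathcal{E}$ is a connected geometric morphism $f\colon\mathcal{E}\to\mathcal{F}$ to some topos $\mathcal{F}$, i.e. one whose inverse image functor $f^*$ is fully faithful; two quotients are identified when the essential images of their inverse image functors coincide. Internal semilattice: an object $A$ with morphisms $\top\colon\mathbf{1}\to A$, $\wedge\colon A\times A\to A$ satisfying $x\wedge\top=\top\wedge x=x$, associativity, commutativity and $x\wedge x=x$; homomorphisms preserve $\top$ and $\wedge$. An internal filter of $A$ is a subobject $m\colon F\rightarrowtail A$ such that $\top$ factors through $m$; $\wedge\circ(m\times m)$ factors through $m$; and $F$ is upward closed: for all $T$, $u\colon T\to F$, $x\colon T\to A$ with $\wedge\circ\langle m u,x\rangle=m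 u$, the morphism $x$ factors through $m$. Semilattice structure on $\Xi$: since $\mathcal{E}$ is cartesian closed, $\{\xi_X\times\xi_Y\colon X\times Y\to\Xi\times\Xi\}_{X,Y}$ is a colimit cocone of the functor $\mathcal{E}_{\mathrm{mono}}\times\mathcal{E}_{\mathrm{mono}}\to\mathcal{E}$, $(X,Y)\mapsto X\times Y$. Put $\top=\xi_{\mathbf{1}}$ and let $\wedge\colon\Xi\times\Xi\to\Xi$ be the unique morphism with $\wedge\circ(\xi_X\times\xi_Y)=\xi_{X\times Y}$ for all $X,Y$. The object $\Omega$ has its usual semilattice structure ($\top=\mathrm{true}$, $\wedge$ the characteristic morphism of $\mathrm{true}\times\mathrm{true}$). The correspondences meant: an internal filter $k\colon F\rightarrowtail\Xi$ corresponds to its characteristic morphism $\Xi\to\Omega$, and to the quotient given by the full subcategory of those $X\in\mathrm{ob}(\mathcal{E})$ for which $\xi_X$ factors through $k$. *)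

theory Defs
  imports Main
begin

section \<open>Categories and functors\<close>

record ('o, 'm) cat =
  Ob :: "'o set"
  Ar :: "'m set"
  Dom :: "'m \<Rightarrow> 'o"
  Cod :: "'m \<Rightarrow> 'o"
  Idn :: "'o \<Rightarrow> 'm"
  Cmp :: "'m \<Rightarrow> 'm \<Rightarrow> 'm"  (infixr "\<cdot>\<index>" 70)

definition hom :: "('o, 'm) cat \<Rightarrow> 'o \<Rightarrow> 'o \<Rightarrow> 'm set" where
  "hom C X Y = {f \<in> Ar C. Dom C f = X \<and> Cod C f = Y}"

locale category =
  fixes C :: "('o, 'm) cat" (structure)
  assumes dom_ob: "f \<in> Ar C \<Longrightarrow> Dom C f \<in> Ob C"
    and cod_ob: "f \<in> Ar C \<Longrightarrow> Cod C f \<in> Ob C"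
    and id_hom: "X \<in> Ob C \<Longrightarrow> Idn C X \<in> hom C X X"
    and comp_hom: "\<lbrakk>f \<in> hom C X Y; g \<in> hom C Y Z\<rbrakk> \<Longrightarrow> g \<cdot> f \<in> hom C X Z"
    and id_left: "f \<in> hom C X Y \<Longrightarrow> Idn C Y \<cdot> f = f"
    and id_right: "f \<in> hom C X Y \<Longrightarrow> f \<cdot> Idn C X = f"
    and comp_assoc: "\<lbrakk>f \<in> hom C W X; g \<in> hom C X Y; h \<in> hom C Y Z\<rbrakk>
      \<Longrightarrow> (h \<cdot> g) \<cdot> f = h \<cdot> (g \<cdot> f)"

definition monic :: "('o, 'm) cat \<Rightarrow> 'm \<Rightarrow> bool" where
  "monic C m \<longleftrightarrow> m \<in> Ar C \<and>
    (\<forall>T. \<forall>f\<in>hom C T (Dom C m). \<forall>g\<in>hom C T (Dom C m).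
       m \<cdot>\<^bsub>C\<^esub> f = m \<cdot>\<^bsub>C\<^esub> g \<longrightarrow> f = g)"

definition iso :: "('o, 'm) cat \<Rightarrow> 'm \<Rightarrow> bool" where
  "iso C f \<longleftrightarrow> f \<in> Ar C \<and>
    (\<exists>g\<in>hom C (Cod C f) (Dom C f).
       g \<cdot>\<^bsub>C\<^esub> f = Idn C (Dom C f) \<and> f \<cdot>\<^bsub>C\<^esub> g = Idn C (Cod C f))"

definition isomorphic :: "('o, 'm) cat \<Rightarrow> 'o \<Rightarrow> 'o \<Rightarrow> bool" where
  "isomorphic C X Y \<longleftrightarrow> (\<exists>f\<in>hom C X Y. iso C f)"

definition factors_through :: "('o, 'm) cat \<Rightarrow> 'm \<Rightarrow> 'm \<Rightarrow> bool" where
  "factors_through C f m \<longleftrightarrow> (\<exists>g\<in>hom C (Dom C f) (Dom C m). m \<cdot>\<^bsub>C\<^esub> g = f)"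

record ('o, 'm, 'p, 'q) cfunctor =
  Fob :: "'o \<Rightarrow> 'p"
  Far :: "'m \<Rightarrow> 'q"

definition is_functor ::
  "('o, 'm) cat \<Rightarrow> ('p, 'q) cat \<Rightarrow> ('o, 'm, 'p, 'q) cfunctor \<Rightarrow> bool" where
  "is_functor C D F \<longleftrightarrow> category C \<and> category D \<and>
    (\<forall>X\<in>Ob C. Fob F X \<in> Ob D) \<and>
    (\<forall>X Y. \<forall>f\<in>hom C X Y. Far F f \<in> hom D (Fob F X) (Fob F Y)) \<and>
    (\<forall>X\<in>Ob C. Far F (Idn C X) = Idn D (Fob F X)) \<and>
    (\<forall>X Y Z. \<forall>f\<in>hom C X Y. \<forall>g\<in>hom C Y Z.
       Far F (g \<cdot>\<^bsub>C\<^esub> f) = Far F g \<cdot>\<^bsub>D\<^esub> Far F f)"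

definition fully_faithful ::
  "('o, 'm) cat \<Rightarrow> ('p, 'q) cat \<Rightarrow> ('o, 'm, 'p, 'q) cfunctor \<Rightarrow> bool" where
  "fully_faithful C D F \<longleftrightarrow>
    (\<forall>X\<in>Ob C. \<forall>Y\<in>Ob C. bij_betw (Far F) (hom C X Y) (hom D (Fob F X) (Fob F Y)))"

definition essential_image ::
  "('o, 'm) cat \<Rightarrow> ('p, 'q) cat \<Rightarrow> ('o, 'm, 'p, 'q) cfunctor \<Rightarrow> 'p set" where
  "essential_image C D F = {Y \<in> Ob D. \<exists>X\<in>Ob C. isomorphic D (Fob F X) Y}"

text \<open>\<open>L : C \<rightarrow> D\<close> is left adjoint to \<open>R : D \<rightarrow> C\<close>: a bijection
  \<open>hom D (L A) X \<cong> hom C A (R X)\<close> natural in both variables.\<close>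

definition adjoint :: "('o, 'm) cat \<Rightarrow> ('p, 'q) cat \<Rightarrow>
    ('o, 'm, 'p, 'q) cfunctor \<Rightarrow> ('p, 'q, 'o, 'm) cfunctor \<Rightarrow> bool" where
  "adjoint C D L R \<longleftrightarrow> is_functor C D L \<and> is_functor D C R \<and>
    (\<exists>\<Phi>. (\<forall>A\<in>Ob C. \<forall>X\<in>Ob D.
            bij_betw (\<Phi> A X) (hom D (Fob L A) X) (hom C A (Fob R X))) \<and>
         (\<forall>A A' X X'. \<forall>a\<in>hom C A' A. \<forall>x\<in>hom D X X'. \<forall>h\<in>hom D (Fob L A) X.
            \<Phi> A' X' (x \<cdot>\<^bsub>D\<^esub> h \<cdot>\<^bsub>D\<^esub> Far L a)
              = Far R x \<cdot>\<^bsub>C\<^esub> \<Phi> A X h \<cdot>\<^bsub>C\<^esub> a))"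

definition is_cocone :: "('j, 'k) cat \<Rightarrow> ('o, 'm) cat \<Rightarrow>
    ('j, 'k, 'o, 'm) cfunctor \<Rightarrow> 'o \<Rightarrow> ('j \<Rightarrow> 'm) \<Rightarrow> bool" where
  "is_cocone J C D Z \<zeta> \<longleftrightarrow> is_functor J C D \<and> Z \<in> Ob C \<and>
    (\<forall>i\<in>Ob J. \<zeta> i \<in> hom C (Fob D i) Z) \<and>
    (\<forall>i j. \<forall>u\<in>hom J i j. \<zeta> j \<cdot>\<^bsub>C\<^esub> Far D u = \<zeta> i)"

definition is_colimit :: "('j, 'k) cat \<Rightarrow> ('o, 'm) cat \<Rightarrow>
    ('j, 'k, 'o, 'm) cfunctor \<Rightarrow> 'o \<Rightarrow> ('j \<Rightarrow> 'm) \<Rightarrow> bool" where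
  "is_colimit J C D L \<kappa> \<longleftrightarrow> is_cocone J C D L \<kappa> \<and>
    (\<forall>Z \<zeta>. is_cocone J C D Z \<zeta> \<longrightarrow>
       (\<exists>!h. h \<in> hom C L Z \<and> (\<forall>i\<in>Ob J. h \<cdot>\<^bsub>C\<^esub> \<kappa> i = \<zeta> i)))"


section \<open>Finite limits and exponentials\<close>

definition is_terminal :: "('o, 'm) cat \<Rightarrow> 'o \<Rightarrow> bool" where
  "is_terminal C T \<longleftrightarrow> T \<in> Ob C \<and> (\<forall>X\<in>Ob C. \<exists>!f. f \<in> hom C X T)"

definition is_pullback :: "('o, 'm) cat \<Rightarrow> 'm \<Rightarrow> 'm \<Rightarrow> 'm \<Rightarrow> 'm \<Rightarrow> bool" where
  "is_pullback C f g p q \<longleftrightarrow>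
    f \<in> Ar C \<and> g \<in> Ar C \<and> p \<in> Ar C \<and> q \<in> Ar C \<and>
    Cod C f = Cod C g \<and> Cod C p = Dom C f \<and> Cod C q = Dom C g \<and> Dom C p = Dom C q \<and>
    f \<cdot>\<^bsub>C\<^esub> p = g \<cdot>\<^bsub>C\<^esub> q \<and>
    (\<forall>T. \<forall>p'\<in>hom C T (Dom C f). \<forall>q'\<in>hom C T (Dom C g).
       f \<cdot>\<^bsub>C\<^esub> p' = g \<cdot>\<^bsub>C\<^esub> q' \<longrightarrow>
       (\<exists>!u. u \<in> hom C T (Dom C p) \<and> p \<cdot>\<^bsub>C\<^esub> u = p' \<and> q \<cdot>\<^bsub>C\<^esub> u = q'))"

definition is_product :: "('o, 'm) cat \<Rightarrow> 'o \<Rightarrow> 'o \<Rightarrow> 'm \<Rightarrow> 'm \<Rightarrow> bool" where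
  "is_product C X Y p q \<longleftrightarrow>
    p \<in> hom C (Dom C p) X \<and> q \<in> hom C (Dom C p) Y \<and>
    (\<forall>T. \<forall>f\<in>hom C T X. \<forall>g\<in>hom C T Y.
       \<exists>!h. h \<in> hom C T (Dom C p) \<and> p \<cdot>\<^bsub>C\<^esub> h = f \<and> q \<cdot>\<^bsub>C\<^esub> h = g)"

text \<open>Finite limits are taken in the form: terminal object and pullbacks.\<close>

definition has_finite_limits :: "('o, 'm) cat \<Rightarrow> bool" where
  "has_finite_limits C \<longleftrightarrow> (\<exists>T. is_terminal C T) \<and>
    (\<forall>f\<in>Ar C. \<forall>g\<in>Ar C. Cod C f = Cod C g \<longrightarrow> (\<exists>p q. is_pullback C f g p q))"

definition preserves_finite_limits ::
  "('o, 'm) cat \<Rightarrow> ('p, 'q) cat \<Rightarrow> ('o, 'm, 'p, 'q) cfunctor \<Rightarrow> bool" where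
  "preserves_finite_limits C D F \<longleftrightarrow>
    (\<forall>T. is_terminal C T \<longrightarrow> is_terminal D (Fob F T)) \<and>
    (\<forall>f g p q. is_pullback C f g p q \<longrightarrow>
       is_pullback D (Far F f) (Far F g) (Far F p) (Far F q))"

text \<open>A fixed, but otherwise unspecified, choice of terminal object and binary products.\<close>

definition one :: "('o, 'm) cat \<Rightarrow> 'o" where
  "one C = (SOME T. is_terminal C T)"

definition bang :: "('o, 'm) cat \<Rightarrow> 'o \<Rightarrow> 'm" where
  "bang C X = (THE f. f \<in> hom C X (one C))"

definition projections :: "('o, 'm) cat \<Rightarrow> 'o \<Rightarrow> 'o \<Rightarrow> 'm \<times> 'm" where
  "projections C X Y = (SOME (p, q). is_product C X Y p q)"

definition pr1 :: "('o, 'm) cat \<Rightarrow> 'o \<Rightarrow> 'o \<Rightarrow> 'm" where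
  "pr1 C X Y = fst (projections C X Y)"

definition pr2 :: "('o, 'm) cat \<Rightarrow> 'o \<Rightarrow> 'o \<Rightarrow> 'm" where
  "pr2 C X Y = snd (projections C X Y)"

definition prod_ob :: "('o, 'm) cat \<Rightarrow> 'o \<Rightarrow> 'o \<Rightarrow> 'o" where
  "prod_ob C X Y = Dom C (pr1 C X Y)"

definition pairing :: "('o, 'm) cat \<Rightarrow> 'm \<Rightarrow> 'm \<Rightarrow> 'm" where
  "pairing C f g = (THE h. h \<in> hom C (Dom C f) (prod_ob C (Cod C f) (Cod C g)) \<and>
     pr1 C (Cod C f) (Cod C g) \<cdot>\<^bsub>C\<^esub> h = f \<and>
     pr2 C (Cod C f) (Cod C g) \<cdot>\<^bsub>C\<^esub> h = g)"

definition prod_map :: "('o, 'm) cat \<Rightarrow> 'm \<Rightarrow> 'm \<Rightarrow> 'm" where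
  "prod_map C f g = pairing C (f \<cdot>\<^bsub>C\<^esub> pr1 C (Dom C f) (Dom C g))
                              (g \<cdot>\<^bsub>C\<^esub> pr2 C (Dom C f) (Dom C g))"

definition is_exponential :: "('o, 'm) cat \<Rightarrow> 'o \<Rightarrow> 'o \<Rightarrow> 'o \<Rightarrow> 'm \<Rightarrow> bool" where
  "is_exponential C X Y Z ev \<longleftrightarrow> Z \<in> Ob C \<and> ev \<in> hom C (prod_ob C Z X) Y \<and>
    (\<forall>W\<in>Ob C. \<forall>f\<in>hom C (prod_ob C W X) Y.
       \<exists>!g. g \<in> hom C W Z \<and> ev \<cdot>\<^bsub>C\<^esub> prod_map C g (Idn C X) = f)"


section \<open>Toposes\<close>

definition is_char :: "('o, 'm) cat \<Rightarrow> 'm \<Rightarrow> 'm \<Rightarrow> 'm \<Rightarrow> bool" where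
  "is_char C tr m \<chi> \<longleftrightarrow> is_pullback C \<chi> tr m (bang C (Dom C m))"

definition char_of :: "('o, 'm) cat \<Rightarrow> 'm \<Rightarrow> 'm \<Rightarrow> 'm" where
  "char_of C tr m = (THE \<chi>. is_char C tr m \<chi>)"

definition subobject_classifier :: "('o, 'm) cat \<Rightarrow> 'o \<Rightarrow> 'm \<Rightarrow> bool" where
  "subobject_classifier C \<Omega> tr \<longleftrightarrow> \<Omega> \<in> Ob C \<and> tr \<in> hom C (one C) \<Omega> \<and>
    (\<forall>m. monic C m \<longrightarrow> (\<exists>!\<chi>. is_char C tr m \<chi>))"

locale topos = category C for C :: "('o, 'm) cat" (structure) +
  assumes finite_limits: "has_finite_limits C"
    and exponentials: "\<lbrakk>X \<in> Ob C; Y \<in> Ob C\<rbrakk> \<Longrightarrow> \<exists>Z ev. is_exponential C X Y Z ev"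
    and classifier: "\<exists>\<Omega> tr. subobject_classifier C \<Omega> tr"

definition subobj_of :: "('o, 'm) cat \<Rightarrow> 'o \<Rightarrow> 'm \<Rightarrow> bool" where
  "subobj_of C X m \<longleftrightarrow> monic C m \<and> Cod C m = X"

text \<open>Complements in the preorder of monomorphisms into \<open>X\<close>: whatever lies below both
  \<open>m\<close> and \<open>n\<close> is a least subobject, and only the greatest subobject lies above both.\<close>

definition complementary :: "('o, 'm) cat \<Rightarrow> 'o \<Rightarrow> 'm \<Rightarrow> 'm \<Rightarrow> bool" where
  "complementary C X m n \<longleftrightarrow> subobj_of C X m \<and> subobj_of C X n \<and>
    (\<forall>s. subobj_of C X s \<and> factors_through C s m \<and> factors_through C s n \<longrightarrow>
       (\<forall>t. subobj_of C X t \<longrightarrow> factors_through C s t)) \<and>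
    (\<forall>s. subobj_of C X s \<and> factors_through C m s \<and> factors_through C n s \<longrightarrow>
       (\<forall>t. subobj_of C X t \<longrightarrow> factors_through C t s))"

locale boolean_topos = topos C for C :: "('o, 'm) cat" (structure) +
  assumes complements: "subobj_of C X m \<Longrightarrow> \<exists>n. complementary C X m n"

definition subobj_eq :: "('o, 'm) cat \<Rightarrow> ('m \<times> 'm) set" where
  "subobj_eq C = {(m, n). monic C m \<and> monic C n \<and> Cod C m = Cod C n \<and>
     (\<exists>i\<in>hom C (Dom C m) (Dom C n). iso C i \<and> n \<cdot>\<^bsub>C\<^esub> i = m)}"


section \<open>Quotients of a topos\<close>

text \<open>A geometric morphism out of a given topos, together with its codomain.\<close>

record ('o, 'm, 'p, 'q) geom =
  codomain :: "('p, 'q) cat"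
  inverse_image :: "('p, 'q, 'o, 'm) cfunctor"
  direct_image :: "('o, 'm, 'p, 'q) cfunctor"

definition geometric_morphism :: "('o, 'm) cat \<Rightarrow> ('o, 'm, 'p, 'q) geom \<Rightarrow> bool" where
  "geometric_morphism E f \<longleftrightarrow> topos E \<and> topos (codomain f) \<and>
    adjoint (codomain f) E (inverse_image f) (direct_image f) \<and>
    preserves_finite_limits (codomain f) E (inverse_image f)"

definition connected_geometric :: "('o, 'm) cat \<Rightarrow> ('o, 'm, 'p, 'q) geom \<Rightarrow> bool" where
  "connected_geometric E f \<longleftrightarrow>
    geometric_morphism E f \<and> fully_faithful (codomain f) E (inverse_image f)"

definition quotient_image :: "('o, 'm) cat \<Rightarrow> ('o, 'm, 'p, 'q) geom \<Rightarrow> 'o set" where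
  "quotient_image E f = essential_image (codomain f) E (inverse_image f)"

definition quotient_eq ::
  "('o, 'm) cat \<Rightarrow> (('o, 'm, 'p, 'q) geom \<times> ('o, 'm, 'p, 'q) geom) set" where
  "quotient_eq E = {(f, g). connected_geometric E f \<and> connected_geometric E g \<and>
     quotient_image E f = quotient_image E g}"

text \<open>HOL cannot quantify over the types carrying the codomain of a quotient. Here it is
  carried by the types of \<open>E\<close>; this loses no quotient if every connected geometric morphism,
  to a topos carried by any types, has the same essential image as one of these.\<close>

definition quotients :: "('o, 'm) cat \<Rightarrow> ('o, 'm, 'o, 'm) geom set set" where
  "quotients E = {f. connected_geometric E f} // quotient_eq E"


section \<open>Internal semilattices and filters\<close>

record ('o, 'm) slat =
  Carrier :: 'o
  Top :: 'm
  Meet :: 'm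

text \<open>The laws are stated on generalized elements \<open>x, y, z : T \<rightarrow> A\<close>.\<close>

definition internal_semilattice :: "('o, 'm) cat \<Rightarrow> ('o, 'm) slat \<Rightarrow> bool" where
  "internal_semilattice C A \<longleftrightarrow> Carrier A \<in> Ob C \<and>
    Top A \<in> hom C (one C) (Carrier A) \<and>
    Meet A \<in> hom C (prod_ob C (Carrier A) (Carrier A)) (Carrier A) \<and>
    (\<forall>T. \<forall>x\<in>hom C T (Carrier A).
       Meet A \<cdot>\<^bsub>C\<^esub> pairing C x (Top A \<cdot>\<^bsub>C\<^esub> bang C T) = x \<and>
       Meet A \<cdot>\<^bsub>C\<^esub> pairing C (Top A \<cdot>\<^bsub>C\<^esub> bang C T) x = x \<and>
       Meet A \<cdot>\<^bsub>C\<^esub> pairing C x x = x) \<and>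
    (\<forall>T. \<forall>x\<in>hom C T (Carrier A). \<forall>y\<in>hom C T (Carrier A).
       Meet A \<cdot>\<^bsub>C\<^esub> pairing C x y = Meet A \<cdot>\<^bsub>C\<^esub> pairing C y x) \<and>
    (\<forall>T. \<forall>x\<in>hom C T (Carrier A). \<forall>y\<in>hom C T (Carrier A). \<forall>z\<in>hom C T (Carrier A).
       Meet A \<cdot>\<^bsub>C\<^esub> pairing C (Meet A \<cdot>\<^bsub>C\<^esub> pairing C x y) z
         = Meet A \<cdot>\<^bsub>C\<^esub> pairing C x (Meet A \<cdot>\<^bsub>C\<^esub> pairing C y z))"

definition semilattice_hom ::
  "('o, 'm) cat \<Rightarrow> ('o, 'm) slat \<Rightarrow> ('o, 'm) slat \<Rightarrow> 'm \<Rightarrow> bool" where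
  "semilattice_hom C A B h \<longleftrightarrow> internal_semilattice C A \<and> internal_semilattice C B \<and>
    h \<in> hom C (Carrier A) (Carrier B) \<and>
    h \<cdot>\<^bsub>C\<^esub> Top A = Top B \<and>
    h \<cdot>\<^bsub>C\<^esub> Meet A = Meet B \<cdot>\<^bsub>C\<^esub> prod_map C h h"

definition internal_filter :: "('o, 'm) cat \<Rightarrow> ('o, 'm) slat \<Rightarrow> 'm \<Rightarrow> bool" where
  "internal_filter C A m \<longleftrightarrow> internal_semilattice C A \<and>
    subobj_of C (Carrier A) m \<and>
    factors_through C (Top A) m \<and>
    factors_through C (Meet A \<cdot>\<^bsub>C\<^esub> prod_map C m m) m \<and>
    (\<forall>T. \<forall>u\<in>hom C T (Dom C m). \<forall>x\<in>hom C T (Carrier A).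
       Meet A \<cdot>\<^bsub>C\<^esub> pairing C (m \<cdot>\<^bsub>C\<^esub> u) x = m \<cdot>\<^bsub>C\<^esub> u \<longrightarrow> factors_through C x m)"

definition filters :: "('o, 'm) cat \<Rightarrow> ('o, 'm) slat \<Rightarrow> 'm set set" where
  "filters C A = {m. internal_filter C A m} // subobj_eq C"

definition Omega_slat :: "('o, 'm) cat \<Rightarrow> 'o \<Rightarrow> 'm \<Rightarrow> ('o, 'm) slat" where
  "Omega_slat C \<Omega> tr =
    \<lparr>Carrier = \<Omega>, Top = tr, Meet = char_of C tr (prod_map C tr tr)\<rparr>"


section \<open>Local state classifiers\<close>

definition mono_subcat :: "('o, 'm) cat \<Rightarrow> ('o, 'm) cat" where
  "mono_subcat C = C\<lparr>Ar := {m. monic C m}\<rparr>"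

definition local_state_classifier ::
  "('o, 'm) cat \<Rightarrow> 'o \<Rightarrow> ('o \<Rightarrow> 'm) \<Rightarrow> bool" where
  "local_state_classifier C \<Xi> \<xi> \<longleftrightarrow>
    is_colimit (mono_subcat C) C \<lparr>Fob = (\<lambda>X. X), Far = (\<lambda>f. f)\<rparr> \<Xi> \<xi>"

definition Xi_meet :: "('o, 'm) cat \<Rightarrow> 'o \<Rightarrow> ('o \<Rightarrow> 'm) \<Rightarrow> 'm" where
  "Xi_meet C \<Xi> \<xi> = (THE w. w \<in> hom C (prod_ob C \<Xi> \<Xi>) \<Xi> \<and>
     (\<forall>X\<in>Ob C. \<forall>Y\<in>Ob C. w \<cdot>\<^bsub>C\<^esub> prod_map C (\<xi> X) (\<xi> Y) = \<xi> (prod_ob C X Y)))"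

definition Xi_slat :: "('o, 'm) cat \<Rightarrow> 'o \<Rightarrow> ('o \<Rightarrow> 'm) \<Rightarrow> ('o, 'm) slat" where
  "Xi_slat C \<Xi> \<xi> = \<lparr>Carrier = \<Xi>, Top = \<xi> (one C), Meet = Xi_meet C \<Xi> \<xi>\<rparr>"


section \<open>The correspondences\<close>

text \<open>An element \<open>S\<close> of \<open>filters\<close> is a class of isomorphic monomorphisms
  into \<open>\<Xi>\<close>.\<close>

definition filter_objects :: "('o, 'm) cat \<Rightarrow> ('o \<Rightarrow> 'm) \<Rightarrow> 'm set \<Rightarrow> 'o set" where
  "filter_objects C \<xi> S = {X \<in> Ob C. \<exists>k\<in>S. factors_through C (\<xi> X) k}"

definition quotient_of_filter ::
  "('o, 'm) cat \<Rightarrow> ('o \<Rightarrow> 'm) \<Rightarrow> 'm set \<Rightarrow> ('o, 'm, 'o, 'm) geom set" where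
  "quotient_of_filter C \<xi> S =
    {f. connected_geometric C f \<and> quotient_image C f = filter_objects C \<xi> S}"

definition char_of_filter :: "('o, 'm) cat \<Rightarrow> 'm \<Rightarrow> 'm set \<Rightarrow> 'm" where
  "char_of_filter C tr S = the_elem (char_of C tr ` S)"

end

theory Submission
  imports Defs
begin

text \<open>A quotient is recorded by the essential image \<open>Q\<close> of its inverse image functor. Such a
  \<open>Q\<close> is replete, closed under finite limits and coreflective
  (\<open>lex_coreflective_quotient_image\<close>). Booleanness adds one thing, closure under subobjects:
  \<open>Q\<close> contains \<open>1\<close>, and being coreflective it contains \<open>1 + 1\<close>, which is
  \<open>\<Omega>\<close> (\<open>Omega_in\<close>); now every subobject is a pullback of \<open>true : 1 \<rightarrow> \<Omega>\<close>
  (\<open>hereditary_if_lex_coreflective\<close>).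

  Let \<open>Q\<close> be coreflective, closed under finite products and under subobjects. Its coreflections
  \<open>RX \<rightarrow> X\<close> are monic, and \<open>RX\<close> is the intersection of \<open>X\<close> with \<open>RY\<close> whenever
  \<open>X\<close> is a subobject of \<open>Y\<close>. So the characteristic morphisms \<open>X \<rightarrow> \<Omega>\<close> of the
  coreflections form a cocone on the category of monomorphisms and glue to
  \<open>\<chi> : \<Xi> \<rightarrow> \<Omega>\<close> with \<open>X \<in> Q\<close> if and only if \<open>\<chi> \<xi>\<^sub>X = true\<close>. The equation
  \<open>R(X \<times> Y) = RX \<times> RY\<close> says that \<open>\<chi>\<close> preserves meets
  (\<open>hom_of_hereditary_coreflective\<close>).

  In the other direction, the graph of \<open>f : Y \<rightarrow> X\<close> is a monomorphism \<open>Y \<rightarrow> Y \<times> X\<close>, which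
  gives \<open>\<xi>\<^sub>Y \<le> \<xi>\<^sub>X f\<close> (\<open>xi_le\<close>). If \<open>\<xi>\<^sub>Y\<close> lies in a filter \<open>k\<close>, then so does
  \<open>\<xi>\<^sub>X f\<close>, that is, \<open>f\<close> factors through the pullback of \<open>k\<close> along
  \<open>\<xi>\<^sub>X\<close>. This pullback is therefore the coreflection of \<open>X\<close> into the objects selected by the
  filter (\<open>hereditary_coreflective_of_filter\<close>). The full subcategory on these objects is a topos,
  whose exponentials and subobject classifier are the coreflections of the ambient ones, and its
  inclusion is the inverse image of a connected geometric morphism
  (\<open>quotient_of_subcategory\<close>).

  Filters and homomorphisms correspond because a subobject is a filter exactly when its
  characteristic morphism is a homomorphism (\<open>filter_iff_char_hom\<close>), and a morphism
  \<open>\<Xi> \<rightarrow> \<Omega>\<close> can be recovered from the objects that it selects, since the \<open>\<xi>\<^sub>X\<close> are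
  jointly epic and invariant under passage to subobjects (\<open>hom_determined_by_objects\<close>).\<close>

section \<open>Finite limits\<close>

text \<open>Composites are normalized to the right, with typing conditions expressed through domains and
  codomains, so that the simplifier can discharge them.\<close>

lemma hom_iff [simp]: "f \<in> hom C X Y \<longleftrightarrow> f \<in> Ar C \<and> Dom C f = X \<and> Cod C f = Y"
  by (simp add: hom_def)

context category
begin

declare dom_ob [simp] cod_ob [simp]

lemma hom_obD: "f \<in> hom C X Y \<Longrightarrow> X \<in> Ob C \<and> Y \<in> Ob C"
  by auto

lemma comp_simps [simp]:
  assumes "f \<in> Ar C" "g \<in> Ar C" "Dom C g = Cod C f"
  shows "g \<cdot> f \<in> Ar C" "Dom C (g \<cdot> f) = Dom C f" "Cod C (g \<cdot> f) = Cod C g"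
  using comp_hom [of f "Dom C f" "Cod C f" g "Cod C g"] assms by auto

lemma id_simps [simp]:
  assumes "X \<in> Ob C"
  shows "Idn C X \<in> Ar C" "Dom C (Idn C X) = X" "Cod C (Idn C X) = X"
  using id_hom [OF assms] by auto

lemma idn_comp [simp]: "f \<in> Ar C \<Longrightarrow> Cod C f = Y \<Longrightarrow> Idn C Y \<cdot> f = f"
  by (rule id_left [of f "Dom C f"]) simp

lemma comp_idn [simp]: "f \<in> Ar C \<Longrightarrow> Dom C f = X \<Longrightarrow> f \<cdot> Idn C X = f"
  by (rule id_right [of f _ "Cod C f"]) simp

lemma assoc [simp]:
  "\<lbrakk>f \<in> Ar C; g \<in> Ar C; h \<in> Ar C; Dom C g = Cod C f; Dom C h = Cod C g\<rbrakk>
    \<Longrightarrow> (h \<cdot> g) \<cdot> f = h \<cdot> (g \<cdot> f)"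
  by (rule comp_assoc) auto

text \<open>In a right-nested composite \<open>g \<cdot> (f \<cdot> x)\<close> an equation for \<open>g \<cdot> f\<close> no longer matches; this
  rule applies it there.\<close>

lemma comp_cong_left:
  assumes "g \<cdot> f = h" "f \<in> Ar C" "g \<in> Ar C" "Dom C g = Cod C f" "x \<in> Ar C" "Cod C x = Dom C f"
  shows "g \<cdot> (f \<cdot> x) = h \<cdot> x"
  using assms by (metis assoc)

lemma monicD: "\<lbrakk>monic C m; f \<in> Ar C; g \<in> Ar C; Cod C f = Dom C m; Cod C g = Dom C m;
    Dom C f = Dom C g; m \<cdot> f = m \<cdot> g\<rbrakk> \<Longrightarrow> f = g"
  unfolding monic_def by auto

lemma monic_Ar [simp]: "monic C m \<Longrightarrow> m \<in> Ar C"
  by (simp add: monic_def)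

lemma monicI:
  assumes "m \<in> Ar C"
    and "\<And>f g. \<lbrakk>f \<in> Ar C; g \<in> Ar C; Cod C f = Dom C m; Cod C g = Dom C m; Dom C f = Dom C g;
      m \<cdot> f = m \<cdot> g\<rbrakk> \<Longrightarrow> f = g"
  shows "monic C m"
  using assms unfolding monic_def by auto

lemma monic_comp:
  assumes "monic C m" "monic C n" "Dom C n = Cod C m"
  shows "monic C (n \<cdot> m)"
proof (rule monicI)
  fix f g
  assume fg: "f \<in> Ar C" "g \<in> Ar C" "Cod C f = Dom C (n \<cdot> m)" "Cod C g = Dom C (n \<cdot> m)"
    "Dom C f = Dom C g" "(n \<cdot> m) \<cdot> f = (n \<cdot> m) \<cdot> g"
  with assms have "n \<cdot> (m \<cdot> f) = n \<cdot> (m \<cdot> g)" by simp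
  then have "m \<cdot> f = m \<cdot> g" using fg assms by - (rule monicD [OF assms(2)], auto)
  then show "f = g" using fg assms by - (rule monicD [OF assms(1)], auto)
qed (use assms in auto)

lemma monic_cancel:
  assumes "monic C (n \<cdot> m)" "m \<in> Ar C" "n \<in> Ar C" "Dom C n = Cod C m"
  shows "monic C m"
proof (rule monicI)
  fix f g
  assume fg: "f \<in> Ar C" "g \<in> Ar C" "Cod C f = Dom C m" "Cod C g = Dom C m"
    "Dom C f = Dom C g" "m \<cdot> f = m \<cdot> g"
  then have "(n \<cdot> m) \<cdot> f = (n \<cdot> m) \<cdot> g" using assms by simp
  then show "f = g" using fg assms by - (rule monicD [OF assms(1)], auto)
qed (use assms in auto)

lemma monic_id: "X \<in> Ob C \<Longrightarrow> monic C (Idn C X)"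
  by (rule monicI) auto

lemma monic_section:
  assumes "r \<cdot> s = Idn C X" "s \<in> Ar C" "r \<in> Ar C" "Dom C r = Cod C s" "X \<in> Ob C"
  shows "monic C s"
  using monic_cancel [of r s] monic_id assms by simp

lemma factors_throughI: "\<lbrakk>m \<cdot> g = f; g \<in> Ar C; Dom C g = Dom C f; Cod C g = Dom C m\<rbrakk>
    \<Longrightarrow> factors_through C f m"
  unfolding factors_through_def by auto

lemma factors_throughE:
  assumes "factors_through C f m"
  obtains g where "g \<in> Ar C" "Dom C g = Dom C f" "Cod C g = Dom C m" "m \<cdot> g = f"
  using assms unfolding factors_through_def by auto

lemma factors_through_comp:
  assumes "factors_through C f m" "m \<in> Ar C" "h \<in> Ar C" "Cod C h = Dom C f"
  shows "factors_through C (f \<cdot> h) m"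
proof -
  obtain g where g: "g \<in> Ar C" "Dom C g = Dom C f" "Cod C g = Dom C m" "m \<cdot> g = f"
    using assms(1) by (rule factors_throughE)
  show ?thesis by (rule factors_throughI [of _ "g \<cdot> h"]) (use g assms in auto)
qed

lemma pullback_simps:
  assumes "is_pullback C f g p q"
  shows "f \<in> Ar C" "g \<in> Ar C" "p \<in> Ar C" "q \<in> Ar C" "Cod C g = Cod C f" "Cod C p = Dom C f"
    "Cod C q = Dom C g" "Dom C q = Dom C p" "f \<cdot> p = g \<cdot> q"
  using assms unfolding is_pullback_def by auto

lemma pullback_lift:
  assumes "is_pullback C f g p q" "a \<in> Ar C" "b \<in> Ar C" "Cod C a = Dom C f" "Cod C b = Dom C g"
    "Dom C a = Dom C b" "f \<cdot> a = g \<cdot> b"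
  obtains u where "u \<in> Ar C" "Dom C u = Dom C a" "Cod C u = Dom C p" "p \<cdot> u = a" "q \<cdot> u = b"
  using assms unfolding is_pullback_def by force

lemma pullback_unique:
  assumes "is_pullback C f g p q" "u \<in> Ar C" "v \<in> Ar C" "Cod C u = Dom C p" "Cod C v = Dom C p"
    "Dom C u = Dom C v" "p \<cdot> u = p \<cdot> v" "q \<cdot> u = q \<cdot> v"
  shows "u = v"
proof -
  note pb = pullback_simps [OF assms(1)]
  have "f \<cdot> (p \<cdot> u) = g \<cdot> (q \<cdot> u)"
    using pb assms by (metis assoc)
  moreover have "p \<cdot> u \<in> hom C (Dom C u) (Dom C f)" "q \<cdot> u \<in> hom C (Dom C u) (Dom C g)"
    using pb assms by auto
  ultimately have "\<exists>!w. w \<in> hom C (Dom C u) (Dom C p) \<and> p \<cdot> w = p \<cdot> u \<and> q \<cdot> w = q \<cdot> u"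
    using assms(1) unfolding is_pullback_def by blast
  then show ?thesis using assms by (metis hom_iff)
qed

lemma pullback_monic:
  assumes "is_pullback C f g p q" "monic C g"
  shows "monic C p"
proof (rule monicI)
  note pb = pullback_simps [OF assms(1)]
  show "p \<in> Ar C" using pb by simp
  fix u v
  assume uv: "u \<in> Ar C" "v \<in> Ar C" "Cod C u = Dom C p" "Cod C v = Dom C p"
    "Dom C u = Dom C v" "p \<cdot> u = p \<cdot> v"
  have "g \<cdot> (q \<cdot> u) = g \<cdot> (q \<cdot> v)"
    using pb uv by (metis assoc)
  then have "q \<cdot> u = q \<cdot> v" using pb uv by - (rule monicD [OF assms(2)], auto)
  then show "u = v" using uv by - (rule pullback_unique [OF assms(1)], auto)
qed

lemma pullback_sym:
  assumes "is_pullback C f g p q"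
  shows "is_pullback C g f q p"
  unfolding is_pullback_def
proof (intro conjI allI ballI impI)
  note pb = pullback_simps [OF assms]
  fix T a b
  assume ab: "a \<in> hom C T (Dom C g)" "b \<in> hom C T (Dom C f)" "g \<cdot> a = f \<cdot> b"
  then have "\<exists>!u. u \<in> hom C T (Dom C p) \<and> p \<cdot> u = b \<and> q \<cdot> u = a"
    using assms unfolding is_pullback_def by metis
  then show "\<exists>!u. u \<in> hom C T (Dom C q) \<and> q \<cdot> u = a \<and> p \<cdot> u = b"
    unfolding pb by (simp only: conj_ac)
qed (use pullback_simps [OF assms] in simp_all)

lemma isomorphicE:
  assumes "isomorphic C X Y"
  obtains i j where "i \<in> Ar C" "Dom C i = X" "Cod C i = Y" "j \<in> Ar C" "Dom C j = Y" "Cod C j = X"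
    "j \<cdot> i = Idn C X" "i \<cdot> j = Idn C Y"
  using assms unfolding isomorphic_def iso_def by auto

lemma isomorphicI:
  assumes "i \<in> Ar C" "Dom C i = X" "Cod C i = Y" "j \<in> Ar C" "Dom C j = Y" "Cod C j = X"
    "j \<cdot> i = Idn C X" "i \<cdot> j = Idn C Y"
  shows "isomorphic C X Y"
  unfolding isomorphic_def iso_def
  by (rule bexI [of _ i], rule conjI, use assms in simp, rule bexI [of _ j]) (use assms in auto)

end

locale finlim_category = category C for C :: "('o, 'm) cat" (structure) +
  assumes fin_limits: "has_finite_limits C"

sublocale topos \<subseteq> finlim_category
  by unfold_locales (rule finite_limits)

context finlim_category
begin

lemma one_terminal: "is_terminal C (one C)"
  using fin_limits unfolding has_finite_limits_def one_def by (metis someI_ex)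

lemma one_ob [simp]: "one C \<in> Ob C"
  using one_terminal by (simp add: is_terminal_def)

lemma bang_hom: "X \<in> Ob C \<Longrightarrow> bang C X \<in> hom C X (one C)"
  unfolding bang_def by (rule theI') (use one_terminal in \<open>auto simp: is_terminal_def\<close>)

lemma bang_simps [simp]:
  assumes "X \<in> Ob C"
  shows "bang C X \<in> Ar C" "Dom C (bang C X) = X" "Cod C (bang C X) = one C"
  using bang_hom [OF assms] by auto

lemma to_one_eq: "\<lbrakk>f \<in> Ar C; Cod C f = one C\<rbrakk> \<Longrightarrow> f = bang C (Dom C f)"
  using one_terminal bang_simps [of "Dom C f"] dom_ob [of f]
  unfolding is_terminal_def by (metis hom_iff)

lemma bang_comp [simp]: "\<lbrakk>f \<in> Ar C; Cod C f = X\<rbrakk> \<Longrightarrow> bang C X \<cdot> f = bang C (Dom C f)"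
  using to_one_eq [of "bang C X \<cdot> f"] by auto

lemma bang_one: "bang C (one C) = Idn C (one C)"
  using to_one_eq [of "Idn C (one C)"] by simp

lemma monic_from_one:
  assumes "f \<in> Ar C" "Dom C f = one C"
  shows "monic C f"
  by (rule monicI) (use assms in \<open>simp, metis to_one_eq\<close>)

lemma pullback_ex:
  assumes "f \<in> Ar C" "g \<in> Ar C" "Cod C f = Cod C g"
  obtains p q where "is_pullback C f g p q"
  using assms fin_limits unfolding has_finite_limits_def by blast

lemma product_ex:
  assumes X: "X \<in> Ob C" and Y: "Y \<in> Ob C"
  shows "\<exists>p q. is_product C X Y p q"
proof -
  obtain p q where pq: "is_pullback C (bang C X) (bang C Y) p q"
    by (rule pullback_ex [of "bang C X" "bang C Y"]) (use assms in simp_all)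
  have "is_product C X Y p q"
    unfolding is_product_def
  proof (intro conjI allI ballI)
    show "p \<in> hom C (Dom C p) X" "q \<in> hom C (Dom C p) Y"
      using pullback_simps [OF pq] assms by simp_all
    fix T f g assume fg: "f \<in> hom C T X" "g \<in> hom C T Y"
    then have "bang C X \<cdot> f = bang C Y \<cdot> g" by simp
    moreover have "f \<in> hom C T (Dom C (bang C X))" "g \<in> hom C T (Dom C (bang C Y))"
      using fg assms by simp_all
    ultimately show "\<exists>!h. h \<in> hom C T (Dom C p) \<and> p \<cdot> h = f \<and> q \<cdot> h = g"
      using pq unfolding is_pullback_def by blast
  qed
  then show ?thesis by blast
qed

lemma projections: "\<lbrakk>X \<in> Ob C; Y \<in> Ob C\<rbrakk> \<Longrightarrow> is_product C X Y (pr1 C X Y) (pr2 C X Y)"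
  using someI_ex [of "\<lambda>z. case z of (p, q) \<Rightarrow> is_product C X Y p q"] product_ex [of X Y]
  unfolding pr1_def pr2_def projections_def by (simp add: case_prod_unfold)

lemma pr_simps [simp]:
  assumes "X \<in> Ob C" "Y \<in> Ob C"
  shows "pr1 C X Y \<in> Ar C" "pr2 C X Y \<in> Ar C" "Dom C (pr1 C X Y) = prod_ob C X Y"
    "Dom C (pr2 C X Y) = prod_ob C X Y" "Cod C (pr1 C X Y) = X" "Cod C (pr2 C X Y) = Y"
    "prod_ob C X Y \<in> Ob C"
  using projections [OF assms] dom_ob unfolding is_product_def prod_ob_def by auto

lemma pairing_ex1:
  assumes "f \<in> Ar C" "g \<in> Ar C" "Dom C f = Dom C g"
  shows "\<exists>!h. h \<in> hom C (Dom C f) (prod_ob C (Cod C f) (Cod C g)) \<and>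
     pr1 C (Cod C f) (Cod C g) \<cdot> h = f \<and> pr2 C (Cod C f) (Cod C g) \<cdot> h = g"
  using projections [of "Cod C f" "Cod C g"] assms
  unfolding is_product_def prod_ob_def by auto

lemma pairing_simps [simp]:
  assumes "f \<in> Ar C" "g \<in> Ar C" "Dom C f = Dom C g"
  shows "pairing C f g \<in> Ar C" "Dom C (pairing C f g) = Dom C g"
    "Cod C (pairing C f g) = prod_ob C (Cod C f) (Cod C g)"
  using theI' [OF pairing_ex1 [OF assms]] assms unfolding pairing_def by auto

lemma pr_pairing [simp]:
  assumes "f \<in> Ar C" "g \<in> Ar C" "Dom C f = Dom C g" "Cod C f = X" "Cod C g = Y"
  shows "pr1 C X Y \<cdot> pairing C f g = f" "pr2 C X Y \<cdot> pairing C f g = g"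
  using theI' [OF pairing_ex1 [OF assms(1-3)]] assms unfolding pairing_def by auto

lemma prod_ext:
  assumes "f \<in> Ar C" "g \<in> Ar C" "Dom C f = Dom C g" "Cod C f = prod_ob C X Y"
    "Cod C g = prod_ob C X Y" "X \<in> Ob C" "Y \<in> Ob C"
    "pr1 C X Y \<cdot> f = pr1 C X Y \<cdot> g" "pr2 C X Y \<cdot> f = pr2 C X Y \<cdot> g"
  shows "f = g"
  using pairing_ex1 [of "pr1 C X Y \<cdot> g" "pr2 C X Y \<cdot> g"] assms by auto

lemma pairing_comp [simp]:
  assumes "f \<in> Ar C" "g \<in> Ar C" "Dom C f = Dom C g" "h \<in> Ar C" "Cod C h = Dom C g"
  shows "pairing C f g \<cdot> h = pairing C (f \<cdot> h) (g \<cdot> h)"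
proof (rule prod_ext [of _ _ "Cod C f" "Cod C g"])
  show "pr1 C (Cod C f) (Cod C g) \<cdot> (pairing C f g \<cdot> h)
      = pr1 C (Cod C f) (Cod C g) \<cdot> pairing C (f \<cdot> h) (g \<cdot> h)"
    using assms comp_cong_left [of "pr1 C (Cod C f) (Cod C g)" "pairing C f g" f h] by simp
  show "pr2 C (Cod C f) (Cod C g) \<cdot> (pairing C f g \<cdot> h)
      = pr2 C (Cod C f) (Cod C g) \<cdot> pairing C (f \<cdot> h) (g \<cdot> h)"
    using assms comp_cong_left [of "pr2 C (Cod C f) (Cod C g)" "pairing C f g" g h] by simp
qed (use assms in auto)

lemma pairing_eta: "\<lbrakk>X \<in> Ob C; Y \<in> Ob C; f \<in> Ar C; Cod C f = prod_ob C X Y\<rbrakk>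
    \<Longrightarrow> pairing C (pr1 C X Y \<cdot> f) (pr2 C X Y \<cdot> f) = f"
  by - (rule prod_ext [of _ _ X Y], auto)

lemma pairing_pr [simp]: "\<lbrakk>X \<in> Ob C; Y \<in> Ob C\<rbrakk>
    \<Longrightarrow> pairing C (pr1 C X Y) (pr2 C X Y) = Idn C (prod_ob C X Y)"
  by - (rule prod_ext [of _ _ X Y], auto)

lemma pairing_inject:
  assumes "pairing C f g = pairing C f' g'" "f \<in> Ar C" "g \<in> Ar C" "Dom C f = Dom C g"
    "f' \<in> Ar C" "g' \<in> Ar C" "Dom C f' = Dom C g'" "Cod C f' = Cod C f" "Cod C g' = Cod C g"
  shows "f = f'" "g = g'"
  using assms by (metis pr_pairing(1), metis pr_pairing(2))

lemma prod_map_simps [simp]: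
  assumes "f \<in> Ar C" "g \<in> Ar C"
  shows "prod_map C f g \<in> Ar C" "Dom C (prod_map C f g) = prod_ob C (Dom C f) (Dom C g)"
    "Cod C (prod_map C f g) = prod_ob C (Cod C f) (Cod C g)"
  using assms unfolding prod_map_def by auto

lemma prod_map_pairing [simp]:
  assumes "f \<in> Ar C" "g \<in> Ar C" "x \<in> Ar C" "y \<in> Ar C" "Dom C x = Dom C y"
    "Cod C x = Dom C f" "Cod C y = Dom C g"
  shows "prod_map C f g \<cdot> pairing C x y = pairing C (f \<cdot> x) (g \<cdot> y)"
  using assms unfolding prod_map_def by simp

lemma monic_pairing_left:
  assumes "monic C f" "g \<in> Ar C" "Dom C f = Dom C g"
  shows "monic C (pairing C f g)"
  by (rule monic_cancel [of "pr1 C (Cod C f) (Cod C g)"]) (use assms in auto)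

lemma monic_prod_map:
  assumes "monic C f" "monic C g"
  shows "monic C (prod_map C f g)"
proof (rule monicI)
  fix u v
  assume uv: "u \<in> Ar C" "v \<in> Ar C" "Cod C u = Dom C (prod_map C f g)"
    "Cod C v = Dom C (prod_map C f g)" "Dom C u = Dom C v"
    "prod_map C f g \<cdot> u = prod_map C f g \<cdot> v"
  let ?p = "pr1 C (Dom C f) (Dom C g)" and ?q = "pr2 C (Dom C f) (Dom C g)"
  have eq: "pairing C (f \<cdot> (?p \<cdot> u)) (g \<cdot> (?q \<cdot> u)) = pairing C (f \<cdot> (?p \<cdot> v)) (g \<cdot> (?q \<cdot> v))"
    using uv assms by (simp add: prod_map_def)
  have "f \<cdot> (?p \<cdot> u) = f \<cdot> (?p \<cdot> v)" "g \<cdot> (?q \<cdot> u) = g \<cdot> (?q \<cdot> v)"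
    using pairing_inject [OF eq] uv assms by auto
  then have "?p \<cdot> u = ?p \<cdot> v" "?q \<cdot> u = ?q \<cdot> v"
    using uv assms monicD [of f] monicD [of g] by auto
  then show "u = v" using uv assms by - (rule prod_ext [of u v "Dom C f" "Dom C g"], auto)
qed (use assms in auto)

text \<open>A pullback is a subobject of a product, so closure under products and subobjects gives
  closure under pullbacks.\<close>

lemma pullback_pairing_monic:
  assumes pb: "is_pullback C f g p q"
  shows "monic C (pairing C p q)"
proof (rule monicI)
  note pbs = pullback_simps [OF pb]
  show "pairing C p q \<in> Ar C" using pbs by simp
  fix a b
  assume ab: "a \<in> Ar C" "b \<in> Ar C" "Cod C a = Dom C (pairing C p q)"
    "Cod C b = Dom C (pairing C p q)" "Dom C a = Dom C b" "pairing C p q \<cdot> a = pairing C p q \<cdot> b"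
  have eq: "pairing C (p \<cdot> a) (q \<cdot> a) = pairing C (p \<cdot> b) (q \<cdot> b)"
    using ab pbs by simp
  have "p \<cdot> a = p \<cdot> b" by (rule pairing_inject(1) [OF eq]) (use ab pbs in simp_all)
  moreover have "q \<cdot> a = q \<cdot> b" by (rule pairing_inject(2) [OF eq]) (use ab pbs in simp_all)
  ultimately show "a = b" by - (rule pullback_unique [OF pb], use ab pbs in simp_all)
qed

text \<open>Evaluation of an equation between morphisms out of a product at a pair of generalized
  elements.\<close>

lemma prod_map_eqD:
  assumes "w \<cdot> prod_map C a b = c" "a \<in> Ar C" "b \<in> Ar C" "w \<in> Ar C"
    "Dom C w = prod_ob C (Cod C a) (Cod C b)"
    "x \<in> Ar C" "y \<in> Ar C" "Dom C x = Dom C y" "Cod C x = Dom C a" "Cod C y = Dom C b"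
  shows "w \<cdot> pairing C (a \<cdot> x) (b \<cdot> y) = c \<cdot> pairing C x y"
proof -
  have "w \<cdot> pairing C (a \<cdot> x) (b \<cdot> y) = w \<cdot> (prod_map C a b \<cdot> pairing C x y)"
    using assms by simp
  also have "\<dots> = c \<cdot> pairing C x y"
    by (rule comp_cong_left) (use assms in simp_all)
  finally show ?thesis .
qed

lemma prod_map_idn_comp:
  assumes "w \<cdot> prod_map C c (Idn C Y) = k" "f \<in> Ar C" "c \<in> Ar C" "Dom C c = Cod C f" "Y \<in> Ob C"
    "w \<in> Ar C" "Dom C w = prod_ob C (Cod C c) Y"
  shows "w \<cdot> prod_map C (c \<cdot> f) (Idn C Y) = k \<cdot> prod_map C f (Idn C Y)"
proof -
  have "prod_map C (c \<cdot> f) (Idn C Y) = prod_map C c (Idn C Y) \<cdot> prod_map C f (Idn C Y)"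
    using assms(2-5) by (simp add: prod_map_def)
  moreover have "w \<cdot> (prod_map C c (Idn C Y) \<cdot> prod_map C f (Idn C Y)) = k \<cdot> prod_map C f (Idn C Y)"
    by (rule comp_cong_left [OF assms(1)]) (use assms(2-7) in simp_all)
  ultimately show ?thesis by simp
qed

lemma equalizer_ex:
  assumes "f \<in> Ar C" "g \<in> Ar C" "Dom C f = Dom C g" "Cod C f = Cod C g"
  obtains e where "monic C e" "Cod C e = Dom C f" "f \<cdot> e = g \<cdot> e"
    "\<And>h. \<lbrakk>h \<in> Ar C; Cod C h = Dom C f; f \<cdot> h = g \<cdot> h\<rbrakk> \<Longrightarrow> factors_through C h e"
proof -
  define d where "d = pairing C (Idn C (Cod C g)) (Idn C (Cod C g))"
  have d: "d \<in> Ar C" "Dom C d = Cod C g" "Cod C d = prod_ob C (Cod C g) (Cod C g)" "monic C d"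
    using assms monic_pairing_left monic_id by (auto simp: d_def)
  have dc: "d \<cdot> x = pairing C x x" if "x \<in> Ar C" "Cod C x = Cod C g" for x
    using that assms by (simp add: d_def)
  \<comment> \<open>The equalizer is the preimage of the diagonal.\<close>
  obtain e q where pb: "is_pullback C (pairing C f g) d e q"
    by (rule pullback_ex [of "pairing C f g" d]) (use assms d in simp_all)
  note pbs = pullback_simps [OF pb]
  have "pairing C (f \<cdot> e) (g \<cdot> e) = pairing C q q"
    using pbs assms d dc by simp
  then have eq: "f \<cdot> e = q" "g \<cdot> e = q"
    using pairing_inject [of "f \<cdot> e" "g \<cdot> e" q q] pbs assms d by auto
  show ?thesis
  proof (rule that [of e])
    show "monic C e" by (rule pullback_monic [OF pb d(4)])
    show "Cod C e = Dom C f" using pbs assms by simp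
    show "f \<cdot> e = g \<cdot> e" using eq by simp
    fix h assume h: "h \<in> Ar C" "Cod C h = Dom C f" "f \<cdot> h = g \<cdot> h"
    obtain u where "u \<in> Ar C" "Dom C u = Dom C h" "Cod C u = Dom C e" "e \<cdot> u = h"
      by (rule pullback_lift [OF pb, of h "f \<cdot> h"]) (use h assms d dc in auto)
    then show "factors_through C h e" by - (rule factors_throughI, auto)
  qed
qed

end

section \<open>Internal semilattices\<close>

context finlim_category
begin

lemma internal_semilatticeI:
  assumes "Carrier A \<in> Ob C" "Top A \<in> hom C (one C) (Carrier A)"
    "Meet A \<in> hom C (prod_ob C (Carrier A) (Carrier A)) (Carrier A)"
    and unit: "\<And>x. \<lbrakk>x \<in> Ar C; Cod C x = Carrier A\<rbrakk>
      \<Longrightarrow> Meet A \<cdot> pairing C x (Top A \<cdot> bang C (Dom C x)) = x"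
    and idem: "\<And>x. \<lbrakk>x \<in> Ar C; Cod C x = Carrier A\<rbrakk> \<Longrightarrow> Meet A \<cdot> pairing C x x = x"
    and comm: "\<And>x y. \<lbrakk>x \<in> Ar C; Cod C x = Carrier A; y \<in> Ar C; Dom C y = Dom C x;
      Cod C y = Carrier A\<rbrakk> \<Longrightarrow> Meet A \<cdot> pairing C x y = Meet A \<cdot> pairing C y x"
    and ass: "\<And>x y z. \<lbrakk>x \<in> Ar C; Cod C x = Carrier A; y \<in> Ar C; Dom C y = Dom C x;
      Cod C y = Carrier A; z \<in> Ar C; Dom C z = Dom C x; Cod C z = Carrier A\<rbrakk>
      \<Longrightarrow> Meet A \<cdot> pairing C (Meet A \<cdot> pairing C x y) z
        = Meet A \<cdot> pairing C x (Meet A \<cdot> pairing C y z)"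
  shows "internal_semilattice C A"
  unfolding internal_semilattice_def
proof (intro conjI allI ballI)
  fix T x assume x: "x \<in> hom C T (Carrier A)"
  have "Meet A \<cdot> pairing C (Top A \<cdot> bang C (Dom C x)) x
      = Meet A \<cdot> pairing C x (Top A \<cdot> bang C (Dom C x))"
    by (rule comm) (use x hom_obD [OF x] assms(1-3) in simp_all)
  then show "Meet A \<cdot> pairing C (Top A \<cdot> bang C T) x = x"
    using unit [of x] x by simp
qed (use assms(1-3) unit idem comm ass in simp_all)

lemma slat_simps:
  assumes "internal_semilattice C A"
  shows "Carrier A \<in> Ob C" "Top A \<in> Ar C" "Dom C (Top A) = one C" "Cod C (Top A) = Carrier A"
    "Meet A \<in> Ar C" "Dom C (Meet A) = prod_ob C (Carrier A) (Carrier A)"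
    "Cod C (Meet A) = Carrier A"
  using assms unfolding internal_semilattice_def hom_iff by blast+

lemma slat_laws:
  assumes "internal_semilattice C A" "x \<in> Ar C" "y \<in> Ar C" "z \<in> Ar C" "Dom C y = Dom C x"
    "Dom C z = Dom C x" "Cod C x = Carrier A" "Cod C y = Carrier A" "Cod C z = Carrier A"
  shows "Meet A \<cdot> pairing C x x = x" "Meet A \<cdot> pairing C x y = Meet A \<cdot> pairing C y x"
    "Meet A \<cdot> pairing C (Meet A \<cdot> pairing C x y) z = Meet A \<cdot> pairing C x (Meet A \<cdot> pairing C y z)"
proof -
  have "x \<in> hom C (Dom C x) (Carrier A)" "y \<in> hom C (Dom C x) (Carrier A)"
    "z \<in> hom C (Dom C x) (Carrier A)"
    using assms by simp_all
  then show "Meet A \<cdot> pairing C x x = x" "Meet A \<cdot> pairing C x y = Meet A \<cdot> pairing C y x"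
    "Meet A \<cdot> pairing C (Meet A \<cdot> pairing C x y) z = Meet A \<cdot> pairing C x (Meet A \<cdot> pairing C y z)"
    using assms(1) unfolding internal_semilattice_def by blast+
qed

lemma slat_absorb:
  assumes A: "internal_semilattice C A" and "x \<in> Ar C" "y \<in> Ar C" "Dom C x = Dom C y"
    "Cod C x = Carrier A" "Cod C y = Carrier A"
  shows "Meet A \<cdot> pairing C (Meet A \<cdot> pairing C x y) y = Meet A \<cdot> pairing C x y"
proof -
  have "Meet A \<cdot> pairing C (Meet A \<cdot> pairing C x y) y = Meet A \<cdot> pairing C x (Meet A \<cdot> pairing C y y)"
    by (rule slat_laws(3) [OF A]) (use assms in simp_all)
  also have "Meet A \<cdot> pairing C y y = y"
    by (rule slat_laws(1) [OF A, of y y y]) (use assms in simp_all)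
  finally show ?thesis .
qed

end

section \<open>Truth values\<close>

locale classified_topos = topos C for C :: "('o, 'm) cat" (structure) +
  fixes \<Omega> :: 'o and tr :: 'm
  assumes classifies: "subobject_classifier C \<Omega> tr"
begin

lemma tr_simps [simp]: "\<Omega> \<in> Ob C" "tr \<in> Ar C" "Dom C tr = one C" "Cod C tr = \<Omega>"
  using classifies by (simp_all add: subobject_classifier_def)

text \<open>Being a pullback of \<open>true\<close> is a statement about factorization only, because morphisms to
  \<open>1\<close> carry no information and factorizations through a monomorphism are unique.\<close>

lemma is_charI:
  assumes "monic C m" "\<chi> \<in> Ar C" "Dom C \<chi> = Cod C m" "Cod C \<chi> = \<Omega>"
    and *: "\<And>f. \<lbrakk>f \<in> Ar C; Cod C f = Cod C m\<rbrakk>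
      \<Longrightarrow> \<chi> \<cdot> f = tr \<cdot> bang C (Dom C f) \<longleftrightarrow> factors_through C f m"
  shows "is_char C tr m \<chi>"
  unfolding is_char_def is_pullback_def
proof (intro conjI allI ballI impI)
  have "factors_through C m m"
    by (rule factors_throughI [of m "Idn C (Dom C m)"]) (use assms(1) in simp_all)
  then show "\<chi> \<cdot> m = tr \<cdot> bang C (Dom C m)"
    using * [of m] assms(1) by simp
  fix T p q
  assume pq: "p \<in> hom C T (Dom C \<chi>)" "q \<in> hom C T (Dom C tr)" "\<chi> \<cdot> p = tr \<cdot> q"
  then have q: "q = bang C T"
    using to_one_eq [of q] by simp
  have "factors_through C p m"
    using * [of p] pq q assms by simp
  then obtain u where u: "u \<in> Ar C" "Dom C u = Dom C p" "Cod C u = Dom C m" "m \<cdot> u = p"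
    by (rule factors_throughE)
  show "\<exists>!u. u \<in> hom C T (Dom C m) \<and> m \<cdot> u = p \<and> bang C (Dom C m) \<cdot> u = q"
  proof (rule ex1I [of _ u])
    show "u \<in> hom C T (Dom C m) \<and> m \<cdot> u = p \<and> bang C (Dom C m) \<cdot> u = q"
      using u pq q by simp
    fix v assume "v \<in> hom C T (Dom C m) \<and> m \<cdot> v = p \<and> bang C (Dom C m) \<cdot> v = q"
    then show "v = u"
      using u pq by - (rule monicD [OF assms(1)], simp_all)
  qed
qed (use assms in simp_all)

lemma char_is_char: "monic C m \<Longrightarrow> is_char C tr m (char_of C tr m)"
  unfolding char_of_def by (rule theI') (use classifies in \<open>simp add: subobject_classifier_def\<close>)

lemma char_unique: "\<lbrakk>monic C m; is_char C tr m \<chi>\<rbrakk> \<Longrightarrow> char_of C tr m = \<chi>"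
  using char_is_char [of m] classifies unfolding subobject_classifier_def by blast

lemma char_simps [simp]:
  assumes "monic C m"
  shows "char_of C tr m \<in> Ar C" "Dom C (char_of C tr m) = Cod C m" "Cod C (char_of C tr m) = \<Omega>"
  using pullback_simps [OF char_is_char [OF assms, unfolded is_char_def]] assms by simp_all

text \<open>A generalized element \<open>f\<close> belongs to the subobject \<open>m\<close> exactly when
  the truth value of \<open>f \<in> m\<close> is true; this turns subobject calculations into propositional ones.\<close>

lemma char_true_iff:
  assumes "monic C m" "f \<in> Ar C" "Cod C f = Cod C m"
  shows "char_of C tr m \<cdot> f = tr \<cdot> bang C (Dom C f) \<longleftrightarrow> factors_through C f m"
proof
  note pb = char_is_char [OF assms(1), unfolded is_char_def]
  {
    assume "char_of C tr m \<cdot> f = tr \<cdot> bang C (Dom C f)"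
    then obtain u where "u \<in> Ar C" "Dom C u = Dom C f" "Cod C u = Dom C m" "m \<cdot> u = f"
      using assms by - (rule pullback_lift [OF pb, of f "bang C (Dom C f)"], simp_all)
    then show "factors_through C f m"
      by - (rule factors_throughI)
  next
    assume "factors_through C f m"
    then obtain u where u: "u \<in> Ar C" "Dom C u = Dom C f" "Cod C u = Dom C m" "m \<cdot> u = f"
      by (rule factors_throughE)
    have "char_of C tr m \<cdot> (m \<cdot> u) = (tr \<cdot> bang C (Dom C m)) \<cdot> u"
      by (rule comp_cong_left) (use pullback_simps [OF pb] u assms in simp_all)
    then show "char_of C tr m \<cdot> f = tr \<cdot> bang C (Dom C f)"
      using u assms by simp
  }
qed

lemma subobject_of_char:
  assumes "\<chi> \<in> Ar C" "Cod C \<chi> = \<Omega>"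
  obtains m where "monic C m" "Cod C m = Dom C \<chi>" "char_of C tr m = \<chi>"
proof -
  obtain m q where pb: "is_pullback C \<chi> tr m q"
    by (rule pullback_ex [of \<chi> tr]) (use assms in simp_all)
  have q: "q = bang C (Dom C m)"
    using pullback_simps [OF pb] to_one_eq [of q] by simp
  have m: "monic C m"
    by (rule pullback_monic [OF pb]) (rule monic_from_one, simp_all)
  show ?thesis
  proof (rule that [OF m])
    show "Cod C m = Dom C \<chi>"
      using pullback_simps [OF pb] by simp
    show "char_of C tr m = \<chi>"
      by (rule char_unique [OF m]) (use pb q in \<open>simp add: is_char_def\<close>)
  qed
qed

text \<open>Truth values are equal when they become true at the same stages: both classify the
  subobject of those stages.\<close>

lemma omega_ext:
  assumes "\<chi> \<in> Ar C" "\<chi>' \<in> Ar C" "Dom C \<chi>' = Dom C \<chi>" "Cod C \<chi> = \<Omega>" "Cod C \<chi>' = \<Omega>"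
    and eq: "\<And>h. \<lbrakk>h \<in> Ar C; Cod C h = Dom C \<chi>\<rbrakk>
      \<Longrightarrow> \<chi> \<cdot> h = tr \<cdot> bang C (Dom C h) \<longleftrightarrow> \<chi>' \<cdot> h = tr \<cdot> bang C (Dom C h)"
  shows "\<chi> = \<chi>'"
proof -
  obtain m where m: "monic C m" "Cod C m = Dom C \<chi>" "char_of C tr m = \<chi>"
    using subobject_of_char assms by metis
  have "is_char C tr m \<chi>'"
    by (rule is_charI) (use m assms char_true_iff [OF m(1)] in simp_all)
  then show ?thesis
    using char_unique m by metis
qed

lemma char_eq_iff:
  assumes "monic C m" "monic C n" "Cod C n = Cod C m"
  shows "char_of C tr m = char_of C tr n \<longleftrightarrow> (m, n) \<in> subobj_eq C"
proof
  assume eq: "char_of C tr m = char_of C tr n"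
  have self: "factors_through C k k" if "monic C k" for k
    by (rule factors_throughI [of k "Idn C (Dom C k)"]) (use that in simp_all)
  have "factors_through C m n" "factors_through C n m"
    using char_true_iff [of m m] char_true_iff [of n m] char_true_iff [of m n]
      char_true_iff [of n n] self eq assms by simp_all
  from \<open>factors_through C m n\<close>
  obtain i where i: "i \<in> Ar C" "Dom C i = Dom C m" "Cod C i = Dom C n" "n \<cdot> i = m"
    by (rule factors_throughE)
  from \<open>factors_through C n m\<close>
  obtain j where j: "j \<in> Ar C" "Dom C j = Dom C n" "Cod C j = Dom C m" "m \<cdot> j = n"
    by (rule factors_throughE)
  have "m \<cdot> (j \<cdot> i) = m"
    using comp_cong_left [of m j n i] i j assms by simp
  then have ji: "j \<cdot> i = Idn C (Dom C m)"
    using i j assms by - (rule monicD [OF assms(1)], simp_all)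
  have "n \<cdot> (i \<cdot> j) = n"
    using comp_cong_left [of n i m j] i j assms by simp
  then have ij: "i \<cdot> j = Idn C (Dom C n)"
    using i j assms by - (rule monicD [OF assms(2)], simp_all)
  have "iso C i"
    unfolding iso_def using i j ij ji by (intro conjI bexI [of _ j]) simp_all
  then show "(m, n) \<in> subobj_eq C"
    unfolding subobj_eq_def mem_Collect_eq prod.case
    by (intro conjI bexI [of _ i]) (use i assms in simp_all)
next
  assume "(m, n) \<in> subobj_eq C"
  then obtain i where i: "i \<in> Ar C" "Dom C i = Dom C m" "Cod C i = Dom C n" "n \<cdot> i = m"
    and "iso C i"
    unfolding subobj_eq_def mem_Collect_eq prod.case Bex_def hom_iff by blast
  then obtain j where j: "j \<in> Ar C" "Dom C j = Dom C n" "Cod C j = Dom C m"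
      "j \<cdot> i = Idn C (Dom C m)" "i \<cdot> j = Idn C (Dom C n)"
    unfolding iso_def Bex_def hom_iff i(2,3) by blast
  have "n \<cdot> (i \<cdot> j) = m \<cdot> j"
    by (rule comp_cong_left) (use i j assms in simp_all)
  then have mj: "m \<cdot> j = n"
    using j assms by simp
  show "char_of C tr m = char_of C tr n"
  proof (rule omega_ext)
    fix h assume h: "h \<in> Ar C" "Cod C h = Dom C (char_of C tr m)"
    have "factors_through C h m \<longleftrightarrow> factors_through C h n"
    proof
      assume "factors_through C h m"
      then obtain u where u: "u \<in> Ar C" "Dom C u = Dom C h" "Cod C u = Dom C m" "m \<cdot> u = h"
        by (rule factors_throughE)
      then have "n \<cdot> (i \<cdot> u) = h"
        using comp_cong_left [of n i m u] i assms by simp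
      then show "factors_through C h n"
        by (rule factors_throughI) (use i u in simp_all)
    next
      assume "factors_through C h n"
      then obtain u where u: "u \<in> Ar C" "Dom C u = Dom C h" "Cod C u = Dom C n" "n \<cdot> u = h"
        by (rule factors_throughE)
      then have "m \<cdot> (j \<cdot> u) = h"
        using comp_cong_left [of m j n u] mj j assms by simp
      then show "factors_through C h m"
        by (rule factors_throughI) (use j u in simp_all)
    qed
    then show "char_of C tr m \<cdot> h = tr \<cdot> bang C (Dom C h)
        \<longleftrightarrow> char_of C tr n \<cdot> h = tr \<cdot> bang C (Dom C h)"
      using h assms by (simp add: char_true_iff)
  qed (use assms in simp_all)
qed

abbreviation meet_Omega :: 'm where
  "meet_Omega \<equiv> char_of C tr (prod_map C tr tr)"

lemma monic_tr: "monic C tr"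
  by (rule monic_from_one) simp_all

lemma meet_Omega_simps [simp]: "meet_Omega \<in> Ar C" "Dom C meet_Omega = prod_ob C \<Omega> \<Omega>"
    "Cod C meet_Omega = \<Omega>"
  using monic_prod_map [OF monic_tr monic_tr] by simp_all

lemma meet_Omega_true [simp]:
  assumes "x \<in> Ar C" "y \<in> Ar C" "Dom C x = T" "Dom C y = T" "Cod C x = \<Omega>" "Cod C y = \<Omega>"
  shows "meet_Omega \<cdot> pairing C x y = tr \<cdot> bang C T
    \<longleftrightarrow> x = tr \<cdot> bang C T \<and> y = tr \<cdot> bang C T"
proof -
  have T: "T \<in> Ob C" using assms by auto
  have "meet_Omega \<cdot> pairing C x y = tr \<cdot> bang C T
      \<longleftrightarrow> factors_through C (pairing C x y) (prod_map C tr tr)"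
    using char_true_iff [OF monic_prod_map [OF monic_tr monic_tr], of "pairing C x y"] assms
    by simp
  also have "\<dots> \<longleftrightarrow> x = tr \<cdot> bang C T \<and> y = tr \<cdot> bang C T"
  proof
    assume "factors_through C (pairing C x y) (prod_map C tr tr)"
    then obtain g where g: "g \<in> Ar C" "Dom C g = T" "Cod C g = prod_ob C (one C) (one C)"
        "prod_map C tr tr \<cdot> g = pairing C x y"
      by (rule factors_throughE) (use assms in simp)
    let ?a = "pr1 C (one C) (one C) \<cdot> g" and ?b = "pr2 C (one C) (one C) \<cdot> g"
    have eq: "pairing C (tr \<cdot> ?a) (tr \<cdot> ?b) = pairing C x y"
      using g by (simp add: prod_map_def)
    have "?a = bang C T" "?b = bang C T"
      using to_one_eq [of ?a] to_one_eq [of ?b] g by simp_all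
    moreover have "tr \<cdot> ?a = x"
      by (rule pairing_inject(1) [OF eq]) (use g assms in simp_all)
    moreover have "tr \<cdot> ?b = y"
      by (rule pairing_inject(2) [OF eq]) (use g assms in simp_all)
    ultimately show "x = tr \<cdot> bang C T \<and> y = tr \<cdot> bang C T"
      by simp
  next
    assume "x = tr \<cdot> bang C T \<and> y = tr \<cdot> bang C T"
    then show "factors_through C (pairing C x y) (prod_map C tr tr)"
      using T by - (rule factors_throughI [of _ "pairing C (bang C T) (bang C T)"], simp_all)
  qed
  finally show ?thesis .
qed

text \<open>By extensionality of truth values the laws reduce to those of propositional conjunction.\<close>

lemma Omega_semilattice: "internal_semilattice C (Omega_slat C \<Omega> tr)"
proof (rule internal_semilatticeI, unfold Omega_slat_def slat.simps)
  fix x assume x: "x \<in> Ar C" "Cod C x = \<Omega>"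
  then have T: "Dom C x \<in> Ob C" by simp
  show "meet_Omega \<cdot> pairing C x (tr \<cdot> bang C (Dom C x)) = x"
    by (rule omega_ext) (use x T in simp_all)
  show "meet_Omega \<cdot> pairing C x x = x"
    by (rule omega_ext) (use x T in simp_all)
  fix y assume y: "y \<in> Ar C" "Dom C y = Dom C x" "Cod C y = \<Omega>"
  show "meet_Omega \<cdot> pairing C x y = meet_Omega \<cdot> pairing C y x"
    by (rule omega_ext) (use x y T in auto)
  fix z assume z: "z \<in> Ar C" "Dom C z = Dom C x" "Cod C z = \<Omega>"
  show "meet_Omega \<cdot> pairing C (meet_Omega \<cdot> pairing C x y) z
      = meet_Omega \<cdot> pairing C x (meet_Omega \<cdot> pairing C y z)"
    by (rule omega_ext) (use x y z T in auto)
qed simp_all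

end

section \<open>Exponentials\<close>

definition jointly_epic :: "('o, 'm) cat \<Rightarrow> 'o \<Rightarrow> 'm set \<Rightarrow> bool" where
  "jointly_epic C X S \<longleftrightarrow> X \<in> Ob C \<and> (\<forall>f\<in>S. f \<in> Ar C \<and> Cod C f = X) \<and>
    (\<forall>g h. g \<in> Ar C \<and> h \<in> Ar C \<and> Dom C g = X \<and> Dom C h = X \<and> Cod C g = Cod C h \<and>
       (\<forall>f\<in>S. g \<cdot>\<^bsub>C\<^esub> f = h \<cdot>\<^bsub>C\<^esub> f) \<longrightarrow> g = h)"

lemma jointly_epicD:
  assumes "jointly_epic C X S" "g \<in> Ar C" "h \<in> Ar C" "Dom C g = X" "Dom C h = X" "Cod C g = Cod C h"
    "\<And>f. f \<in> S \<Longrightarrow> g \<cdot>\<^bsub>C\<^esub> f = h \<cdot>\<^bsub>C\<^esub> f"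
  shows "g = h"
  using assms unfolding jointly_epic_def by blast

context topos
begin

text \<open>Exponential transposition with respect to an arbitrary product in place of the chosen one;
  a subcategory makes its own choice of products.\<close>

lemma exponential_transpose:
  assumes ex: "is_exponential C X Y Z ev" and pr: "is_product C W X p q"
    and f: "f \<in> Ar C" "Dom C f = Dom C p" "Cod C f = Y" and "p \<in> Ar C" "X \<in> Ob C"
  shows "\<exists>!g. g \<in> hom C W Z \<and> ev \<cdot> pairing C (g \<cdot> p) q = f"
proof -
  have pq: "p \<in> Ar C" "q \<in> Ar C" "Dom C q = Dom C p" "Cod C p = W" "Cod C q = X"
    and W: "W \<in> Ob C"
    using pr assms unfolding is_product_def by auto
  have ev: "ev \<in> Ar C" "Dom C ev = prod_ob C Z X" "Cod C ev = Y" "Z \<in> Ob C"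
    using ex by (simp_all add: is_exponential_def)
  have U: "\<exists>!h. h \<in> hom C T (Dom C p) \<and> p \<cdot> h = a \<and> q \<cdot> h = b"
    if "a \<in> hom C T W" "b \<in> hom C T X" for T a b
    using pr that unfolding is_product_def by blast
  obtain j where j: "j \<in> Ar C" "Dom C j = prod_ob C W X" "Cod C j = Dom C p"
      "p \<cdot> j = pr1 C W X" "q \<cdot> j = pr2 C W X"
    using U [of "pr1 C W X" "prod_ob C W X" "pr2 C W X"] W \<open>X \<in> Ob C\<close> by auto
  have i: "pairing C p q \<in> Ar C" "Dom C (pairing C p q) = Dom C p"
      "Cod C (pairing C p q) = prod_ob C W X"
    using pq by simp_all
  have pji: "p \<cdot> (j \<cdot> pairing C p q) = p" "q \<cdot> (j \<cdot> pairing C p q) = q"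
    using comp_cong_left [of p j "pr1 C W X" "pairing C p q"]
      comp_cong_left [of q j "pr2 C W X" "pairing C p q"] i j pq by simp_all
  have "j \<cdot> pairing C p q \<in> hom C (Dom C p) (Dom C p)" "Idn C (Dom C p) \<in> hom C (Dom C p) (Dom C p)"
    using i j pq by simp_all
  then have ji: "j \<cdot> pairing C p q = Idn C (Dom C p)"
    using U [of p "Dom C p" q] pji pq by (metis hom_iff comp_idn)
  have "f \<cdot> j \<in> hom C (prod_ob C W X) Y"
    using f j by simp
  then have ex1: "\<exists>!g. g \<in> hom C W Z \<and> ev \<cdot> prod_map C g (Idn C X) = f \<cdot> j"
    using ex W unfolding is_exponential_def by blast
  have "ev \<cdot> prod_map C g (Idn C X) = f \<cdot> j \<longleftrightarrow> ev \<cdot> pairing C (g \<cdot> p) q = f"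
    if g: "g \<in> Ar C" "Dom C g = W" "Cod C g = Z" for g
  proof
    assume "ev \<cdot> prod_map C g (Idn C X) = f \<cdot> j"
    then have "ev \<cdot> pairing C (g \<cdot> p) (Idn C X \<cdot> q) = (f \<cdot> j) \<cdot> pairing C p q"
      by (rule prod_map_eqD) (use g ev pq \<open>X \<in> Ob C\<close> in simp_all)
    then show "ev \<cdot> pairing C (g \<cdot> p) q = f"
      using f j ji i pq by simp
  next
    assume "ev \<cdot> pairing C (g \<cdot> p) q = f"
    then have "ev \<cdot> (pairing C (g \<cdot> p) q \<cdot> j) = f \<cdot> j"
      by (rule comp_cong_left) (use f g ev pq j in simp_all)
    then show "ev \<cdot> prod_map C g (Idn C X) = f \<cdot> j"
      using f g ev pq j W \<open>X \<in> Ob C\<close> by (simp add: prod_map_def)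
  qed
  then show ?thesis using ex1 by (metis hom_iff)
qed

text \<open>The functor \<open>- \<times> Y\<close> is a left adjoint, hence preserves jointly epic families: a
  family is tested against the transposes of two morphisms.\<close>

lemma jointly_epic_prod_left:
  assumes je: "jointly_epic C X S" and Y: "Y \<in> Ob C"
  shows "jointly_epic C (prod_ob C X Y) ((\<lambda>f. prod_map C f (Idn C Y)) ` S)"
  unfolding jointly_epic_def
proof (intro conjI ballI allI impI)
  have X: "X \<in> Ob C" using je unfolding jointly_epic_def by blast
  then show "prod_ob C X Y \<in> Ob C" using Y by simp
  have S: "f \<in> Ar C" "Cod C f = X" if "f \<in> S" for f
    using je that unfolding jointly_epic_def by blast+
  fix f assume "f \<in> (\<lambda>f. prod_map C f (Idn C Y)) ` S"
  then show "f \<in> Ar C" "Cod C f = prod_ob C X Y" using S Y by auto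
next
  have X: "X \<in> Ob C" using je unfolding jointly_epic_def by blast
  have S: "f \<in> Ar C" "Cod C f = X" if "f \<in> S" for f
    using je that unfolding jointly_epic_def by blast+
  fix g h
  assume gh: "g \<in> Ar C \<and> h \<in> Ar C \<and> Dom C g = prod_ob C X Y \<and> Dom C h = prod_ob C X Y \<and>
    Cod C g = Cod C h \<and> (\<forall>f\<in>(\<lambda>f. prod_map C f (Idn C Y)) ` S. g \<cdot> f = h \<cdot> f)"
  obtain Z ev where ex: "is_exponential C Y (Cod C g) Z ev"
    using exponentials [of Y "Cod C g"] Y gh by auto
  have ev: "ev \<in> Ar C" "Dom C ev = prod_ob C Z Y" "Cod C ev = Cod C g" "Z \<in> Ob C"
    using ex by (simp_all add: is_exponential_def)
  have tr: "\<exists>!a. a \<in> hom C W Z \<and> ev \<cdot> prod_map C a (Idn C Y) = f"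
    if "W \<in> Ob C" "f \<in> hom C (prod_ob C W Y) (Cod C g)" for W f
    using ex that unfolding is_exponential_def by blast
  obtain a where a: "a \<in> Ar C" "Dom C a = X" "Cod C a = Z" "ev \<cdot> prod_map C a (Idn C Y) = g"
    using tr [of X g] X gh by auto
  obtain b where b: "b \<in> Ar C" "Dom C b = X" "Cod C b = Z" "ev \<cdot> prod_map C b (Idn C Y) = h"
    using tr [of X h] X gh by auto
  have comp: "ev \<cdot> prod_map C (c \<cdot> f) (Idn C Y) = k \<cdot> prod_map C f (Idn C Y)"
    if "f \<in> Ar C" "Cod C f = X" "c \<in> Ar C" "Dom C c = X" "Cod C c = Z"
      "ev \<cdot> prod_map C c (Idn C Y) = k" for f c k
    by (rule prod_map_idn_comp) (use that ev Y in simp_all)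
  have "a = b"
  proof (rule jointly_epicD [OF je])
    fix f assume f: "f \<in> S"
    then have "g \<cdot> prod_map C f (Idn C Y) = h \<cdot> prod_map C f (Idn C Y)"
      using gh by simp
    then have "ev \<cdot> prod_map C (a \<cdot> f) (Idn C Y) = ev \<cdot> prod_map C (b \<cdot> f) (Idn C Y)"
      using comp [of f a g] comp [of f b h] a b S [OF f] by simp
    moreover have "a \<cdot> f \<in> hom C (Dom C f) Z" "b \<cdot> f \<in> hom C (Dom C f) Z"
        "ev \<cdot> prod_map C (b \<cdot> f) (Idn C Y) \<in> hom C (prod_ob C (Dom C f) Y) (Cod C g)"
      using S [OF f] a b ev Y by simp_all
    ultimately show "a \<cdot> f = b \<cdot> f"
      using tr [of "Dom C f"] S [OF f] by (metis dom_ob)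
  qed (use a b in simp_all)
  then show "g = h" using a b by simp
qed

definition swap :: "'o \<Rightarrow> 'o \<Rightarrow> 'm" where
  "swap X Y = pairing C (pr2 C X Y) (pr1 C X Y)"

lemma swap_simps [simp]:
  assumes "X \<in> Ob C" "Y \<in> Ob C"
  shows "swap X Y \<in> Ar C" "Dom C (swap X Y) = prod_ob C X Y" "Cod C (swap X Y) = prod_ob C Y X"
  using assms by (simp_all add: swap_def)

lemma swap_pairing [simp]:
  "\<lbrakk>x \<in> Ar C; y \<in> Ar C; Dom C x = Dom C y; Cod C x = X; Cod C y = Y\<rbrakk>
    \<Longrightarrow> swap X Y \<cdot> pairing C x y = pairing C y x"
  by (auto simp: swap_def)

lemma swap_swap: "\<lbrakk>X \<in> Ob C; Y \<in> Ob C\<rbrakk> \<Longrightarrow> swap Y X \<cdot> swap X Y = Idn C (prod_ob C X Y)"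
  by (simp add: swap_def)

text \<open>A pair of families is treated one variable at a time, the second after swapping the factors.\<close>

lemma jointly_epic_prod:
  assumes S: "jointly_epic C X S" and T: "jointly_epic C Y T"
  shows "jointly_epic C (prod_ob C X Y) {prod_map C f g | f g. f \<in> S \<and> g \<in> T}"
  unfolding jointly_epic_def
proof (intro conjI ballI allI impI)
  have XY: "X \<in> Ob C" "Y \<in> Ob C" using S T unfolding jointly_epic_def by blast+
  then show "prod_ob C X Y \<in> Ob C" by simp
  have SA: "f \<in> Ar C" "Cod C f = X" if "f \<in> S" for f
    using S that unfolding jointly_epic_def by blast+
  have TA: "f \<in> Ar C" "Cod C f = Y" if "f \<in> T" for f
    using T that unfolding jointly_epic_def by blast+
  {
    fix f assume "f \<in> {prod_map C f g | f g. f \<in> S \<and> g \<in> T}"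
    then show "f \<in> Ar C" "Cod C f = prod_ob C X Y" using SA TA by auto
  }
  fix a b
  assume ab: "a \<in> Ar C \<and> b \<in> Ar C \<and> Dom C a = prod_ob C X Y \<and> Dom C b = prod_ob C X Y \<and>
    Cod C a = Cod C b \<and> (\<forall>f\<in>{prod_map C f g | f g. f \<in> S \<and> g \<in> T}. a \<cdot> f = b \<cdot> f)"
  have fg: "a \<cdot> prod_map C f g = b \<cdot> prod_map C f g" if "f \<in> S" "g \<in> T" for f g
    using ab that by blast
  show "a = b"
  proof (rule jointly_epicD [OF jointly_epic_prod_left [OF S XY(2)]])
    fix u assume "u \<in> (\<lambda>f. prod_map C f (Idn C Y)) ` S"
    then obtain f where f: "f \<in> S" "u = prod_map C f (Idn C Y)" by blast
    let ?F = "Dom C f"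
    have F: "?F \<in> Ob C" using SA [OF f(1)] by simp
    have "(a \<cdot> u) \<cdot> swap Y ?F = (b \<cdot> u) \<cdot> swap Y ?F"
    proof (rule jointly_epicD [OF jointly_epic_prod_left [OF T F]])
      fix v assume "v \<in> (\<lambda>g. prod_map C g (Idn C ?F)) ` T"
      then obtain g where g: "g \<in> T" "v = prod_map C g (Idn C ?F)" by blast
      have "u \<cdot> (swap Y ?F \<cdot> v) = prod_map C f g \<cdot> swap (Dom C g) ?F"
        using SA [OF f(1)] TA [OF g(1)] f g F XY by (simp add: prod_map_def swap_def)
      moreover have "a \<cdot> (prod_map C f g \<cdot> swap (Dom C g) ?F)
          = (b \<cdot> prod_map C f g) \<cdot> swap (Dom C g) ?F"
        by (rule comp_cong_left) (use fg f g ab SA [OF f(1)] TA [OF g(1)] in simp_all)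
      ultimately show "((a \<cdot> u) \<cdot> swap Y ?F) \<cdot> v = ((b \<cdot> u) \<cdot> swap Y ?F) \<cdot> v"
        using SA [OF f(1)] TA [OF g(1)] f g F ab XY by simp
    qed (use SA [OF f(1)] f ab F XY in simp_all)
    then have "((a \<cdot> u) \<cdot> swap Y ?F) \<cdot> swap ?F Y = ((b \<cdot> u) \<cdot> swap Y ?F) \<cdot> swap ?F Y"
      by simp
    then show "a \<cdot> u = b \<cdot> u"
      using SA [OF f(1)] f ab F XY swap_swap [of ?F Y] by simp
  qed (use ab in simp_all)
qed

end

section \<open>Filters and characteristic morphisms\<close>

context classified_topos
begin

lemma char_factor_true:
  assumes "monic C m" "u \<in> Ar C" "Cod C u = Dom C m"
  shows "char_of C tr m \<cdot> (m \<cdot> u) = tr \<cdot> bang C (Dom C u)"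
  using char_true_iff [of m "m \<cdot> u"] factors_throughI [of m u "m \<cdot> u"] assms by simp

text \<open>Closure under meets and upward closure of \<open>m\<close> together say that \<open>x \<and> y \<in> m\<close> holds
  exactly when both \<open>x \<in> m\<close> and \<open>y \<in> m\<close> hold, which is what it means for the membership
  predicate to preserve meets.\<close>

lemma filter_iff_char_hom:
  assumes A: "internal_semilattice C A" and m: "monic C m" "Cod C m = Carrier A"
  shows "internal_filter C A m \<longleftrightarrow> semilattice_hom C A (Omega_slat C \<Omega> tr) (char_of C tr m)"
proof
  note As [simp] = slat_simps [OF A]
  let ?\<chi> = "char_of C tr m"
  have \<chi> [simp]: "?\<chi> \<in> Ar C" "Dom C ?\<chi> = Carrier A" "Cod C ?\<chi> = \<Omega>"
    using m by simp_all
  have pairing_true: "factors_through C (Meet A \<cdot> pairing C x y) m \<longleftrightarrow>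
      factors_through C x m \<and> factors_through C y m"
    if F: "internal_filter C A m"
      and xy: "x \<in> Ar C" "y \<in> Ar C" "Dom C y = Dom C x" "Cod C x = Carrier A"
        "Cod C y = Carrier A" for x y
  proof
    assume "factors_through C (Meet A \<cdot> pairing C x y) m"
    then obtain u where u: "u \<in> Ar C" "Dom C u = Dom C x" "Cod C u = Dom C m"
        "m \<cdot> u = Meet A \<cdot> pairing C x y"
      by (rule factors_throughE) (use xy in simp)
    have up: "factors_through C z m"
      if "z \<in> Ar C" "Dom C z = Dom C x" "Cod C z = Carrier A"
        "Meet A \<cdot> pairing C (m \<cdot> u) z = m \<cdot> u" for z
    proof -
      have "u \<in> hom C (Dom C x) (Dom C m)" "z \<in> hom C (Dom C x) (Carrier A)"
        using u that by simp_all
      then show ?thesis using F that(4) unfolding internal_filter_def by blast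
    qed
    have "factors_through C y m"
      by (rule up) (use slat_absorb [OF A, of x y] u(4) xy in simp_all)
    moreover have comm: "Meet A \<cdot> pairing C x y = Meet A \<cdot> pairing C y x"
      by (rule slat_laws(2) [OF A]) (use xy in simp_all)
    have "factors_through C x m"
      by (rule up) (use slat_absorb [OF A, of y x] u(4) comm xy in simp_all)
    ultimately show "factors_through C x m \<and> factors_through C y m"
      by simp
  next
    assume "factors_through C x m \<and> factors_through C y m"
    then have fx: "factors_through C x m" and fy: "factors_through C y m" by simp_all
    obtain u where u: "u \<in> Ar C" "Dom C u = Dom C x" "Cod C u = Dom C m" "m \<cdot> u = x"
      using fx by (rule factors_throughE)
    obtain v where v: "v \<in> Ar C" "Dom C v = Dom C y" "Cod C v = Dom C m" "m \<cdot> v = y"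
      using fy by (rule factors_throughE)
    have "factors_through C ((Meet A \<cdot> prod_map C m m) \<cdot> pairing C u v) m"
    proof (rule factors_through_comp)
      show "factors_through C (Meet A \<cdot> prod_map C m m) m"
        using F by (simp add: internal_filter_def)
    qed (use m u v xy in simp_all)
    moreover have "(Meet A \<cdot> prod_map C m m) \<cdot> pairing C u v = Meet A \<cdot> pairing C x y"
      using m u v xy by simp
    ultimately show "factors_through C (Meet A \<cdot> pairing C x y) m" by simp
  qed
  show "semilattice_hom C A (Omega_slat C \<Omega> tr) ?\<chi>" if F: "internal_filter C A m"
    unfolding semilattice_hom_def
  proof (intro conjI)
    show "internal_semilattice C A" "internal_semilattice C (Omega_slat C \<Omega> tr)"
      by (rule A, rule Omega_semilattice)
    show "?\<chi> \<in> hom C (Carrier A) (Carrier (Omega_slat C \<Omega> tr))"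
      by (simp add: Omega_slat_def)
    have "factors_through C (Top A) m" using F by (simp add: internal_filter_def)
    then show "?\<chi> \<cdot> Top A = Top (Omega_slat C \<Omega> tr)"
      using char_true_iff [of m "Top A"] m by (simp add: Omega_slat_def bang_one)
    have "?\<chi> \<cdot> Meet A = meet_Omega \<cdot> prod_map C ?\<chi> ?\<chi>"
    proof (rule omega_ext)
      fix h assume h: "h \<in> Ar C" "Cod C h = Dom C (?\<chi> \<cdot> Meet A)"
      define x where "x = pr1 C (Carrier A) (Carrier A) \<cdot> h"
      define y where "y = pr2 C (Carrier A) (Carrier A) \<cdot> h"
      have xy: "x \<in> Ar C" "y \<in> Ar C" "Dom C x = Dom C h" "Dom C y = Dom C h"
          "Cod C x = Carrier A" "Cod C y = Carrier A"
        using h by (simp_all add: x_def y_def)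
      have hxy: "h = pairing C x y"
        using pairing_eta [of "Carrier A" "Carrier A" h] h by (simp add: x_def y_def)
      have "(?\<chi> \<cdot> Meet A) \<cdot> pairing C x y = tr \<cdot> bang C (Dom C h)
          \<longleftrightarrow> factors_through C (Meet A \<cdot> pairing C x y) m"
        using char_true_iff [of m "Meet A \<cdot> pairing C x y"] m xy by simp
      also have "\<dots> \<longleftrightarrow> (meet_Omega \<cdot> prod_map C ?\<chi> ?\<chi>) \<cdot> pairing C x y = tr \<cdot> bang C (Dom C h)"
        using pairing_true [OF F, of x y] char_true_iff [of m x] char_true_iff [of m y] m xy
        by simp
      finally show "(?\<chi> \<cdot> Meet A) \<cdot> h = tr \<cdot> bang C (Dom C h)
          \<longleftrightarrow> (meet_Omega \<cdot> prod_map C ?\<chi> ?\<chi>) \<cdot> h = tr \<cdot> bang C (Dom C h)"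
        using hxy by metis
    qed simp_all
    then show "?\<chi> \<cdot> Meet A = Meet (Omega_slat C \<Omega> tr) \<cdot> prod_map C ?\<chi> ?\<chi>"
      by (simp add: Omega_slat_def)
  qed
  show "internal_filter C A m" if H: "semilattice_hom C A (Omega_slat C \<Omega> tr) ?\<chi>"
  proof -
    have top: "?\<chi> \<cdot> Top A = tr" and meet: "?\<chi> \<cdot> Meet A = meet_Omega \<cdot> prod_map C ?\<chi> ?\<chi>"
      using H by (simp_all add: semilattice_hom_def Omega_slat_def)
    have meet': "?\<chi> \<cdot> (Meet A \<cdot> pairing C x y) = meet_Omega \<cdot> pairing C (?\<chi> \<cdot> x) (?\<chi> \<cdot> y)"
      if "x \<in> Ar C" "y \<in> Ar C" "Dom C x = Dom C y" "Cod C x = Carrier A"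
        "Cod C y = Carrier A" for x y
    proof -
      have "?\<chi> \<cdot> (Meet A \<cdot> pairing C x y) = (meet_Omega \<cdot> prod_map C ?\<chi> ?\<chi>) \<cdot> pairing C x y"
        by (rule comp_cong_left [OF meet]) (use that in simp_all)
      then show ?thesis using that by simp
    qed
    show ?thesis
      unfolding internal_filter_def
    proof (intro conjI allI ballI impI)
      show "internal_semilattice C A" by (rule A)
      show "subobj_of C (Carrier A) m" using m by (simp add: subobj_of_def)
      show "factors_through C (Top A) m"
        using char_true_iff [of m "Top A"] m top by (simp add: bang_one)
      let ?p = "pr1 C (Dom C m) (Dom C m)" and ?q = "pr2 C (Dom C m) (Dom C m)"
      have "?\<chi> \<cdot> (Meet A \<cdot> pairing C (m \<cdot> ?p) (m \<cdot> ?q))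
          = tr \<cdot> bang C (prod_ob C (Dom C m) (Dom C m))"
        using meet' [of "m \<cdot> ?p" "m \<cdot> ?q"] m char_factor_true [of m ?p] char_factor_true [of m ?q]
        by simp
      then show "factors_through C (Meet A \<cdot> prod_map C m m) m"
        using char_true_iff [of m "Meet A \<cdot> prod_map C m m"] m by (simp add: prod_map_def)
      fix T u x
      assume ux: "u \<in> hom C T (Dom C m)" "x \<in> hom C T (Carrier A)"
        "Meet A \<cdot> pairing C (m \<cdot> u) x = m \<cdot> u"
      have "meet_Omega \<cdot> pairing C (?\<chi> \<cdot> (m \<cdot> u)) (?\<chi> \<cdot> x) = tr \<cdot> bang C T"
        using meet' [of "m \<cdot> u" x] char_factor_true [of m u] ux m by simp
      then have "?\<chi> \<cdot> x = tr \<cdot> bang C T"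
        using ux m by simp
      then show "factors_through C x m"
        using char_true_iff [of m x] ux m by simp
    qed
  qed
qed

end

section \<open>The semilattice of local states\<close>

locale local_state_topos = classified_topos C \<Omega> tr
  for C :: "('o, 'm) cat" (structure) and \<Omega> tr +
  fixes \<Xi> :: 'o and \<xi> :: "'o \<Rightarrow> 'm"
  assumes lsc: "local_state_classifier C \<Xi> \<xi>"
begin

lemma mono_subcat_simps [simp]:
  "Ob (mono_subcat C) = Ob C" "Dom (mono_subcat C) = Dom C" "Cod (mono_subcat C) = Cod C"
  "f \<in> Ar (mono_subcat C) \<longleftrightarrow> monic C f"
  by (simp_all add: mono_subcat_def)

lemma mono_cocone_iff:
  "is_cocone (mono_subcat C) C \<lparr>Fob = (\<lambda>X. X), Far = (\<lambda>f. f)\<rparr> Z \<zeta> \<longleftrightarrow>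
    Z \<in> Ob C \<and> (\<forall>X\<in>Ob C. \<zeta> X \<in> hom C X Z) \<and> (\<forall>m. monic C m \<longrightarrow> \<zeta> (Cod C m) \<cdot> m = \<zeta> (Dom C m))"
proof -
  have "is_functor (mono_subcat C) C \<lparr>Fob = (\<lambda>X. X), Far = (\<lambda>f. f)\<rparr>"
    using lsc unfolding local_state_classifier_def is_colimit_def is_cocone_def by blast
  then show ?thesis
    unfolding is_cocone_def by auto
qed

lemma Xi_ob [simp]: "\<Xi> \<in> Ob C"
  and xi_hom: "X \<in> Ob C \<Longrightarrow> \<xi> X \<in> hom C X \<Xi>"
  and xi_mono: "monic C m \<Longrightarrow> \<xi> (Cod C m) \<cdot> m = \<xi> (Dom C m)"
  using lsc unfolding local_state_classifier_def is_colimit_def mono_cocone_iff by blast+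

lemma xi_simps [simp]:
  assumes "X \<in> Ob C"
  shows "\<xi> X \<in> Ar C" "Dom C (\<xi> X) = X" "Cod C (\<xi> X) = \<Xi>"
  using xi_hom [OF assms] by simp_all

lemma xi_desc_ex1:
  assumes "Z \<in> Ob C" "\<And>X. X \<in> Ob C \<Longrightarrow> \<zeta> X \<in> hom C X Z"
    "\<And>m. monic C m \<Longrightarrow> \<zeta> (Cod C m) \<cdot> m = \<zeta> (Dom C m)"
  shows "\<exists>!h. h \<in> hom C \<Xi> Z \<and> (\<forall>i\<in>Ob C. h \<cdot> \<xi> i = \<zeta> i)"
proof -
  have "is_cocone (mono_subcat C) C \<lparr>Fob = (\<lambda>X. X), Far = (\<lambda>f. f)\<rparr> Z \<zeta>"
    unfolding mono_cocone_iff using assms by blast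
  moreover have "\<forall>Z \<zeta>. is_cocone (mono_subcat C) C \<lparr>Fob = (\<lambda>X. X), Far = (\<lambda>f. f)\<rparr> Z \<zeta> \<longrightarrow>
      (\<exists>!h. h \<in> hom C \<Xi> Z \<and> (\<forall>i\<in>Ob C. h \<cdot> \<xi> i = \<zeta> i))"
    using lsc unfolding local_state_classifier_def is_colimit_def mono_subcat_simps by (rule conjunct2)
  ultimately show ?thesis by blast
qed

lemma xi_desc:
  assumes "Z \<in> Ob C" "\<And>X. X \<in> Ob C \<Longrightarrow> \<zeta> X \<in> hom C X Z"
    "\<And>m. monic C m \<Longrightarrow> \<zeta> (Cod C m) \<cdot> m = \<zeta> (Dom C m)"
  obtains h where "h \<in> Ar C" "Dom C h = \<Xi>" "Cod C h = Z" "\<And>X. X \<in> Ob C \<Longrightarrow> h \<cdot> \<xi> X = \<zeta> X"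
proof -
  have "\<exists>h. h \<in> hom C \<Xi> Z \<and> (\<forall>i\<in>Ob C. h \<cdot> \<xi> i = \<zeta> i)"
    by (rule ex1_implies_ex [OF xi_desc_ex1]) (use assms in blast)+
  then show ?thesis using that unfolding hom_iff by blast
qed

lemma xi_jointly_epic: "jointly_epic C \<Xi> (\<xi> ` Ob C)"
  unfolding jointly_epic_def
proof (intro conjI ballI allI impI)
  fix g h
  assume gh: "g \<in> Ar C \<and> h \<in> Ar C \<and> Dom C g = \<Xi> \<and> Dom C h = \<Xi> \<and> Cod C g = Cod C h \<and>
    (\<forall>f\<in>\<xi> ` Ob C. g \<cdot> f = h \<cdot> f)"
  then have g: "g \<in> Ar C" "h \<in> Ar C" "Dom C g = \<Xi>" "Dom C h = \<Xi>" "Cod C h = Cod C g"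
    and eq: "\<And>X. X \<in> Ob C \<Longrightarrow> h \<cdot> \<xi> X = g \<cdot> \<xi> X"
    by (simp_all only: ball_simps)
  have "Cod C g \<in> Ob C" using g(1) by simp
  moreover have "g \<cdot> \<xi> X \<in> hom C X (Cod C g)" if "X \<in> Ob C" for X
    using that g by simp
  moreover have "(g \<cdot> \<xi> (Cod C m)) \<cdot> m = g \<cdot> \<xi> (Dom C m)" if "monic C m" for m
    using that g xi_mono by simp
  ultimately have "\<exists>!k. k \<in> hom C \<Xi> (Cod C g) \<and> (\<forall>i\<in>Ob C. k \<cdot> \<xi> i = g \<cdot> \<xi> i)"
    by (rule xi_desc_ex1)
  moreover have "g \<in> hom C \<Xi> (Cod C g) \<and> (\<forall>i\<in>Ob C. g \<cdot> \<xi> i = g \<cdot> \<xi> i)"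
    "h \<in> hom C \<Xi> (Cod C g) \<and> (\<forall>i\<in>Ob C. h \<cdot> \<xi> i = g \<cdot> \<xi> i)"
    using g eq by simp_all
  ultimately show "g = h" by blast
qed auto

lemma xi_ext:
  assumes "g \<in> Ar C" "h \<in> Ar C" "Dom C g = \<Xi>" "Dom C h = \<Xi>" "Cod C g = Cod C h"
    "\<And>X. X \<in> Ob C \<Longrightarrow> g \<cdot> \<xi> X = h \<cdot> \<xi> X"
  shows "g = h"
  by (rule jointly_epicD [OF xi_jointly_epic]) (use assms in auto)

lemma xi_ext_prod:
  assumes "g \<in> Ar C" "h \<in> Ar C" "Dom C g = prod_ob C \<Xi> \<Xi>" "Dom C h = prod_ob C \<Xi> \<Xi>"
    "Cod C g = Cod C h"
    "\<And>X Y. \<lbrakk>X \<in> Ob C; Y \<in> Ob C\<rbrakk> \<Longrightarrow> g \<cdot> prod_map C (\<xi> X) (\<xi> Y) = h \<cdot> prod_map C (\<xi> X) (\<xi> Y)"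
  shows "g = h"
  by (rule jointly_epicD [OF jointly_epic_prod [OF xi_jointly_epic xi_jointly_epic]])
    (use assms in auto)

text \<open>The colimit with a parameter object \<open>Y\<close>: transpose, descend, and transpose back.\<close>

lemma xi_desc_param:
  assumes Y: "Y \<in> Ob C" and Z: "Z \<in> Ob C"
    and \<zeta>: "\<And>X. X \<in> Ob C \<Longrightarrow> \<zeta> X \<in> hom C (prod_ob C X Y) Z"
    and nat: "\<And>m. monic C m \<Longrightarrow> \<zeta> (Cod C m) \<cdot> prod_map C m (Idn C Y) = \<zeta> (Dom C m)"
  obtains w where "w \<in> Ar C" "Dom C w = prod_ob C \<Xi> Y" "Cod C w = Z"
    "\<And>X. X \<in> Ob C \<Longrightarrow> w \<cdot> prod_map C (\<xi> X) (Idn C Y) = \<zeta> X"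
proof -
  obtain P ev where ex: "is_exponential C Y Z P ev"
    using exponentials [OF Y Z] by blast
  have ev: "ev \<in> Ar C" "Dom C ev = prod_ob C P Y" "Cod C ev = Z" "P \<in> Ob C"
    using ex by (simp_all add: is_exponential_def)
  have transpose: "\<exists>!a. a \<in> hom C W P \<and> ev \<cdot> prod_map C a (Idn C Y) = f"
    if "W \<in> Ob C" "f \<in> hom C (prod_ob C W Y) Z" for W f
    using ex that unfolding is_exponential_def by blast
  have "\<forall>X\<in>Ob C. \<exists>a. a \<in> hom C X P \<and> ev \<cdot> prod_map C a (Idn C Y) = \<zeta> X"
    using transpose \<zeta> by blast
  then obtain t where t: "\<And>X. X \<in> Ob C \<Longrightarrow> t X \<in> hom C X P"
    "\<And>X. X \<in> Ob C \<Longrightarrow> ev \<cdot> prod_map C (t X) (Idn C Y) = \<zeta> X"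
    by (metis (no_types, lifting) bchoice)
  have comp: "ev \<cdot> prod_map C (c \<cdot> f) (Idn C Y) = k \<cdot> prod_map C f (Idn C Y)"
    if "f \<in> Ar C" "Cod C f = X" "c \<in> Ar C" "Dom C c = X" "Cod C c = P"
      "ev \<cdot> prod_map C c (Idn C Y) = k" for f c k X
    by (rule prod_map_idn_comp) (use that ev Y in simp_all)
  have "t (Cod C m) \<cdot> m = t (Dom C m)" if m: "monic C m" for m
  proof -
    have "ev \<cdot> prod_map C (t (Cod C m) \<cdot> m) (Idn C Y) = \<zeta> (Dom C m)"
      using comp [of m "Cod C m" "t (Cod C m)" "\<zeta> (Cod C m)"] t [of "Cod C m"] nat [OF m] m
      by simp
    moreover have "t (Cod C m) \<cdot> m \<in> hom C (Dom C m) P"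
      using t(1) [of "Cod C m"] m by simp
    moreover have "Dom C m \<in> Ob C" using m by simp
    ultimately show ?thesis
      using transpose [of "Dom C m" "\<zeta> (Dom C m)"] t [of "Dom C m"] \<zeta> [of "Dom C m"] by blast
  qed
  then obtain h where h: "h \<in> Ar C" "Dom C h = \<Xi>" "Cod C h = P"
      "\<And>X. X \<in> Ob C \<Longrightarrow> h \<cdot> \<xi> X = t X"
    using xi_desc [of P t] ev t by metis
  show ?thesis
  proof (rule that [of "ev \<cdot> prod_map C h (Idn C Y)"])
    fix X assume X: "X \<in> Ob C"
    show "(ev \<cdot> prod_map C h (Idn C Y)) \<cdot> prod_map C (\<xi> X) (Idn C Y) = \<zeta> X"
      using comp [OF _ _ _ _ _ refl, of "\<xi> X" \<Xi> h] X h ev Y t(2) [OF X] by simp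
  qed (use h ev Y in simp_all)
qed

text \<open>The two variables are eliminated in turn: for fixed \<open>Y\<close> the morphisms
  \<open>\<xi>\<^bsub>X \<times> Y\<^esub>\<close> glue to \<open>v\<^sub>Y : \<Xi> \<times> Y \<rightarrow> \<Xi>\<close>, and these again form a cocone in \<open>Y\<close>.\<close>

lemma Xi_meet_ex:
  "\<exists>w. w \<in> hom C (prod_ob C \<Xi> \<Xi>) \<Xi> \<and>
    (\<forall>X\<in>Ob C. \<forall>Y\<in>Ob C. w \<cdot> prod_map C (\<xi> X) (\<xi> Y) = \<xi> (prod_ob C X Y))"
proof -
  have "\<exists>w. w \<in> hom C (prod_ob C \<Xi> Y) \<Xi> \<and>
      (\<forall>X\<in>Ob C. w \<cdot> prod_map C (\<xi> X) (Idn C Y) = \<xi> (prod_ob C X Y))" if Y: "Y \<in> Ob C" for Y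
  proof -
    have "\<xi> (prod_ob C (Cod C m) Y) \<cdot> prod_map C m (Idn C Y) = \<xi> (prod_ob C (Dom C m) Y)"
      if "monic C m" for m
      using xi_mono [OF monic_prod_map [OF that monic_id [OF Y]]] Y that by simp
    moreover have "\<xi> (prod_ob C X Y) \<in> hom C (prod_ob C X Y) \<Xi>" if "X \<in> Ob C" for X
      using that Y by simp
    ultimately obtain w where "w \<in> Ar C" "Dom C w = prod_ob C \<Xi> Y" "Cod C w = \<Xi>"
      "\<And>X. X \<in> Ob C \<Longrightarrow> w \<cdot> prod_map C (\<xi> X) (Idn C Y) = \<xi> (prod_ob C X Y)"
      using xi_desc_param [OF Y Xi_ob, of "\<lambda>X. \<xi> (prod_ob C X Y)"] by metis
    then show ?thesis by (intro exI [of _ w]) simp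
  qed
  then obtain v where v: "\<And>Y. Y \<in> Ob C \<Longrightarrow> v Y \<in> hom C (prod_ob C \<Xi> Y) \<Xi>"
    "\<And>X Y. \<lbrakk>X \<in> Ob C; Y \<in> Ob C\<rbrakk> \<Longrightarrow> v Y \<cdot> prod_map C (\<xi> X) (Idn C Y) = \<xi> (prod_ob C X Y)"
    by metis
  have vs [simp]: "v Y \<in> Ar C" "Dom C (v Y) = prod_ob C \<Xi> Y" "Cod C (v Y) = \<Xi>"
    if "Y \<in> Ob C" for Y
    using v(1) [OF that] by simp_all
  have v_pairing: "v Y \<cdot> pairing C (\<xi> X \<cdot> x) y = \<xi> (prod_ob C X Y) \<cdot> pairing C x y"
    if "X \<in> Ob C" "Y \<in> Ob C" "x \<in> Ar C" "y \<in> Ar C" "Dom C x = Dom C y" "Cod C x = X" "Cod C y = Y"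
    for X Y x y
    using prod_map_eqD [OF v(2) [OF that(1,2)], of x y] that by simp
  have v_nat: "v (Cod C m) \<cdot> prod_map C (Idn C \<Xi>) m = v (Dom C m)" if m: "monic C m" for m
  proof (rule jointly_epicD [OF jointly_epic_prod_left [OF xi_jointly_epic, of "Dom C m"]])
    fix f assume "f \<in> (\<lambda>f. prod_map C f (Idn C (Dom C m))) ` \<xi> ` Ob C"
    then obtain X where X: "X \<in> Ob C" "f = prod_map C (\<xi> X) (Idn C (Dom C m))" by blast
    let ?p = "pr1 C X (Dom C m)" and ?q = "pr2 C X (Dom C m)"
    have "(v (Cod C m) \<cdot> prod_map C (Idn C \<Xi>) m) \<cdot> f
        = v (Cod C m) \<cdot> pairing C (\<xi> X \<cdot> ?p) (m \<cdot> ?q)"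
      using X m by (simp add: prod_map_def)
    also have "\<dots> = \<xi> (prod_ob C X (Cod C m)) \<cdot> pairing C ?p (m \<cdot> ?q)"
      by (rule v_pairing) (use X m in simp_all)
    also have "pairing C ?p (m \<cdot> ?q) = prod_map C (Idn C X) m"
      using X m by (simp add: prod_map_def)
    also have "\<xi> (prod_ob C X (Cod C m)) \<cdot> prod_map C (Idn C X) m = \<xi> (prod_ob C X (Dom C m))"
      using xi_mono [OF monic_prod_map [OF monic_id [OF X(1)] m]] X m by simp
    also have "\<dots> = v (Dom C m) \<cdot> f"
      using v(2) X m by simp
    finally show "(v (Cod C m) \<cdot> prod_map C (Idn C \<Xi>) m) \<cdot> f = v (Dom C m) \<cdot> f" .
  qed (use m in simp_all)
  have "(v (Cod C m) \<cdot> swap (Cod C m) \<Xi>) \<cdot> prod_map C m (Idn C \<Xi>) = v (Dom C m) \<cdot> swap (Dom C m) \<Xi>"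
    if m: "monic C m" for m
  proof -
    have "v (Cod C m) \<cdot> (prod_map C (Idn C \<Xi>) m \<cdot> swap (Dom C m) \<Xi>) = v (Dom C m) \<cdot> swap (Dom C m) \<Xi>"
      by (rule comp_cong_left [OF v_nat]) (use m in simp_all)
    moreover have "swap (Cod C m) \<Xi> \<cdot> prod_map C m (Idn C \<Xi>) = prod_map C (Idn C \<Xi>) m \<cdot> swap (Dom C m) \<Xi>"
      using m by (simp add: prod_map_def swap_def)
    ultimately show ?thesis using m by simp
  qed
  moreover have "v Y \<cdot> swap Y \<Xi> \<in> hom C (prod_ob C Y \<Xi>) \<Xi>" if "Y \<in> Ob C" for Y
    using that by simp
  ultimately obtain u where u: "u \<in> Ar C" "Dom C u = prod_ob C \<Xi> \<Xi>" "Cod C u = \<Xi>"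
    "\<And>Y. Y \<in> Ob C \<Longrightarrow> u \<cdot> prod_map C (\<xi> Y) (Idn C \<Xi>) = v Y \<cdot> swap Y \<Xi>"
    using xi_desc_param [OF Xi_ob Xi_ob, of "\<lambda>Y. v Y \<cdot> swap Y \<Xi>"] by metis
  have "(u \<cdot> swap \<Xi> \<Xi>) \<cdot> prod_map C (\<xi> X) (\<xi> Y) = \<xi> (prod_ob C X Y)"
    if X: "X \<in> Ob C" and Y: "Y \<in> Ob C" for X Y
  proof -
    let ?p = "pr1 C X Y" and ?q = "pr2 C X Y"
    have "(u \<cdot> swap \<Xi> \<Xi>) \<cdot> prod_map C (\<xi> X) (\<xi> Y) = u \<cdot> pairing C (\<xi> Y \<cdot> ?q) (Idn C \<Xi> \<cdot> (\<xi> X \<cdot> ?p))"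
      using X Y u by (simp add: prod_map_def)
    also have "\<dots> = (v Y \<cdot> swap Y \<Xi>) \<cdot> pairing C ?q (\<xi> X \<cdot> ?p)"
      by (rule prod_map_eqD [OF u(4) [OF Y]]) (use X Y u in simp_all)
    also have "\<dots> = v Y \<cdot> pairing C (\<xi> X \<cdot> ?p) ?q"
      using X Y by simp
    also have "\<dots> = \<xi> (prod_ob C X Y)"
      using v_pairing [of X Y ?p ?q] X Y by simp
    finally show ?thesis .
  qed
  then show ?thesis
    by (intro exI [of _ "u \<cdot> swap \<Xi> \<Xi>"]) (use u in simp)
qed

abbreviation meet_Xi :: 'm where
  "meet_Xi \<equiv> Xi_meet C \<Xi> \<xi>"

lemma Xi_meet: "meet_Xi \<in> hom C (prod_ob C \<Xi> \<Xi>) \<Xi>"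
  "\<lbrakk>X \<in> Ob C; Y \<in> Ob C\<rbrakk> \<Longrightarrow> meet_Xi \<cdot> prod_map C (\<xi> X) (\<xi> Y) = \<xi> (prod_ob C X Y)"
proof -
  have "\<exists>!w. w \<in> hom C (prod_ob C \<Xi> \<Xi>) \<Xi> \<and>
    (\<forall>X\<in>Ob C. \<forall>Y\<in>Ob C. w \<cdot> prod_map C (\<xi> X) (\<xi> Y) = \<xi> (prod_ob C X Y))"
  proof (rule ex_ex1I [OF Xi_meet_ex])
    fix a b
    assume ab: "a \<in> hom C (prod_ob C \<Xi> \<Xi>) \<Xi> \<and>
        (\<forall>X\<in>Ob C. \<forall>Y\<in>Ob C. a \<cdot> prod_map C (\<xi> X) (\<xi> Y) = \<xi> (prod_ob C X Y))"
      "b \<in> hom C (prod_ob C \<Xi> \<Xi>) \<Xi> \<and>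
        (\<forall>X\<in>Ob C. \<forall>Y\<in>Ob C. b \<cdot> prod_map C (\<xi> X) (\<xi> Y) = \<xi> (prod_ob C X Y))"
    show "a = b" by (rule xi_ext_prod) (use ab in simp_all)
  qed
  from theI' [OF this] show "meet_Xi \<in> hom C (prod_ob C \<Xi> \<Xi>) \<Xi>"
    "\<lbrakk>X \<in> Ob C; Y \<in> Ob C\<rbrakk> \<Longrightarrow> meet_Xi \<cdot> prod_map C (\<xi> X) (\<xi> Y) = \<xi> (prod_ob C X Y)"
    unfolding Xi_meet_def by blast+
qed

lemma meet_Xi_simps [simp]: "meet_Xi \<in> Ar C" "Dom C meet_Xi = prod_ob C \<Xi> \<Xi>" "Cod C meet_Xi = \<Xi>"
  using Xi_meet(1) by simp_all

lemma meet_Xi_pairing: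
  assumes "X \<in> Ob C" "Y \<in> Ob C" "x \<in> Ar C" "y \<in> Ar C" "Dom C x = Dom C y" "Cod C x = X" "Cod C y = Y"
  shows "meet_Xi \<cdot> pairing C (\<xi> X \<cdot> x) (\<xi> Y \<cdot> y) = \<xi> (prod_ob C X Y) \<cdot> pairing C x y"
  by (rule prod_map_eqD [OF Xi_meet(2)]) (use assms in simp_all)

text \<open>Each law is checked on the jointly epic morphisms \<open>\<xi>\<close>, where it compares \<open>\<xi>\<close> at two objects
  joined by a structural morphism of products: \<open>X \<rightarrow> X \<times> 1\<close>, the diagonal, the symmetry and the
  associativity. These are monic, and \<open>\<xi>\<close> is invariant under monomorphisms.\<close>

lemma Xi_semilattice: "internal_semilattice C (Xi_slat C \<Xi> \<xi>)"
proof (rule internal_semilatticeI, unfold Xi_slat_def slat.simps)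
  show "\<Xi> \<in> Ob C" "\<xi> (one C) \<in> hom C (one C) \<Xi>" "meet_Xi \<in> hom C (prod_ob C \<Xi> \<Xi>) \<Xi>"
    by simp_all
next
  fix x assume x: "x \<in> Ar C" "Cod C x = \<Xi>"
  have "meet_Xi \<cdot> pairing C (Idn C \<Xi>) (\<xi> (one C) \<cdot> bang C \<Xi>) = Idn C \<Xi>"
  proof (rule xi_ext)
    fix X assume X: "X \<in> Ob C"
    have m: "monic C (pairing C (Idn C X) (bang C X))"
      by (rule monic_pairing_left) (use X monic_id in simp_all)
    have "(meet_Xi \<cdot> pairing C (Idn C \<Xi>) (\<xi> (one C) \<cdot> bang C \<Xi>)) \<cdot> \<xi> X
        = meet_Xi \<cdot> pairing C (\<xi> X \<cdot> Idn C X) (\<xi> (one C) \<cdot> bang C X)"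
      using X by simp
    also have "\<dots> = \<xi> (prod_ob C X (one C)) \<cdot> pairing C (Idn C X) (bang C X)"
      by (rule meet_Xi_pairing) (use X in simp_all)
    also have "\<dots> = \<xi> X"
      using xi_mono [OF m] X by simp
    finally show "(meet_Xi \<cdot> pairing C (Idn C \<Xi>) (\<xi> (one C) \<cdot> bang C \<Xi>)) \<cdot> \<xi> X = Idn C \<Xi> \<cdot> \<xi> X"
      using X by simp
  qed simp_all
  then have "meet_Xi \<cdot> (pairing C (Idn C \<Xi>) (\<xi> (one C) \<cdot> bang C \<Xi>) \<cdot> x) = Idn C \<Xi> \<cdot> x"
    by (rule comp_cong_left) (use x in simp_all)
  then show "meet_Xi \<cdot> pairing C x (\<xi> (one C) \<cdot> bang C (Dom C x)) = x"
    using x by simp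
  have "meet_Xi \<cdot> pairing C (Idn C \<Xi>) (Idn C \<Xi>) = Idn C \<Xi>"
  proof (rule xi_ext)
    fix X assume X: "X \<in> Ob C"
    have m: "monic C (pairing C (Idn C X) (Idn C X))"
      by (rule monic_pairing_left) (use X monic_id in simp_all)
    have "(meet_Xi \<cdot> pairing C (Idn C \<Xi>) (Idn C \<Xi>)) \<cdot> \<xi> X
        = meet_Xi \<cdot> pairing C (\<xi> X \<cdot> Idn C X) (\<xi> X \<cdot> Idn C X)"
      using X by simp
    also have "\<dots> = \<xi> (prod_ob C X X) \<cdot> pairing C (Idn C X) (Idn C X)"
      by (rule meet_Xi_pairing) (use X in simp_all)
    also have "\<dots> = \<xi> X"
      using xi_mono [OF m] X by simp
    finally show "(meet_Xi \<cdot> pairing C (Idn C \<Xi>) (Idn C \<Xi>)) \<cdot> \<xi> X = Idn C \<Xi> \<cdot> \<xi> X"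
      using X by simp
  qed simp_all
  then have "meet_Xi \<cdot> (pairing C (Idn C \<Xi>) (Idn C \<Xi>) \<cdot> x) = Idn C \<Xi> \<cdot> x"
    by (rule comp_cong_left) (use x in simp_all)
  then show "meet_Xi \<cdot> pairing C x x = x"
    using x by simp
  fix y assume y: "y \<in> Ar C" "Dom C y = Dom C x" "Cod C y = \<Xi>"
  have "meet_Xi \<cdot> swap \<Xi> \<Xi> = meet_Xi"
  proof (rule xi_ext_prod)
    fix X Y assume XY: "X \<in> Ob C" "Y \<in> Ob C"
    have m: "monic C (swap X Y)"
      by (rule monic_section [OF swap_swap]) (use XY in simp_all)
    have "(meet_Xi \<cdot> swap \<Xi> \<Xi>) \<cdot> prod_map C (\<xi> X) (\<xi> Y)
        = meet_Xi \<cdot> pairing C (\<xi> Y \<cdot> pr2 C X Y) (\<xi> X \<cdot> pr1 C X Y)"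
      using XY by (simp add: prod_map_def)
    also have "\<dots> = \<xi> (prod_ob C Y X) \<cdot> pairing C (pr2 C X Y) (pr1 C X Y)"
      by (rule meet_Xi_pairing) (use XY in simp_all)
    also have "\<dots> = \<xi> (prod_ob C X Y)"
      using xi_mono [OF m] XY by (simp add: swap_def)
    also have "\<dots> = meet_Xi \<cdot> prod_map C (\<xi> X) (\<xi> Y)"
      using Xi_meet(2) [OF XY] by simp
    finally show "(meet_Xi \<cdot> swap \<Xi> \<Xi>) \<cdot> prod_map C (\<xi> X) (\<xi> Y) = meet_Xi \<cdot> prod_map C (\<xi> X) (\<xi> Y)" .
  qed simp_all
  then have "meet_Xi \<cdot> (swap \<Xi> \<Xi> \<cdot> pairing C y x) = meet_Xi \<cdot> pairing C y x"
    by (rule comp_cong_left) (use x y in simp_all)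
  then show "meet_Xi \<cdot> pairing C x y = meet_Xi \<cdot> pairing C y x"
    using x y by simp
  fix z assume z: "z \<in> Ar C" "Dom C z = Dom C x" "Cod C z = \<Xi>"
  let ?p = "\<lambda>X Y Z. pr1 C X Y \<cdot> pr1 C (prod_ob C X Y) Z"
    and ?q = "\<lambda>X Y Z. pr2 C X Y \<cdot> pr1 C (prod_ob C X Y) Z"
    and ?r = "\<lambda>X Y Z. pr2 C (prod_ob C X Y) Z"
  let ?a = "meet_Xi \<cdot> pairing C (meet_Xi \<cdot> pr1 C (prod_ob C \<Xi> \<Xi>) \<Xi>) (?r \<Xi> \<Xi> \<Xi>)"
  let ?b = "meet_Xi \<cdot> pairing C (?p \<Xi> \<Xi> \<Xi>) (meet_Xi \<cdot> pairing C (?q \<Xi> \<Xi> \<Xi>) (?r \<Xi> \<Xi> \<Xi>))"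
  have "?a = ?b"
  proof (rule jointly_epicD
      [OF jointly_epic_prod [OF jointly_epic_prod [OF xi_jointly_epic xi_jointly_epic] xi_jointly_epic]])
    fix f
    assume "f \<in> {prod_map C g h | g h.
      g \<in> {prod_map C g h | g h. g \<in> \<xi> ` Ob C \<and> h \<in> \<xi> ` Ob C} \<and> h \<in> \<xi> ` Ob C}"
    then obtain X Y Z where XYZ: "X \<in> Ob C" "Y \<in> Ob C" "Z \<in> Ob C"
      and f: "f = prod_map C (prod_map C (\<xi> X) (\<xi> Y)) (\<xi> Z)" by blast
    let ?P = "prod_ob C (prod_ob C X Y) Z"
    have pq: "pairing C (?p X Y Z) (?q X Y Z) = pr1 C (prod_ob C X Y) Z"
      by (rule pairing_eta) (use XYZ in simp_all)
    have "?a \<cdot> f = meet_Xi \<cdot> pairing C (meet_Xi \<cdot> pairing C (\<xi> X \<cdot> ?p X Y Z) (\<xi> Y \<cdot> ?q X Y Z))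
        (\<xi> Z \<cdot> ?r X Y Z)"
      using XYZ by (simp add: f prod_map_def)
    also have "meet_Xi \<cdot> pairing C (\<xi> X \<cdot> ?p X Y Z) (\<xi> Y \<cdot> ?q X Y Z)
        = \<xi> (prod_ob C X Y) \<cdot> pairing C (?p X Y Z) (?q X Y Z)"
      by (rule meet_Xi_pairing) (use XYZ in simp_all)
    also have "meet_Xi \<cdot> pairing C (\<xi> (prod_ob C X Y) \<cdot> pairing C (?p X Y Z) (?q X Y Z)) (\<xi> Z \<cdot> ?r X Y Z)
        = \<xi> ?P \<cdot> pairing C (pairing C (?p X Y Z) (?q X Y Z)) (?r X Y Z)"
      by (rule meet_Xi_pairing) (use XYZ in simp_all)
    also have "\<dots> = \<xi> ?P"
      unfolding pq using XYZ by simp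
    finally have a: "?a \<cdot> f = \<xi> ?P" .
    let ?i = "pairing C (?p X Y Z) (pairing C (?q X Y Z) (?r X Y Z))"
    let ?YZ = "prod_ob C Y Z"
    have "pairing C (pairing C (pr1 C X ?YZ) (pr1 C Y Z \<cdot> pr2 C X ?YZ)) (pr2 C Y Z \<cdot> pr2 C X ?YZ) \<cdot> ?i
        = pairing C (pairing C (?p X Y Z) (?q X Y Z)) (?r X Y Z)"
      using XYZ by simp
    also have "\<dots> = Idn C ?P"
      unfolding pq using XYZ by simp
    finally have i: "monic C ?i"
      by (rule monic_section) (use XYZ in simp_all)
    have "?b \<cdot> f = meet_Xi \<cdot> pairing C (\<xi> X \<cdot> ?p X Y Z)
        (meet_Xi \<cdot> pairing C (\<xi> Y \<cdot> ?q X Y Z) (\<xi> Z \<cdot> ?r X Y Z))"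
      using XYZ by (simp add: f prod_map_def)
    also have "meet_Xi \<cdot> pairing C (\<xi> Y \<cdot> ?q X Y Z) (\<xi> Z \<cdot> ?r X Y Z)
        = \<xi> ?YZ \<cdot> pairing C (?q X Y Z) (?r X Y Z)"
      by (rule meet_Xi_pairing) (use XYZ in simp_all)
    also have "meet_Xi \<cdot> pairing C (\<xi> X \<cdot> ?p X Y Z) (\<xi> ?YZ \<cdot> pairing C (?q X Y Z) (?r X Y Z))
        = \<xi> (prod_ob C X ?YZ) \<cdot> ?i"
      by (rule meet_Xi_pairing) (use XYZ in simp_all)
    also have "\<dots> = \<xi> ?P"
      using xi_mono [OF i] XYZ by simp
    finally show "?a \<cdot> f = ?b \<cdot> f" using a by simp
  qed simp_all
  then have "?a \<cdot> pairing C (pairing C x y) z = ?b \<cdot> pairing C (pairing C x y) z"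
    by simp
  then show "meet_Xi \<cdot> pairing C (meet_Xi \<cdot> pairing C x y) z
      = meet_Xi \<cdot> pairing C x (meet_Xi \<cdot> pairing C y z)"
    using x y z by simp
qed

end

section \<open>Coreflective subcategories closed under subobjects\<close>

definition coreflection :: "('o, 'm) cat \<Rightarrow> 'o set \<Rightarrow> 'o \<Rightarrow> 'm \<Rightarrow> bool" where
  "coreflection C Q X e \<longleftrightarrow> e \<in> hom C (Dom C e) X \<and> Dom C e \<in> Q \<and>
    (\<forall>Y\<in>Q. \<forall>h\<in>hom C Y X. \<exists>!k. k \<in> hom C Y (Dom C e) \<and> e \<cdot>\<^bsub>C\<^esub> k = h)"

lemma coreflection_simps:
  assumes "coreflection C Q X e"
  shows "e \<in> Ar C" "Cod C e = X" "Dom C e \<in> Q"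
  using assms by (simp_all add: coreflection_def)

lemma coreflection_lift:
  assumes "coreflection C Q X e" "h \<in> Ar C" "Dom C h \<in> Q" "Cod C h = X"
  obtains k where "k \<in> Ar C" "Dom C k = Dom C h" "Cod C k = Dom C e" "e \<cdot>\<^bsub>C\<^esub> k = h"
proof -
  have "h \<in> hom C (Dom C h) X" using assms(2,4) by simp
  then have "\<exists>!k. k \<in> hom C (Dom C h) (Dom C e) \<and> e \<cdot>\<^bsub>C\<^esub> k = h"
    using assms(1,3) unfolding coreflection_def by blast
  then show ?thesis using that unfolding hom_iff by blast
qed

lemma coreflection_unique:
  assumes "coreflection C Q X e" "k \<in> Ar C" "k' \<in> Ar C" "Dom C k = Dom C k'" "Dom C k' \<in> Q"
    "Cod C k = Dom C e" "Cod C k' = Dom C e" "e \<cdot>\<^bsub>C\<^esub> k = e \<cdot>\<^bsub>C\<^esub> k'" "category C"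
  shows "k = k'"
proof -
  interpret category C by fact
  have "e \<cdot>\<^bsub>C\<^esub> k' \<in> hom C (Dom C k') X"
    using assms coreflection_simps [OF assms(1)] by simp
  then have "\<exists>!k. k \<in> hom C (Dom C k') (Dom C e) \<and> e \<cdot>\<^bsub>C\<^esub> k = e \<cdot>\<^bsub>C\<^esub> k'"
    using assms(1,5) unfolding coreflection_def by blast
  moreover have "k \<in> hom C (Dom C k') (Dom C e)" "k' \<in> hom C (Dom C k') (Dom C e)"
    using assms(2-7) by simp_all
  ultimately show ?thesis using assms(8) by blast
qed

text \<open>Closure under subobjects is what singles out the hyperconnected quotients. Together with
  finite products it yields closure under all finite limits and under isomorphism.\<close>

locale hereditary_coreflective = topos C for C :: "('o, 'm) cat" (structure) +
  fixes Q :: "'o set"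
  assumes sub_ob: "Q \<subseteq> Ob C"
    and one_in: "one C \<in> Q"
    and prod_in: "\<lbrakk>X \<in> Q; Y \<in> Q\<rbrakk> \<Longrightarrow> prod_ob C X Y \<in> Q"
    and sub_in: "\<lbrakk>monic C m; Cod C m \<in> Q\<rbrakk> \<Longrightarrow> Dom C m \<in> Q"
    and coreflect: "X \<in> Ob C \<Longrightarrow> \<exists>e. coreflection C Q X e"
begin

lemma in_ob [simp]: "X \<in> Q \<Longrightarrow> X \<in> Ob C"
  using sub_ob by blast

lemma pullback_in:
  assumes pb: "is_pullback C f g p q" and "Dom C f \<in> Q" "Dom C g \<in> Q"
  shows "Dom C p \<in> Q"
proof -
  note pbs = pullback_simps [OF pb]
  have "Cod C (pairing C p q) \<in> Q" using pbs assms prod_in by simp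
  then have "Dom C (pairing C p q) \<in> Q" by (rule sub_in [OF pullback_pairing_monic [OF pb]])
  then show ?thesis using pbs by simp
qed

text \<open>The kernel pair of a coreflection lies in \<open>Q\<close>, as a subobject of a product of objects
  of \<open>Q\<close>, and maps out of it into the coreflection are determined by their composite with it.\<close>

lemma coreflection_monic:
  assumes e: "coreflection C Q X e"
  shows "monic C e"
proof (rule monicI)
  note es = coreflection_simps [OF e]
  show "e \<in> Ar C" by (rule es)
  fix f g
  assume fg: "f \<in> Ar C" "g \<in> Ar C" "Cod C f = Dom C e" "Cod C g = Dom C e" "Dom C f = Dom C g"
    "e \<cdot> f = e \<cdot> g"
  obtain p q where pb: "is_pullback C e e p q"
    by (rule pullback_ex [of e e]) (use es in simp_all)
  note pbs = pullback_simps [OF pb]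
  have "Dom C p \<in> Q" by (rule pullback_in [OF pb]) (use es in simp_all)
  then have "p = q"
    by - (rule coreflection_unique [OF e], use pbs category_axioms in simp_all)
  moreover obtain u where "u \<in> Ar C" "Cod C u = Dom C p" "p \<cdot> u = f" "q \<cdot> u = g"
    by (rule pullback_lift [OF pb, of f g]) (use fg es in simp_all)
  ultimately show "f = g" by simp
qed

text \<open>A section of the coreflection is monic, so it exhibits \<open>X\<close> as a subobject of an object of
  \<open>Q\<close>.\<close>

lemma in_iff_coreflection_total:
  assumes e: "coreflection C Q X e"
  shows "X \<in> Q \<longleftrightarrow> factors_through C (Idn C X) e"
proof
  note es = coreflection_simps [OF e]
  have X: "X \<in> Ob C" using es by auto
  show "factors_through C (Idn C X) e" if XQ: "X \<in> Q"
  proof -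
    obtain k where "k \<in> Ar C" "Dom C k = Dom C (Idn C X)" "Cod C k = Dom C e" "e \<cdot> k = Idn C X"
      by (rule coreflection_lift [OF e, of "Idn C X"]) (use XQ X in simp_all)
    then show ?thesis by - (rule factors_throughI)
  qed
  show "X \<in> Q" if fac: "factors_through C (Idn C X) e"
  proof -
    obtain k where k: "k \<in> Ar C" "Dom C k = Dom C (Idn C X)" "Cod C k = Dom C e" "e \<cdot> k = Idn C X"
      using fac by (rule factors_throughE)
    have "monic C k" by (rule monic_section [OF k(4)]) (use k es X in simp_all)
    then show ?thesis using sub_in [of k] k es X by simp
  qed
qed

end

section \<open>Filters of local states as coreflective subcategories\<close>

context local_state_topos
begin

abbreviation Xi :: "('o, 'm) slat" where
  "Xi \<equiv> Xi_slat C \<Xi> \<xi>"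

lemma Xi_slat_simps [simp]: "Carrier Xi = \<Xi>" "Top Xi = \<xi> (one C)" "Meet Xi = meet_Xi"
  by (simp_all add: Xi_slat_def)

text \<open>The graph of \<open>f : Y \<rightarrow> X\<close> is a monomorphism \<open>Y \<rightarrow> Y \<times> X\<close>,
  whence \<open>\<xi>\<^sub>Y = \<xi>\<^sub>Y \<and> \<xi>\<^sub>X f\<close>: local states can only grow along morphisms.\<close>

lemma xi_le:
  assumes "f \<in> Ar C" "Dom C f = Y" "Cod C f = X"
  shows "meet_Xi \<cdot> pairing C (\<xi> Y) (\<xi> X \<cdot> f) = \<xi> Y"
proof -
  have XY: "X \<in> Ob C" "Y \<in> Ob C" using assms by auto
  have m: "monic C (pairing C (Idn C Y) f)"
    by (rule monic_pairing_left) (use assms XY monic_id in simp_all)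
  have "meet_Xi \<cdot> pairing C (\<xi> Y \<cdot> Idn C Y) (\<xi> X \<cdot> f) = \<xi> (prod_ob C Y X) \<cdot> pairing C (Idn C Y) f"
    by (rule meet_Xi_pairing) (use assms XY in simp_all)
  also have "\<dots> = \<xi> Y" using xi_mono [OF m] assms XY by simp
  finally show ?thesis using XY by simp
qed

text \<open>The coreflection of \<open>X\<close> is the pullback of the filter along \<open>\<xi>\<^sub>X\<close>: upward closure and
  \<open>xi_le\<close> make every morphism from a selected object factor through it.\<close>

lemma hereditary_coreflective_of_filter:
  assumes F: "internal_filter C Xi k"
  shows "hereditary_coreflective C {X \<in> Ob C. factors_through C (\<xi> X) k}" (is "hereditary_coreflective C ?Q")
proof
  have k: "monic C k" "Cod C k = \<Xi>"
    using F by (simp_all add: internal_filter_def subobj_of_def)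
  show "?Q \<subseteq> Ob C" by blast
  show "one C \<in> ?Q"
    using F by (simp add: internal_filter_def)
  show "prod_ob C X Y \<in> ?Q" if "X \<in> ?Q" "Y \<in> ?Q" for X Y
  proof -
    have XY: "X \<in> Ob C" "Y \<in> Ob C" "factors_through C (\<xi> X) k" "factors_through C (\<xi> Y) k"
      using that by simp_all
    obtain u where u: "u \<in> Ar C" "Dom C u = Dom C (\<xi> X)" "Cod C u = Dom C k" "k \<cdot> u = \<xi> X"
      using XY(3) by (rule factors_throughE)
    obtain v where v: "v \<in> Ar C" "Dom C v = Dom C (\<xi> Y)" "Cod C v = Dom C k" "k \<cdot> v = \<xi> Y"
      using XY(4) by (rule factors_throughE)
    have "factors_through C ((meet_Xi \<cdot> prod_map C k k) \<cdot> prod_map C u v) k"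
      by (rule factors_through_comp) (use F k u v XY in \<open>simp_all add: internal_filter_def\<close>)
    moreover have "prod_map C k k \<cdot> prod_map C u v = prod_map C (k \<cdot> u) (k \<cdot> v)"
      using k(1) u(1-3) v(1-3) XY by (simp add: prod_map_def)
    ultimately have "factors_through C (meet_Xi \<cdot> prod_map C (\<xi> X) (\<xi> Y)) k"
      using k u v XY by simp
    then show ?thesis using Xi_meet(2) XY by simp
  qed
  show "Dom C m \<in> ?Q" if m: "monic C m" "Cod C m \<in> ?Q" for m
  proof -
    have "factors_through C (\<xi> (Cod C m) \<cdot> m) k"
      by (rule factors_through_comp) (use m k in simp_all)
    then show ?thesis using xi_mono [OF m(1)] m by simp
  qed
  show "\<exists>e. coreflection C ?Q X e" if X: "X \<in> Ob C" for X
  proof -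
    obtain e q where pb: "is_pullback C (\<xi> X) k e q"
      by (rule pullback_ex [of "\<xi> X" k]) (use X k in simp_all)
    note pbs = pullback_simps [OF pb]
    have e: "monic C e" by (rule pullback_monic [OF pb k(1)])
    have ec: "Cod C e = X" using pbs X by simp
    have "\<xi> (Dom C e) = k \<cdot> q" using pbs X xi_mono [OF e] by simp
    then have "factors_through C (\<xi> (Dom C e)) k"
      by - (rule factors_throughI [of k q], use pbs in simp_all)
    then have eQ: "Dom C e \<in> ?Q" using pbs by simp
    have "coreflection C ?Q X e"
      unfolding coreflection_def
    proof (intro conjI ballI)
      show "e \<in> hom C (Dom C e) X" using pbs ec by simp
      show "Dom C e \<in> ?Q" by (rule eQ)
      fix Y h assume Y: "Y \<in> ?Q" and h: "h \<in> hom C Y X"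
      from Y have "factors_through C (\<xi> Y) k" by simp
      then obtain u where u: "u \<in> Ar C" "Dom C u = Dom C (\<xi> Y)" "Cod C u = Dom C k" "k \<cdot> u = \<xi> Y"
        by (rule factors_throughE)
      have "meet_Xi \<cdot> pairing C (k \<cdot> u) (\<xi> X \<cdot> h) = k \<cdot> u"
        using xi_le [of h Y X] u(4) h by simp
      moreover have "u \<in> hom C Y (Dom C k)" "\<xi> X \<cdot> h \<in> hom C Y (Carrier Xi)"
        using u Y h X by simp_all
      ultimately have "factors_through C (\<xi> X \<cdot> h) k"
        using F unfolding internal_filter_def Xi_slat_simps by blast
      then obtain v where v: "v \<in> Ar C" "Dom C v = Dom C (\<xi> X \<cdot> h)" "Cod C v = Dom C k"
          "k \<cdot> v = \<xi> X \<cdot> h"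
        by (rule factors_throughE)
      obtain w where w: "w \<in> Ar C" "Dom C w = Dom C h" "Cod C w = Dom C e" "e \<cdot> w = h"
        by (rule pullback_lift [OF pb, of h v]) (use v h X in simp_all)
      show "\<exists>!w. w \<in> hom C Y (Dom C e) \<and> e \<cdot> w = h"
      proof (rule ex1I [of _ w])
        show "w \<in> hom C Y (Dom C e) \<and> e \<cdot> w = h" using w h by simp
        show "w' = w" if "w' \<in> hom C Y (Dom C e) \<and> e \<cdot> w' = h" for w'
          by (rule monicD [OF e]) (use that w h in simp_all)
      qed
    qed
    then show ?thesis ..
  qed
qed

text \<open>Conversely the coreflections \<open>RX \<rightarrow> X\<close> are monic and compatible with
  monomorphisms, so that their characteristic morphisms form a cocone and glue to
  \<open>\<Xi> \<rightarrow> \<Omega>\<close>.\<close>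

lemma hom_of_hereditary_coreflective:
  assumes "hereditary_coreflective C Q"
  obtains \<chi> where "semilattice_hom C Xi (Omega_slat C \<Omega> tr) \<chi>"
    "Q = {X \<in> Ob C. \<chi> \<cdot> \<xi> X = tr \<cdot> bang C X}"
proof -
  interpret hereditary_coreflective C Q by fact
  obtain r where r: "\<And>X. X \<in> Ob C \<Longrightarrow> coreflection C Q X (r X)"
    using coreflect by metis
  have rs [simp]: "r X \<in> Ar C" "Cod C (r X) = X" "Dom C (r X) \<in> Q" "monic C (r X)"
    if "X \<in> Ob C" for X
    using coreflection_simps [OF r [OF that]] coreflection_monic [OF r [OF that]] by simp_all
  have into_r: "factors_through C h (r X)" if h: "h \<in> Ar C" "Dom C h \<in> Q" "Cod C h = X" for h X
  proof -
    have "X \<in> Ob C" using h by auto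
    then obtain k where "k \<in> Ar C" "Dom C k = Dom C h" "Cod C k = Dom C (r X)" "r X \<cdot> k = h"
      by (rule coreflection_lift [OF r h])
    then show ?thesis by - (rule factors_throughI)
  qed
  define \<zeta> where "\<zeta> X = char_of C tr (r X)" for X
  have \<zeta>s [simp]: "\<zeta> X \<in> Ar C" "Dom C (\<zeta> X) = X" "Cod C (\<zeta> X) = \<Omega>" if "X \<in> Ob C" for X
    using that by (simp_all add: \<zeta>_def)
  have \<zeta>_true: "\<zeta> X \<cdot> h = tr \<cdot> bang C (Dom C h) \<longleftrightarrow> factors_through C h (r X)"
    if "h \<in> Ar C" "Cod C h = X" for h X
    unfolding \<zeta>_def by (rule char_true_iff) (use that in auto)
  \<comment> \<open>The intersection of \<open>m\<close> with the coreflection of its codomain is a subobject of an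
    object of \<open>Q\<close>, hence in \<open>Q\<close>, hence below the coreflection of the domain.\<close>
  have nat: "\<zeta> (Cod C m) \<cdot> m = \<zeta> (Dom C m)" if m: "monic C m" for m
  proof (rule omega_ext)
    fix h assume "h \<in> Ar C" "Cod C h = Dom C (\<zeta> (Cod C m) \<cdot> m)"
    then have h: "h \<in> Ar C" "Cod C h = Dom C m" using m by simp_all
    have "factors_through C (m \<cdot> h) (r (Cod C m)) \<longleftrightarrow> factors_through C h (r (Dom C m))"
    proof
      assume "factors_through C (m \<cdot> h) (r (Cod C m))"
      then obtain v where v: "v \<in> Ar C" "Dom C v = Dom C (m \<cdot> h)" "Cod C v = Dom C (r (Cod C m))"
          "r (Cod C m) \<cdot> v = m \<cdot> h"
        by (rule factors_throughE)
      obtain p q where pb: "is_pullback C m (r (Cod C m)) p q"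
        by (rule pullback_ex [of m "r (Cod C m)"]) (use m in simp_all)
      note pbs = pullback_simps [OF pb]
      have "monic C q" by (rule pullback_monic [OF pullback_sym [OF pb] m])
      then have "Dom C p \<in> Q" using sub_in [of q] pbs m by simp
      then have pr: "factors_through C p (r (Dom C m))"
        by (intro into_r) (use pbs in simp_all)
      obtain u where u: "u \<in> Ar C" "Dom C u = Dom C h" "Cod C u = Dom C p" "p \<cdot> u = h"
        by (rule pullback_lift [OF pb, of h v]) (use h v m in simp_all)
      have "factors_through C (p \<cdot> u) (r (Dom C m))"
        by (rule factors_through_comp [OF pr]) (use u m in simp_all)
      then show "factors_through C h (r (Dom C m))" using u by simp
    next
      assume "factors_through C h (r (Dom C m))"
      then obtain u where u: "u \<in> Ar C" "Dom C u = Dom C h" "Cod C u = Dom C (r (Dom C m))"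
          "r (Dom C m) \<cdot> u = h"
        by (rule factors_throughE)
      have "factors_through C (m \<cdot> r (Dom C m)) (r (Cod C m))"
        by (rule into_r) (use m in simp_all)
      then have "factors_through C ((m \<cdot> r (Dom C m)) \<cdot> u) (r (Cod C m))"
        by (rule factors_through_comp) (use m u in simp_all)
      then show "factors_through C (m \<cdot> h) (r (Cod C m))" using u m by simp
    qed
    then show "(\<zeta> (Cod C m) \<cdot> m) \<cdot> h = tr \<cdot> bang C (Dom C h)
        \<longleftrightarrow> \<zeta> (Dom C m) \<cdot> h = tr \<cdot> bang C (Dom C h)"
      using \<zeta>_true [of "m \<cdot> h" "Cod C m"] \<zeta>_true [of h "Dom C m"] h m by simp
  qed (use m in simp_all)
  obtain \<chi> where \<chi>: "\<chi> \<in> Ar C" "Dom C \<chi> = \<Xi>" "Cod C \<chi> = \<Omega>" "\<And>X. X \<in> Ob C \<Longrightarrow> \<chi> \<cdot> \<xi> X = \<zeta> X"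
    by (rule xi_desc [of \<Omega> \<zeta>]) (use nat in simp_all)
  have Q: "X \<in> Q \<longleftrightarrow> \<zeta> X = tr \<cdot> bang C X" if "X \<in> Ob C" for X
    using in_iff_coreflection_total [OF r [OF that]] \<zeta>_true [of "Idn C X" X] that by simp
  have "\<chi> \<cdot> meet_Xi = meet_Omega \<cdot> prod_map C \<chi> \<chi>"
  proof (rule xi_ext_prod)
    fix X Y assume XY: "X \<in> Ob C" "Y \<in> Ob C"
    have "\<zeta> (prod_ob C X Y) = meet_Omega \<cdot> prod_map C (\<zeta> X) (\<zeta> Y)"
    proof (rule omega_ext)
      fix h assume "h \<in> Ar C" "Cod C h = Dom C (\<zeta> (prod_ob C X Y))"
      then have h: "h \<in> Ar C" "Cod C h = prod_ob C X Y" using XY by simp_all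
      let ?x = "pr1 C X Y \<cdot> h" and ?y = "pr2 C X Y \<cdot> h"
      let ?R = "r (prod_ob C X Y)"
      have "factors_through C h ?R \<longleftrightarrow> factors_through C ?x (r X) \<and> factors_through C ?y (r Y)"
      proof (intro iffI conjI)
        assume "factors_through C h ?R"
        then obtain u where u: "u \<in> Ar C" "Dom C u = Dom C h" "Cod C u = Dom C ?R" "?R \<cdot> u = h"
          by (rule factors_throughE)
        have "factors_through C ((pr1 C X Y \<cdot> ?R) \<cdot> u) (r X)"
          by (rule factors_through_comp, rule into_r) (use XY u in simp_all)
        then show "factors_through C ?x (r X)" using u XY by simp
        have "factors_through C ((pr2 C X Y \<cdot> ?R) \<cdot> u) (r Y)"
          by (rule factors_through_comp, rule into_r) (use XY u in simp_all)
        then show "factors_through C ?y (r Y)" using u XY by simp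
      next
        assume "factors_through C ?x (r X) \<and> factors_through C ?y (r Y)"
        then have fx: "factors_through C ?x (r X)" and fy: "factors_through C ?y (r Y)"
          by simp_all
        obtain a where a: "a \<in> Ar C" "Dom C a = Dom C ?x" "Cod C a = Dom C (r X)" "r X \<cdot> a = ?x"
          using fx by (rule factors_throughE)
        obtain b where b: "b \<in> Ar C" "Dom C b = Dom C ?y" "Cod C b = Dom C (r Y)" "r Y \<cdot> b = ?y"
          using fy by (rule factors_throughE)
        have "factors_through C (prod_map C (r X) (r Y) \<cdot> pairing C a b) ?R"
          by (rule factors_through_comp, rule into_r) (use XY h a(1-3) b(1-3) prod_in in simp_all)
        moreover have "prod_map C (r X) (r Y) \<cdot> pairing C a b = pairing C ?x ?y"
          using XY h a b by simp
        moreover have "pairing C ?x ?y = h" by (rule pairing_eta) (use XY h in simp_all)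
        ultimately show "factors_through C h ?R" by simp
      qed
      moreover have "prod_map C (\<zeta> X) (\<zeta> Y) \<cdot> h = pairing C (\<zeta> X \<cdot> ?x) (\<zeta> Y \<cdot> ?y)"
        using XY h by (simp add: prod_map_def)
      then have "(meet_Omega \<cdot> prod_map C (\<zeta> X) (\<zeta> Y)) \<cdot> h
          = meet_Omega \<cdot> pairing C (\<zeta> X \<cdot> ?x) (\<zeta> Y \<cdot> ?y)"
        using XY h by simp
      ultimately show "\<zeta> (prod_ob C X Y) \<cdot> h = tr \<cdot> bang C (Dom C h)
          \<longleftrightarrow> (meet_Omega \<cdot> prod_map C (\<zeta> X) (\<zeta> Y)) \<cdot> h = tr \<cdot> bang C (Dom C h)"
        using \<zeta>_true [of h "prod_ob C X Y"] \<zeta>_true [of ?x X] \<zeta>_true [of ?y Y] XY h by simp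
    qed (use XY in simp_all)
    moreover have "prod_map C \<chi> \<chi> \<cdot> prod_map C (\<xi> X) (\<xi> Y) = prod_map C (\<zeta> X) (\<zeta> Y)"
      unfolding prod_map_def [of C "\<xi> X"] using XY \<chi>(1-3) \<chi>(4) [symmetric]
      by (simp add: prod_map_def)
    moreover have "meet_Xi \<cdot> prod_map C (\<xi> X) (\<xi> Y) = \<xi> (prod_ob C X Y)"
      using Xi_meet(2) XY by simp
    ultimately show "(\<chi> \<cdot> meet_Xi) \<cdot> prod_map C (\<xi> X) (\<xi> Y)
        = (meet_Omega \<cdot> prod_map C \<chi> \<chi>) \<cdot> prod_map C (\<xi> X) (\<xi> Y)"
      using XY \<chi> by simp
  qed (use \<chi> in simp_all)
  moreover have "\<chi> \<cdot> \<xi> (one C) = tr"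
    using \<chi>(4) [of "one C"] Q [of "one C"] one_in by (simp add: bang_one)
  ultimately have "semilattice_hom C Xi (Omega_slat C \<Omega> tr) \<chi>"
    unfolding semilattice_hom_def using Xi_semilattice Omega_semilattice \<chi>(1-3)
    by (simp add: Omega_slat_def)
  moreover have "Q = {X \<in> Ob C. \<chi> \<cdot> \<xi> X = tr \<cdot> bang C X}"
    using Q \<chi>(4) sub_ob by auto
  ultimately show ?thesis by (rule that)
qed

end

section \<open>The quotient defined by a coreflective subcategory\<close>

definition full_subcat :: "('o, 'm) cat \<Rightarrow> 'o set \<Rightarrow> ('o, 'm) cat" where
  "full_subcat C Q = C\<lparr>Ob := Q, Ar := {f \<in> Ar C. Dom C f \<in> Q \<and> Cod C f \<in> Q}\<rparr>"

lemma full_subcat_simps [simp]: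
  "Ob (full_subcat C Q) = Q" "Dom (full_subcat C Q) = Dom C" "Cod (full_subcat C Q) = Cod C"
  "Idn (full_subcat C Q) = Idn C" "Cmp (full_subcat C Q) = Cmp C"
  "f \<in> Ar (full_subcat C Q) \<longleftrightarrow> f \<in> Ar C \<and> Dom C f \<in> Q \<and> Cod C f \<in> Q"
  by (simp_all add: full_subcat_def)

context hereditary_coreflective
begin

abbreviation S :: "('o, 'm) cat" where
  "S \<equiv> full_subcat C Q"

lemma iso_in:
  assumes "X \<in> Q" "isomorphic C X Y"
  shows "Y \<in> Q"
proof -
  obtain i j where ij: "i \<in> Ar C" "Dom C i = X" "Cod C i = Y" "j \<in> Ar C" "Dom C j = Y" "Cod C j = X"
    "j \<cdot> i = Idn C X" "i \<cdot> j = Idn C Y"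
    using assms(2) by (rule isomorphicE)
  have "Y \<in> Ob C" using ij by auto
  then have "monic C j" by - (rule monic_section [OF ij(8)], use ij in simp_all)
  then show ?thesis using sub_in [of j] ij assms by simp
qed

lemma category_S: "category S"
  by unfold_locales auto

lemma pullback_sub:
  assumes pb: "is_pullback C f g p q" and "f \<in> Ar S" "g \<in> Ar S"
  shows "is_pullback S f g p q"
  unfolding is_pullback_def full_subcat_simps
proof (intro conjI allI ballI impI)
  note pbs = pullback_simps [OF pb]
  show "Dom C p \<in> Q" by (rule pullback_in [OF pb]) (use assms in simp_all)
  then show "Dom C q \<in> Q" using pbs by simp
  fix T a b
  assume ab: "a \<in> hom S T (Dom C f)" "b \<in> hom S T (Dom C g)" "f \<cdot> a = g \<cdot> b"
  have "a \<in> hom C T (Dom C f)" "b \<in> hom C T (Dom C g)"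
    using ab by simp_all
  then have "\<exists>!u. u \<in> hom C T (Dom C p) \<and> p \<cdot> u = a \<and> q \<cdot> u = b"
    using pb ab(3) unfolding is_pullback_def by blast
  moreover have "u \<in> hom S T (Dom C p) \<longleftrightarrow> u \<in> hom C T (Dom C p)" for u
    using ab \<open>Dom C p \<in> Q\<close> by auto
  ultimately show "\<exists>!u. u \<in> hom S T (Dom C p) \<and> p \<cdot> u = a \<and> q \<cdot> u = b"
    by simp
qed (use pullback_simps [OF pb] assms in simp_all)

lemma finlim_S: "finlim_category S"
proof -
  interpret S: category S by (rule category_S)
  have "is_terminal S (one C)"
    unfolding is_terminal_def
  proof (intro conjI ballI)
    fix X assume "X \<in> Ob S"
    then show "\<exists>!f. f \<in> hom S X (one C)"
      using one_in to_one_eq by (intro ex1I [of _ "bang C X"]) auto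
  qed (use one_in in simp)
  moreover have "\<exists>p q. is_pullback S f g p q" if fg: "f \<in> Ar S" "g \<in> Ar S" "Cod S f = Cod S g" for f g
  proof -
    obtain p q where "is_pullback C f g p q"
      by (rule pullback_ex [of f g]) (use fg in simp_all)
    then show ?thesis using pullback_sub [OF _ fg(1,2)] by blast
  qed
  ultimately show ?thesis
    by unfold_locales (auto simp only: has_finite_limits_def)
qed

sublocale S: finlim_category S
  by (rule finlim_S)

text \<open>Limits formed in the subcategory are limits in the ambient topos, since the ambient
  limits exist and lie in the subcategory.\<close>

lemma pullback_S_imp:
  assumes pb: "is_pullback S f g p q"
  shows "is_pullback C f g p q"
proof -
  have s: "f \<in> Ar C" "g \<in> Ar C" "p \<in> Ar C" "q \<in> Ar C" "Cod C g = Cod C f" "Cod C p = Dom C f"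
    "Cod C q = Dom C g" "Dom C q = Dom C p" "f \<cdot> p = g \<cdot> q"
    "Dom C f \<in> Q" "Dom C g \<in> Q" "Cod C f \<in> Q" "Dom C p \<in> Q"
    using S.pullback_simps [OF pb] by simp_all
  obtain a b where ab: "is_pullback C f g a b"
    by (rule pullback_ex [of f g]) (use s in simp_all)
  note abs = pullback_simps [OF ab]
  have aQ: "Dom C a \<in> Q" by (rule pullback_in [OF ab]) (use s in simp_all)
  obtain u where u: "u \<in> Ar C" "Dom C u = Dom C a" "Cod C u = Dom C p" "p \<cdot> u = a" "q \<cdot> u = b"
    using S.pullback_lift [OF pb, of a b] abs s aQ by auto
  obtain w where w: "w \<in> Ar C" "Dom C w = Dom C p" "Cod C w = Dom C a" "a \<cdot> w = p" "b \<cdot> w = q"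
    by (rule pullback_lift [OF ab, of p q]) (use s in simp_all)
  have "p \<cdot> (u \<cdot> w) = p" "q \<cdot> (u \<cdot> w) = q"
    using comp_cong_left [of p u a w] comp_cong_left [of q u b w] u w s by simp_all
  then have uw: "u \<cdot> w = Idn C (Dom C p)"
    using S.pullback_unique [OF pb, of "u \<cdot> w" "Idn C (Dom C p)"] u(1-3) w(1-3) s by simp
  show ?thesis
    unfolding is_pullback_def
  proof (intro conjI allI ballI impI)
    fix T x y
    assume xy: "x \<in> hom C T (Dom C f)" "y \<in> hom C T (Dom C g)" "f \<cdot> x = g \<cdot> y"
    obtain t where t: "t \<in> Ar C" "Dom C t = T" "Cod C t = Dom C a" "a \<cdot> t = x" "b \<cdot> t = y"
      using pullback_lift [OF ab, of x y] xy by auto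
    show "\<exists>!v. v \<in> hom C T (Dom C p) \<and> p \<cdot> v = x \<and> q \<cdot> v = y"
    proof (rule ex1I [of _ "u \<cdot> t"])
      show "u \<cdot> t \<in> hom C T (Dom C p) \<and> p \<cdot> (u \<cdot> t) = x \<and> q \<cdot> (u \<cdot> t) = y"
        using comp_cong_left [of p u a t] comp_cong_left [of q u b t] u t s by simp
      fix v assume v: "v \<in> hom C T (Dom C p) \<and> p \<cdot> v = x \<and> q \<cdot> v = y"
      have "a \<cdot> (w \<cdot> v) = p \<cdot> v"
        by (rule comp_cong_left [OF w(4)]) (use abs v w(1-3) in simp_all)
      moreover have "b \<cdot> (w \<cdot> v) = q \<cdot> v"
        by (rule comp_cong_left [OF w(5)]) (use abs v w(1-3) in simp_all)
      ultimately have "w \<cdot> v = t"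
        by - (rule pullback_unique [OF ab], use v w(1-3) t abs in simp_all)
      then have "u \<cdot> t = (u \<cdot> w) \<cdot> v" using u(1-3) w(1-3) v by simp
      then show "v = u \<cdot> t" unfolding uw using v by simp
    qed
  qed (use s in simp_all)
qed

lemma product_S_imp:
  assumes pr: "is_product S W X p q"
  shows "is_product C W X p q"
proof -
  have pq: "p \<in> Ar C" "q \<in> Ar C" "Dom C q = Dom C p" "Cod C p = W" "Cod C q = X"
    and Q: "Dom C p \<in> Q" "W \<in> Q" "X \<in> Q"
    using pr unfolding is_product_def by auto
  have U: "\<exists>!h. h \<in> hom S T (Dom C p) \<and> p \<cdot> h = f \<and> q \<cdot> h = g"
    if "f \<in> hom S T W" "g \<in> hom S T X" for T f g
    using pr that unfolding is_product_def full_subcat_simps by blast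
  let ?P = "prod_ob C W X"
  have P: "?P \<in> Q" using Q prod_in by simp
  obtain u where u: "u \<in> Ar C" "Dom C u = ?P" "Cod C u = Dom C p" "p \<cdot> u = pr1 C W X" "q \<cdot> u = pr2 C W X"
    using U [of "pr1 C W X" ?P "pr2 C W X"] Q P by auto
  let ?w = "pairing C p q"
  have "p \<cdot> (u \<cdot> ?w) = p" "q \<cdot> (u \<cdot> ?w) = q"
    using comp_cong_left [of p u "pr1 C W X" ?w] comp_cong_left [of q u "pr2 C W X" ?w] u pq Q
    by simp_all
  moreover have "u \<cdot> ?w \<in> hom S (Dom C p) (Dom C p)" "Idn C (Dom C p) \<in> hom S (Dom C p) (Dom C p)"
    "p \<in> hom S (Dom C p) W" "q \<in> hom S (Dom C p) X"
    "p \<cdot> Idn C (Dom C p) = p" "q \<cdot> Idn C (Dom C p) = q"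
    using u pq Q by simp_all
  ultimately have uw: "u \<cdot> ?w = Idn C (Dom C p)"
    using U [of p "Dom C p" q] by blast
  show ?thesis
    unfolding is_product_def
  proof (intro conjI allI ballI)
    fix T f g assume fg: "f \<in> hom C T W" "g \<in> hom C T X"
    show "\<exists>!h. h \<in> hom C T (Dom C p) \<and> p \<cdot> h = f \<and> q \<cdot> h = g"
    proof (rule ex1I [of _ "u \<cdot> pairing C f g"])
      show "u \<cdot> pairing C f g \<in> hom C T (Dom C p) \<and> p \<cdot> (u \<cdot> pairing C f g) = f
          \<and> q \<cdot> (u \<cdot> pairing C f g) = g"
        using comp_cong_left [of p u "pr1 C W X" "pairing C f g"]
          comp_cong_left [of q u "pr2 C W X" "pairing C f g"] u pq Q fg by simp
      fix h assume h: "h \<in> hom C T (Dom C p) \<and> p \<cdot> h = f \<and> q \<cdot> h = g"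
      then have "u \<cdot> pairing C f g = (u \<cdot> ?w) \<cdot> h" using u(1-3) pq by auto
      then show "h = u \<cdot> pairing C f g" unfolding uw using h by simp
    qed
  qed (use pq in simp_all)
qed

lemma terminal_S_imp:
  assumes T: "is_terminal S T"
  shows "is_terminal C T"
proof -
  have TQ: "T \<in> Q" and U: "\<And>X. X \<in> Q \<Longrightarrow> \<exists>!f. f \<in> hom S X T"
    using T by (simp_all add: is_terminal_def)
  obtain m where m: "m \<in> Ar C" "Dom C m = one C" "Cod C m = T"
    using U [OF one_in] by auto
  have "m \<cdot> bang C T \<in> hom S T T" "Idn C T \<in> hom S T T"
    using m TQ one_in by simp_all
  then have mT: "m \<cdot> bang C T = Idn C T" using U [OF TQ] by blast
  show ?thesis
    unfolding is_terminal_def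
  proof (intro conjI ballI)
    fix X assume X: "X \<in> Ob C"
    show "\<exists>!f. f \<in> hom C X T"
    proof (rule ex1I [of _ "m \<cdot> bang C X"])
      show "m \<cdot> bang C X \<in> hom C X T" using m X by simp
      fix f assume f: "f \<in> hom C X T"
      have "m \<cdot> (bang C T \<cdot> f) = Idn C T \<cdot> f"
        by (rule comp_cong_left [OF mT]) (use m f TQ in simp_all)
      then show "f = m \<cdot> bang C X" using f by simp
    qed
  qed (use TQ in simp)
qed

text \<open>A kernel pair of a morphism in \<open>Q\<close> lies in \<open>Q\<close>.\<close>

lemma monic_S_imp:
  assumes m: "monic S m"
  shows "monic C m"
proof (rule monicI)
  have ms: "m \<in> Ar C" "Dom C m \<in> Q" "Cod C m \<in> Q"
    using S.monic_Ar [OF m] by simp_all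
  show "m \<in> Ar C" by (rule ms)
  fix f g
  assume fg: "f \<in> Ar C" "g \<in> Ar C" "Cod C f = Dom C m" "Cod C g = Dom C m" "Dom C f = Dom C g"
    "m \<cdot> f = m \<cdot> g"
  obtain p q where pb: "is_pullback C m m p q"
    by (rule pullback_ex [of m m]) (use ms in simp_all)
  note pbs = pullback_simps [OF pb]
  have "Dom C p \<in> Q" by (rule pullback_in [OF pb]) (use ms in simp_all)
  then have "p = q" by - (rule S.monicD [OF m], use pbs ms in simp_all)
  moreover obtain u where "u \<in> Ar C" "Cod C u = Dom C p" "p \<cdot> u = f" "q \<cdot> u = g"
    by (rule pullback_lift [OF pb, of f g]) (use fg ms in simp_all)
  ultimately show "f = g" by simp
qed

lemma pr_S:
  assumes "W \<in> Q" "X \<in> Q"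
  shows "pr1 S W X \<in> Ar C" "pr2 S W X \<in> Ar C" "Dom C (pr1 S W X) = prod_ob S W X"
    "Dom C (pr2 S W X) = prod_ob S W X" "Cod C (pr1 S W X) = W" "Cod C (pr2 S W X) = X"
    "prod_ob S W X \<in> Q"
  using S.pr_simps [of W X] assms by simp_all

text \<open>Morphisms from objects of \<open>Q\<close> to \<open>Y\<^sup>X\<close> are the same as morphisms to its coreflection.\<close>

lemma exponential_S:
  assumes X: "X \<in> Q" and Y: "Y \<in> Q"
  shows "\<exists>Z ev. is_exponential S X Y Z ev"
proof -
  obtain Z ev where ex: "is_exponential C X Y Z ev"
    using exponentials [of X Y] X Y by auto
  have ev: "ev \<in> Ar C" "Dom C ev = prod_ob C Z X" "Cod C ev = Y" "Z \<in> Ob C"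
    using ex by (simp_all add: is_exponential_def)
  obtain e where e: "coreflection C Q Z e"
    using coreflect ev by blast
  note es = coreflection_simps [OF e]
  let ?Z = "Dom C e"
  let ?ev = "ev \<cdot> pairing C (e \<cdot> pr1 S ?Z X) (pr2 S ?Z X)"
  note prZ = pr_S [OF es(3) X]
  have evS: "?ev \<in> Ar C" "Dom C ?ev = prod_ob S ?Z X" "Cod C ?ev = Y"
    using prZ es ev by simp_all
  have "is_exponential S X Y ?Z ?ev"
    unfolding is_exponential_def full_subcat_simps
  proof (intro conjI ballI)
    show "?Z \<in> Q" by (rule es)
    show "?ev \<in> hom S (prod_ob S ?Z X) Y" using evS prZ Y by simp
    fix W f assume W: "W \<in> Q" and "f \<in> hom S (prod_ob S W X) Y"
    then have f: "f \<in> Ar C" "Dom C f = prod_ob S W X" "Cod C f = Y" by simp_all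
    note prW = pr_S [OF W X]
    let ?p = "pr1 S W X" and ?q = "pr2 S W X"
    have "is_product C W X ?p ?q"
      by (rule product_S_imp) (use S.projections [of W X] W X in simp)
    then have "\<exists>!g. g \<in> hom C W Z \<and> ev \<cdot> pairing C (g \<cdot> ?p) ?q = f"
      by (rule exponential_transpose [OF ex]) (use f prW X in simp_all)
    moreover have ev_map: "?ev \<cdot> prod_map S g (Idn C X) = ev \<cdot> pairing C ((e \<cdot> g) \<cdot> ?p) ?q"
      if g: "g \<in> Ar C" "Dom C g = W" "Cod C g = ?Z" for g
    proof -
      let ?k = "prod_map S g (Idn C X)"
      have k: "?k \<in> Ar C" "Dom C ?k = prod_ob S W X" "Cod C ?k = prod_ob S ?Z X"
        using S.prod_map_simps [of g "Idn C X"] g W X es by simp_all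
      have "pr1 S ?Z X \<cdot> ?k = g \<cdot> ?p" "pr2 S ?Z X \<cdot> ?k = ?q"
        using S.pr_pairing [of "g \<cdot> ?p" "Idn C X \<cdot> ?q" ?Z X] g W X es prW
        by (simp_all add: prod_map_def)
      then show ?thesis using k g prZ prW es ev by simp
    qed
    ultimately obtain g0 where g0: "g0 \<in> hom C W Z" "ev \<cdot> pairing C (g0 \<cdot> ?p) ?q = f"
      and uniq: "\<And>g. \<lbrakk>g \<in> hom C W Z; ev \<cdot> pairing C (g \<cdot> ?p) ?q = f\<rbrakk> \<Longrightarrow> g = g0"
      by blast
    obtain g where g: "g \<in> Ar C" "Dom C g = Dom C g0" "Cod C g = ?Z" "e \<cdot> g = g0"
      by (rule coreflection_lift [OF e, of g0]) (use g0 W in simp_all)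
    show "\<exists>!g. g \<in> hom S W ?Z \<and> ?ev \<cdot> prod_map S g (Idn C X) = f"
    proof (rule ex1I [of _ g])
      show "g \<in> hom S W ?Z \<and> ?ev \<cdot> prod_map S g (Idn C X) = f"
        using ev_map [of g] g g0 W es by simp
      fix g' assume g': "g' \<in> hom S W ?Z \<and> ?ev \<cdot> prod_map S g' (Idn C X) = f"
      have "e \<cdot> g' = g0"
        by (rule uniq) (use ev_map [of g'] g' es in simp_all)
      then show "g' = g"
        using g' g g0 W category_axioms by - (rule coreflection_unique [OF e], simp_all)
    qed
  qed
  then show ?thesis by blast
qed

text \<open>Subobjects in \<open>Q\<close> are the same as in the ambient topos, so the coreflection of
  \<open>\<Omega>\<close> classifies them.\<close>

lemma classifier_S: "\<exists>\<Omega> tr. subobject_classifier S \<Omega> tr"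
proof -
  obtain \<Omega> tr where "subobject_classifier C \<Omega> tr" using classifier by blast
  then interpret classified_topos C \<Omega> tr by unfold_locales
  obtain e where e: "coreflection C Q \<Omega> e" using coreflect by fastforce
  note es = coreflection_simps [OF e]
  have em: "monic C e" by (rule coreflection_monic [OF e])
  let ?I = "one S"
  have oneS: "?I \<in> Q" "is_terminal C ?I"
    using S.one_ob terminal_S_imp [OF S.one_terminal] by simp_all
  have to_oneS: "f = g" if "f \<in> Ar C" "g \<in> Ar C" "Dom C f = Dom C g" "Cod C f = ?I" "Cod C g = ?I" for f g
    using oneS(2) that dom_ob [of g] unfolding is_terminal_def by (metis hom_iff)
  obtain t where t: "t \<in> Ar C" "Dom C t = ?I" "Cod C t = Dom C e" "e \<cdot> t = tr \<cdot> bang C ?I"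
    using coreflection_lift [OF e, of "tr \<cdot> bang C ?I"] oneS by auto
  have bangS: "bang S X \<in> Ar C" "Dom C (bang S X) = X" "Cod C (bang S X) = ?I" if "X \<in> Q" for X
    using S.bang_simps [of X] that by simp_all
  \<comment> \<open>Composition with the monomorphism \<open>e\<close> turns classifying squares of the subcategory into
    those of the ambient topos, and conversely.\<close>
  have to_C: "is_char C tr m (e \<cdot> \<chi>)"
    if m: "monic C m" "Dom C m \<in> Q" and \<chi>: "\<chi> \<in> Ar C" "Cod C \<chi> = Dom C e"
      and pb: "is_pullback C \<chi> t m (bang S (Dom C m))" for m \<chi>
  proof (rule is_charI)
    note pbs = pullback_simps [OF pb]
    show "monic C m" "e \<cdot> \<chi> \<in> Ar C" "Dom C (e \<cdot> \<chi>) = Cod C m" "Cod C (e \<cdot> \<chi>) = \<Omega>"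
      using m \<chi> pbs es by simp_all
    fix f assume f: "f \<in> Ar C" "Cod C f = Cod C m"
    show "(e \<cdot> \<chi>) \<cdot> f = tr \<cdot> bang C (Dom C f) \<longleftrightarrow> factors_through C f m"
    proof
      assume eq: "(e \<cdot> \<chi>) \<cdot> f = tr \<cdot> bang C (Dom C f)"
      obtain b where b: "b \<in> Ar C" "Dom C b = Dom C f" "Cod C b = ?I"
        using oneS(2) dom_ob [OF f(1)] unfolding is_terminal_def by auto
      have "e \<cdot> (t \<cdot> b) = (tr \<cdot> bang C ?I) \<cdot> b"
        by (rule comp_cong_left) (use t b es in simp_all)
      then have "e \<cdot> (\<chi> \<cdot> f) = e \<cdot> (t \<cdot> b)"
        using eq f b \<chi> pbs es oneS by simp
      then have "\<chi> \<cdot> f = t \<cdot> b"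
        by - (rule monicD [OF em], use f b \<chi> t pbs es in simp_all)
      then obtain u where "u \<in> Ar C" "Dom C u = Dom C f" "Cod C u = Dom C m" "m \<cdot> u = f"
        by - (rule pullback_lift [OF pb, of f b], use f b t pbs in simp_all)
      then show "factors_through C f m" by - (rule factors_throughI)
    next
      assume "factors_through C f m"
      then obtain u where u: "u \<in> Ar C" "Dom C u = Dom C f" "Cod C u = Dom C m" "m \<cdot> u = f"
        by (rule factors_throughE)
      let ?b = "bang S (Dom C m)"
      have "e \<cdot> (t \<cdot> (?b \<cdot> u)) = (tr \<cdot> bang C ?I) \<cdot> (?b \<cdot> u)"
        by (rule comp_cong_left) (use t u m bangS es in simp_all)
      moreover have "\<chi> \<cdot> (m \<cdot> u) = (t \<cdot> ?b) \<cdot> u"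
        by (rule comp_cong_left) (use pbs u \<chi> m in simp_all)
      ultimately show "(e \<cdot> \<chi>) \<cdot> f = tr \<cdot> bang C (Dom C f)"
        using u m bangS \<chi> pbs es t oneS f by simp
    qed
  qed
  have to_S: "is_pullback C \<chi> t m (bang S (Dom C m))"
    if m: "monic C m" "Dom C m \<in> Q" and \<chi>: "\<chi> \<in> Ar C" "Cod C \<chi> = Dom C e" "Dom C \<chi> = Cod C m"
      and ch: "e \<cdot> \<chi> = char_of C tr m" for m \<chi>
    unfolding is_pullback_def
  proof (intro conjI allI ballI impI)
    let ?b = "bang S (Dom C m)"
    have et: "e \<cdot> (t \<cdot> y) = tr \<cdot> bang C (Dom C y)" if "y \<in> Ar C" "Cod C y = ?I" for y
    proof -
      have "e \<cdot> (t \<cdot> y) = (tr \<cdot> bang C ?I) \<cdot> y"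
        by (rule comp_cong_left) (use t that es in simp_all)
      then show ?thesis using that oneS by simp
    qed
    have "e \<cdot> (\<chi> \<cdot> m) = char_of C tr m \<cdot> m"
      by (rule comp_cong_left [OF ch]) (use m \<chi> es in simp_all)
    also have "\<dots> = e \<cdot> (t \<cdot> ?b)"
      using char_factor_true [of m "Idn C (Dom C m)"] et [of ?b] m bangS by simp
    finally show "\<chi> \<cdot> m = t \<cdot> ?b"
      by - (rule monicD [OF em], use m \<chi> t bangS es in simp_all)
    fix T x y
    assume xy: "x \<in> hom C T (Dom C \<chi>)" "y \<in> hom C T (Dom C t)" "\<chi> \<cdot> x = t \<cdot> y"
    have "e \<cdot> (\<chi> \<cdot> x) = char_of C tr m \<cdot> x"
      by (rule comp_cong_left [OF ch]) (use m \<chi> es xy in simp_all)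
    then have "char_of C tr m \<cdot> x = tr \<cdot> bang C (Dom C x)"
      using et [of y] xy t by simp
    then have "factors_through C x m"
      using char_true_iff [of m x] m xy \<chi> by simp
    then obtain u where u: "u \<in> Ar C" "Dom C u = Dom C x" "Cod C u = Dom C m" "m \<cdot> u = x"
      by (rule factors_throughE)
    show "\<exists>!u. u \<in> hom C T (Dom C m) \<and> m \<cdot> u = x \<and> ?b \<cdot> u = y"
    proof (rule ex1I [of _ u])
      have "?b \<cdot> u = y" by (rule to_oneS) (use u m bangS xy t in simp_all)
      then show "u \<in> hom C T (Dom C m) \<and> m \<cdot> u = x \<and> ?b \<cdot> u = y"
        using u xy by simp
      show "v = u" if "v \<in> hom C T (Dom C m) \<and> m \<cdot> v = x \<and> ?b \<cdot> v = y" for v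
        by (rule monicD [OF m(1)]) (use that u xy in simp_all)
    qed
  qed (use m \<chi> t bangS in simp_all)
  have "subobject_classifier S (Dom C e) t"
    unfolding subobject_classifier_def full_subcat_simps is_char_def
  proof (intro conjI allI impI)
    show "Dom C e \<in> Q" "t \<in> hom S ?I (Dom C e)" using t es oneS by simp_all
    fix m assume mS: "monic S m"
    have m: "monic C m" "Dom C m \<in> Q" "Cod C m \<in> Q"
      using monic_S_imp [OF mS] S.monic_Ar [OF mS] by simp_all
    obtain \<chi> where \<chi>: "\<chi> \<in> Ar C" "Dom C \<chi> = Dom C (char_of C tr m)" "Cod C \<chi> = Dom C e"
        "e \<cdot> \<chi> = char_of C tr m"
      by (rule coreflection_lift [OF e, of "char_of C tr m"]) (use m in simp_all)
    show "\<exists>!\<chi>. is_pullback S \<chi> t m (bang S (Dom C m))"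
    proof (rule ex1I [of _ \<chi>])
      show "is_pullback S \<chi> t m (bang S (Dom C m))"
        by (rule pullback_sub, rule to_S) (use m \<chi> t es oneS in simp_all)
      fix \<chi>' assume pb: "is_pullback S \<chi>' t m (bang S (Dom C m))"
      note pbC = pullback_S_imp [OF pb]
      have \<chi>': "\<chi>' \<in> Ar C" "Dom C \<chi>' = Cod C m" "Cod C \<chi>' = Dom C e"
        using pullback_simps [OF pbC] t by simp_all
      have "char_of C tr m = e \<cdot> \<chi>'"
        by (rule char_unique [OF m(1)], rule to_C) (use m \<chi>' pbC in simp_all)
      moreover have "Dom C \<chi> = Cod C m" using \<chi>(2) m by simp
      ultimately show "\<chi>' = \<chi>"
        using \<chi>(1,3,4) \<chi>' m category_axioms by - (rule coreflection_unique [OF e], simp_all)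
    qed
  qed
  then show ?thesis by blast
qed

lemma topos_S: "topos S"
  by unfold_locales (use S.fin_limits exponential_S classifier_S in simp_all)

text \<open>The direct image sends an object to its coreflection, and transposition lifts a morphism along
  the coreflection of its codomain.\<close>

theorem quotient_of_subcategory:
  "\<exists>f :: ('o, 'm, 'o, 'm) geom. connected_geometric C f \<and> quotient_image C f = Q"
proof -
  obtain r where r: "\<And>X. X \<in> Ob C \<Longrightarrow> coreflection C Q X (r X)"
    using coreflect by metis
  have rs [simp]: "r X \<in> Ar C" "Cod C (r X) = X" "Dom C (r X) \<in> Q" if "X \<in> Ob C" for X
    using coreflection_simps [OF r [OF that]] by simp_all
  define l where "l h = (THE k. k \<in> hom C (Dom C h) (Dom C (r (Cod C h))) \<and> r (Cod C h) \<cdot> k = h)" for h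
  have l_ex1: "\<exists>!k. k \<in> hom C (Dom C h) (Dom C (r (Cod C h))) \<and> r (Cod C h) \<cdot> k = h"
    if h: "h \<in> Ar C" "Dom C h \<in> Q" for h
  proof -
    have "h \<in> hom C (Dom C h) (Cod C h)" using h by simp
    then show ?thesis
      using r [of "Cod C h"] h unfolding coreflection_def by auto
  qed
  have l [simp]: "l h \<in> Ar C" "Dom C (l h) = Dom C h" "Cod C (l h) = Dom C (r (Cod C h))"
    and rl: "r (Cod C h) \<cdot> l h = h"
    if h: "h \<in> Ar C" "Dom C h \<in> Q" for h
    using theI' [OF l_ex1 [OF h]] unfolding l_def by simp_all
  have l_unique: "k = l (r X \<cdot> k)"
    if k: "k \<in> Ar C" "Dom C k \<in> Q" "Cod C k = Dom C (r X)" "X \<in> Ob C" for k X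
  proof -
    have rk: "r X \<cdot> k \<in> Ar C" "Dom C (r X \<cdot> k) \<in> Q" using k by simp_all
    show ?thesis
      using l_ex1 [OF rk] l [OF rk] rl [OF rk] k rk by (metis comp_simps(2,3) hom_iff rs(1,2))
  qed
  define L :: "('o, 'm, 'o, 'm) cfunctor" where "L = \<lparr>Fob = (\<lambda>X. X), Far = (\<lambda>f. f)\<rparr>"
  define R :: "('o, 'm, 'o, 'm) cfunctor"
    where "R = \<lparr>Fob = (\<lambda>X. Dom C (r X)), Far = (\<lambda>f. l (f \<cdot> r (Dom C f)))\<rparr>"
  define f where "f = \<lparr>codomain = S, inverse_image = L, direct_image = R\<rparr>"
  have LS [simp]: "Fob L X = X" "Far L a = a" for X a by (simp_all add: L_def)
  have RS [simp]: "Fob R X = Dom C (r X)" "Far R a = l (a \<cdot> r (Dom C a))" for X a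
    by (simp_all add: R_def)
  have funL: "is_functor S C L"
    unfolding is_functor_def using category_S category_axioms by simp
  have funR: "is_functor C S R"
    unfolding is_functor_def
  proof (intro conjI ballI allI)
    show "category C" "category S" by (rule category_axioms, rule category_S)
    show "Fob R X \<in> Ob S" if "X \<in> Ob C" for X using that by simp
    show "Far R a \<in> hom S (Fob R X) (Fob R Y)" if "a \<in> hom C X Y" for a X Y
      using that by auto
    show "Far R (Idn C X) = Idn S (Fob R X)" if "X \<in> Ob C" for X
      using l_unique [of "Idn C (Dom C (r X))" X] that by simp
    fix X Y Z a b assume "a \<in> hom C X Y" "b \<in> hom C Y Z"
    then have ab: "a \<in> Ar C" "Dom C a = X" "Cod C a = Y" "b \<in> Ar C" "Dom C b = Y" "Cod C b = Z"
      and XYZ: "X \<in> Ob C" "Y \<in> Ob C" "Z \<in> Ob C" by auto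
    let ?a = "l (a \<cdot> r X)" and ?b = "l (b \<cdot> r Y)"
    have ra: "r Y \<cdot> ?a = a \<cdot> r X" and rb: "r Z \<cdot> ?b = b \<cdot> r Y"
      using rl [of "a \<cdot> r X"] rl [of "b \<cdot> r Y"] ab XYZ by simp_all
    have "r Z \<cdot> (?b \<cdot> ?a) = (b \<cdot> r Y) \<cdot> ?a"
      by (rule comp_cong_left [OF rb]) (use ab XYZ in simp_all)
    also have "\<dots> = b \<cdot> (a \<cdot> r X)" using ra ab XYZ by simp
    finally have "l (r Z \<cdot> (?b \<cdot> ?a)) = l (b \<cdot> (a \<cdot> r X))" by simp
    then show "Far R (b \<cdot> a) = Far R b \<cdot>\<^bsub>S\<^esub> Far R a"
      using l_unique [of "?b \<cdot> ?a" Z] ab XYZ by simp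
  qed
  have "adjoint S C L R"
    unfolding adjoint_def
  proof (intro conjI exI [of _ "\<lambda>A X. l"] ballI allI)
    show "is_functor S C L" "is_functor C S R" by (rule funL, rule funR)
    fix A X assume "A \<in> Ob S" "X \<in> Ob C"
    then have AX: "A \<in> Q" "X \<in> Ob C" by simp_all
    show "bij_betw l (hom C (Fob L A) X) (hom S A (Fob R X))"
    proof (rule bij_betw_byWitness [where f' = "\<lambda>k. r X \<cdot> k"])
      show "l ` hom C (Fob L A) X \<subseteq> hom S A (Fob R X)"
        using AX by auto
      show "(\<cdot>) (r X) ` hom S A (Fob R X) \<subseteq> hom C (Fob L A) X"
        using AX by auto
      show "\<forall>h\<in>hom C (Fob L A) X. r X \<cdot> l h = h"
        using rl AX by auto
      show "\<forall>k\<in>hom S A (Fob R X). l (r X \<cdot> k) = k"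
        using l_unique AX by auto
    qed
  next
    fix A A' X X' a x h
    assume "a \<in> hom S A' A" "x \<in> hom C X X'" "h \<in> hom C (Fob L A) X"
    then have s: "a \<in> Ar C" "Dom C a = A'" "Cod C a = A" "A' \<in> Q" "A \<in> Q" "x \<in> Ar C" "Dom C x = X"
      "Cod C x = X'" "h \<in> Ar C" "Dom C h = A" "Cod C h = X" and XX: "X \<in> Ob C" "X' \<in> Ob C" by auto
    let ?x = "l (x \<cdot> r X)"
    have "r X' \<cdot> (?x \<cdot> (l h \<cdot> a)) = (x \<cdot> r X) \<cdot> (l h \<cdot> a)"
      by (rule comp_cong_left) (use rl [of "x \<cdot> r X"] s XX in simp_all)
    also have "\<dots> = x \<cdot> (r X \<cdot> (l h \<cdot> a))" using s XX by simp
    also have "r X \<cdot> (l h \<cdot> a) = h \<cdot> a"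
      by (rule comp_cong_left) (use rl [of h] s XX in simp_all)
    finally have "l (r X' \<cdot> (?x \<cdot> (l h \<cdot> a))) = l (x \<cdot> (h \<cdot> a))" by simp
    then show "l (x \<cdot> h \<cdot> Far L a) = Far R x \<cdot>\<^bsub>S\<^esub> l h \<cdot>\<^bsub>S\<^esub> a"
      using l_unique [of "?x \<cdot> (l h \<cdot> a)" X'] s XX by simp
  qed
  moreover have "preserves_finite_limits S C L"
    unfolding preserves_finite_limits_def using terminal_S_imp pullback_S_imp by simp
  moreover have "fully_faithful S C L"
    unfolding fully_faithful_def
  proof (intro ballI)
    fix X Y assume "X \<in> Ob S" "Y \<in> Ob S"
    then have "hom S X Y = hom C (Fob L X) (Fob L Y)" by (auto simp: hom_def)
    moreover have "Far L = id" by (simp add: fun_eq_iff)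
    ultimately show "bij_betw (Far L) (hom S X Y) (hom C (Fob L X) (Fob L Y))" by simp
  qed
  ultimately have "connected_geometric C f"
    using topos_S topos_axioms by (simp add: connected_geometric_def geometric_morphism_def f_def)
  moreover have "quotient_image C f = Q"
  proof -
    have refl: "isomorphic C X X" if "X \<in> Ob C" for X
      by (rule isomorphicI [of "Idn C X" _ _ "Idn C X"]) (use that in simp_all)
    show ?thesis
      unfolding quotient_image_def essential_image_def f_def using iso_in refl sub_ob by simp blast
  qed
  ultimately show ?thesis by blast
qed

end

section \<open>Essential images of connected geometric morphisms\<close>

text \<open>The properties of the essential image of an arbitrary connected geometric morphism.\<close>

locale lex_coreflective = topos C for C :: "('o, 'm) cat" (structure) +
  fixes Q :: "'o set"
  assumes sub_ob: "Q \<subseteq> Ob C"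
    and iso_in: "\<lbrakk>X \<in> Q; isomorphic C X Y\<rbrakk> \<Longrightarrow> Y \<in> Q"
    and one_in: "one C \<in> Q"
    and pullback_in: "\<lbrakk>is_pullback C f g p q; Dom C f \<in> Q; Dom C g \<in> Q; Cod C f \<in> Q\<rbrakk> \<Longrightarrow> Dom C p \<in> Q"
    and coreflect: "X \<in> Ob C \<Longrightarrow> \<exists>e. coreflection C Q X e"

context topos
begin

text \<open>The counits of the adjunction are the coreflections. Full faithfulness moves diagrams of objects
  in the image back to the codomain, where their limits can be formed and are preserved.\<close>

lemma lex_coreflective_quotient_image:
  fixes g :: "('o, 'm, 'p, 'q) geom"
  assumes g: "connected_geometric C g"
  shows "lex_coreflective C (quotient_image C g)"
proof -
  define F where "F = codomain g"
  define L where "L = inverse_image g"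
  define R where "R = direct_image g"
  let ?Q = "quotient_image C g"
  have tF: "topos F" and ad: "adjoint F C L R"
    and lex: "preserves_finite_limits F C L" and ff: "fully_faithful F C L"
    using g unfolding connected_geometric_def geometric_morphism_def F_def L_def R_def by blast+
  interpret F: topos F by (rule tF)
  have L: "is_functor F C L" and R: "is_functor C F R"
    using ad unfolding adjoint_def by blast+
  obtain \<Phi> where \<Phi>: "\<And>A X. \<lbrakk>A \<in> Ob F; X \<in> Ob C\<rbrakk> \<Longrightarrow>
        bij_betw (\<Phi> A X) (hom C (Fob L A) X) (hom F A (Fob R X))"
    and \<Phi>_nat: "\<And>A A' X X' a x h. \<lbrakk>a \<in> hom F A' A; x \<in> hom C X X'; h \<in> hom C (Fob L A) X\<rbrakk> \<Longrightarrow>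
        \<Phi> A' X' (x \<cdot> h \<cdot> Far L a) = Far R x \<cdot>\<^bsub>F\<^esub> \<Phi> A X h \<cdot>\<^bsub>F\<^esub> a"
    using ad unfolding adjoint_def by blast
  have L_ob [simp]: "Fob L A \<in> Ob C" if "A \<in> Ob F" for A
    using L that unfolding is_functor_def by blast
  have R_ob [simp]: "Fob R X \<in> Ob F" if "X \<in> Ob C" for X
    using R that unfolding is_functor_def by blast
  have L_hom: "Far L a \<in> hom C (Fob L A) (Fob L B)" if "a \<in> hom F A B" for a A B
    using L that unfolding is_functor_def by blast
  have L_full: "\<exists>a. a \<in> hom F A B \<and> Far L a = h"
    if "h \<in> hom C (Fob L A) (Fob L B)" "A \<in> Ob F" "B \<in> Ob F" for h A B
  proof -
    have "bij_betw (Far L) (hom F A B) (hom C (Fob L A) (Fob L B))"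
      using ff that(2,3) unfolding fully_faithful_def by blast
    then have "h \<in> Far L ` hom F A B"
      using that(1) bij_betw_imp_surj_on by blast
    then show ?thesis by blast
  qed
  have inQ: "Y \<in> ?Q \<longleftrightarrow> Y \<in> Ob C \<and> (\<exists>A\<in>Ob F. isomorphic C (Fob L A) Y)" for Y
    unfolding quotient_image_def essential_image_def F_def L_def mem_Collect_eq by (rule refl)
  have LQ: "Fob L A \<in> ?Q" if "A \<in> Ob F" for A
  proof -
    have "isomorphic C (Fob L A) (Fob L A)"
      by (rule isomorphicI [of "Idn C (Fob L A)" _ _ "Idn C (Fob L A)"]) (use that in simp_all)
    then show ?thesis using inQ L_ob [OF that] that by blast
  qed
  have QE: "\<exists>A i j. A \<in> Ob F \<and> i \<in> hom C (Fob L A) Y \<and> j \<in> hom C Y (Fob L A) \<and>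
      j \<cdot> i = Idn C (Fob L A) \<and> i \<cdot> j = Idn C Y" if "Y \<in> ?Q" for Y
  proof -
    obtain A where "A \<in> Ob F" "isomorphic C (Fob L A) Y" using \<open>Y \<in> ?Q\<close> inQ by blast
    then obtain i where A: "A \<in> Ob F" and i: "i \<in> Ar C" "Dom C i = Fob L A" "Cod C i = Y"
      and "iso C i"
      unfolding isomorphic_def Bex_def hom_iff by blast
    then obtain j where "j \<in> hom C Y (Fob L A)"
        "j \<cdot> i = Idn C (Fob L A)" "i \<cdot> j = Idn C Y"
      unfolding iso_def i by blast
    moreover have "i \<in> hom C (Fob L A) Y" using i by simp
    ultimately show ?thesis using A by blast
  qed
  have iso_in: "Y \<in> ?Q" if X: "X \<in> ?Q" and XY: "isomorphic C X Y" for X Y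
  proof -
    obtain A i j where A: "A \<in> Ob F" and i: "i \<in> hom C (Fob L A) X" and j: "j \<in> hom C X (Fob L A)"
      and ij: "j \<cdot> i = Idn C (Fob L A)" "i \<cdot> j = Idn C X"
      using QE [OF X] by blast
    obtain k l where kl: "k \<in> Ar C" "Dom C k = X" "Cod C k = Y" "l \<in> Ar C" "Dom C l = Y" "Cod C l = X"
      "l \<cdot> k = Idn C X" "k \<cdot> l = Idn C Y"
      using XY by (rule isomorphicE)
    have "l \<cdot> (k \<cdot> i) = Idn C X \<cdot> i"
      by (rule comp_cong_left [OF kl(7)]) (use kl(1-6) i in simp_all)
    moreover have "i \<cdot> (j \<cdot> l) = Idn C X \<cdot> l"
      by (rule comp_cong_left [OF ij(2)]) (use kl(1-6) i j in simp_all)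
    ultimately have "isomorphic C (Fob L A) Y"
      using kl i j ij
      by - (rule isomorphicI [of "k \<cdot> i" _ _ "j \<cdot> l"], simp_all)
    moreover have "Y \<in> Ob C" using kl by auto
    ultimately show ?thesis using A inQ by blast
  qed
  have one_in: "one C \<in> ?Q"
  proof -
    let ?T = "Fob L (one F)"
    have T: "is_terminal C ?T"
      using lex F.one_terminal unfolding preserves_finite_limits_def by blast
    obtain m where m: "m \<in> Ar C" "Dom C m = one C" "Cod C m = ?T"
      using T one_ob unfolding is_terminal_def by fastforce
    have "m \<cdot> bang C ?T \<in> hom C ?T ?T" "Idn C ?T \<in> hom C ?T ?T"
      using m by simp_all
    then have "m \<cdot> bang C ?T = Idn C ?T"
      using T unfolding is_terminal_def by blast
    then have "isomorphic C ?T (one C)"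
      by - (rule isomorphicI [of "bang C ?T" _ _ m], use m in \<open>simp_all add: bang_one\<close>)
    then show ?thesis using LQ [of "one F"] iso_in by simp
  qed
  have pullback_in: "Dom C p \<in> ?Q"
    if pb: "is_pullback C f h p q" and Q: "Dom C f \<in> ?Q" "Dom C h \<in> ?Q" "Cod C f \<in> ?Q" for f h p q
  proof -
    note s = pullback_simps [OF pb]
    obtain A iA jA where A: "A \<in> Ob F" "iA \<in> Ar C" "Dom C iA = Fob L A" "Cod C iA = Dom C f"
      "jA \<in> Ar C" "Dom C jA = Dom C f" "Cod C jA = Fob L A"
      and ijA: "jA \<cdot> iA = Idn C (Fob L A)" "iA \<cdot> jA = Idn C (Dom C f)"
      using QE [OF Q(1)] unfolding hom_iff by blast
    obtain B iB jB where B: "B \<in> Ob F" "iB \<in> Ar C" "Dom C iB = Fob L B" "Cod C iB = Dom C h"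
      "jB \<in> Ar C" "Dom C jB = Dom C h" "Cod C jB = Fob L B"
      and ijB: "jB \<cdot> iB = Idn C (Fob L B)" "iB \<cdot> jB = Idn C (Dom C h)"
      using QE [OF Q(2)] unfolding hom_iff by blast
    obtain D iD jD where D: "D \<in> Ob F" "iD \<in> Ar C" "Dom C iD = Fob L D" "Cod C iD = Cod C f"
      "jD \<in> Ar C" "Dom C jD = Cod C f" "Cod C jD = Fob L D"
      and ijD: "jD \<cdot> iD = Idn C (Fob L D)" "iD \<cdot> jD = Idn C (Cod C f)"
      using QE [OF Q(3)] unfolding hom_iff by blast
    \<comment> \<open>The cospan is conjugated by isomorphisms into the image of the functor, and there lifted
      along it.\<close>
    obtain a where a: "a \<in> hom F A D" "Far L a = jD \<cdot> (f \<cdot> iA)"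
      using L_full [of "jD \<cdot> (f \<cdot> iA)" A D] A B D s by auto
    obtain b where b: "b \<in> hom F B D" "Far L b = jD \<cdot> (h \<cdot> iB)"
      using L_full [of "jD \<cdot> (h \<cdot> iB)" B D] A B D s by auto
    obtain p0 q0 where "is_pullback F a b p0 q0"
      by (rule F.pullback_ex [of a b]) (use a b in simp_all)
    define x where "x = Far L p0"
    define y where "y = Far L q0"
    have pb': "is_pullback C (jD \<cdot> (f \<cdot> iA)) (jD \<cdot> (h \<cdot> iB)) x y"
      using lex \<open>is_pullback F a b p0 q0\<close> a(2) b(2) unfolding preserves_finite_limits_def x_def y_def
      by metis
    note s0 = pullback_simps [OF pb']
    have xy: "x \<in> Ar C" "y \<in> Ar C" "Cod C x = Fob L A" "Cod C y = Fob L B" "Dom C y = Dom C x"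
      using s0 A B D s by simp_all
    have "p0 \<in> hom F (Dom F p0) A"
      using F.pullback_simps [OF \<open>is_pullback F a b p0 q0\<close>] a by simp
    then have Dx: "Dom C x = Fob L (Dom F p0)" "Dom F p0 \<in> Ob F"
      using L_hom [of p0 "Dom F p0" A] F.hom_obD unfolding x_def by (simp, blast)
    have cancel: "iD \<cdot> (jD \<cdot> z) = z" if "z \<in> Ar C" "Cod C z = Cod C f" for z
      using comp_cong_left [OF ijD(2), of z] D that s by simp
    have cancelA: "iA \<cdot> (jA \<cdot> z) = z" if "z \<in> Ar C" "Cod C z = Dom C f" for z
      using comp_cong_left [OF ijA(2), of z] A that s by simp
    have cancelB: "iB \<cdot> (jB \<cdot> z) = z" if "z \<in> Ar C" "Cod C z = Dom C h" for z
      using comp_cong_left [OF ijB(2), of z] B that s by simp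
    have cancelA': "jA \<cdot> (iA \<cdot> z) = z" if "z \<in> Ar C" "Cod C z = Fob L A" for z
      using comp_cong_left [OF ijA(1), of z] A that by simp
    have cancelB': "jB \<cdot> (iB \<cdot> z) = z" if "z \<in> Ar C" "Cod C z = Fob L B" for z
      using comp_cong_left [OF ijB(1), of z] B that by simp
    have "iD \<cdot> (jD \<cdot> (f \<cdot> (iA \<cdot> x))) = iD \<cdot> (jD \<cdot> (h \<cdot> (iB \<cdot> y)))"
      using s0(9) A B D s xy by simp
    then have "f \<cdot> (iA \<cdot> x) = h \<cdot> (iB \<cdot> y)"
      using cancel [of "f \<cdot> (iA \<cdot> x)"] cancel [of "h \<cdot> (iB \<cdot> y)"]
        A(2-7) B(2-7) s(1-8) xy by simp
    then obtain u where u: "u \<in> Ar C" "Dom C u = Dom C x" "Cod C u = Dom C p"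
        "p \<cdot> u = iA \<cdot> x" "q \<cdot> u = iB \<cdot> y"
      using A(2-7) B(2-7) s(1-8) xy
      by - (rule pullback_lift [OF pb, of "iA \<cdot> x" "iB \<cdot> y"], simp_all)
    obtain v where v: "v \<in> Ar C" "Dom C v = Dom C p" "Cod C v = Dom C x"
        "x \<cdot> v = jA \<cdot> p" "y \<cdot> v = jB \<cdot> q"
      by (rule pullback_lift [OF pb', of "jA \<cdot> p" "jB \<cdot> q"])
        (use A B D s cancelA [of p] cancelB [of q] in simp_all)
    have "p \<cdot> (u \<cdot> v) = (iA \<cdot> x) \<cdot> v"
      by (rule comp_cong_left [OF u(4)]) (use u(1-3) v(1-3) s in simp_all)
    then have puv: "p \<cdot> (u \<cdot> v) = p"
      using A xy v cancelA [of p] s by simp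
    have "q \<cdot> (u \<cdot> v) = (iB \<cdot> y) \<cdot> v"
      by (rule comp_cong_left [OF u(5)]) (use u(1-3) v(1-3) s in simp_all)
    then have quv: "q \<cdot> (u \<cdot> v) = q"
      using B xy v cancelB [of q] s by simp
    have uv: "u \<cdot> v = Idn C (Dom C p)"
      by (rule pullback_unique [OF pb]) (use u(1-3) v(1-3) s puv quv in simp_all)
    have "x \<cdot> (v \<cdot> u) = (jA \<cdot> p) \<cdot> u"
      by (rule comp_cong_left [OF v(4)]) (use u(1-3) v(1-3) xy in simp_all)
    then have xvu: "x \<cdot> (v \<cdot> u) = x"
      using A xy u cancelA' [of x] s by simp
    have "y \<cdot> (v \<cdot> u) = (jB \<cdot> q) \<cdot> u"
      by (rule comp_cong_left [OF v(5)]) (use u(1-3) v(1-3) xy in simp_all)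
    then have yvu: "y \<cdot> (v \<cdot> u) = y"
      using B xy u cancelB' [of y] s by simp
    have vu: "v \<cdot> u = Idn C (Dom C x)"
      by (rule pullback_unique [OF pb']) (use u(1-3) v(1-3) xy xvu yvu in simp_all)
    have "isomorphic C (Dom C x) (Dom C p)"
      by (rule isomorphicI [of u _ _ v]) (use u(1-3) v(1-3) uv vu in simp_all)
    then show ?thesis using iso_in LQ Dx by metis
  qed
  have coreflect: "\<exists>e. coreflection C ?Q X e" if X: "X \<in> Ob C" for X
  proof -
    let ?R = "Fob R X"
    have "Idn F ?R \<in> hom F ?R ?R" using X by simp
    then obtain e where e: "e \<in> hom C (Fob L ?R) X" "\<Phi> ?R X e = Idn F ?R"
      using \<Phi> [of ?R X] X unfolding bij_betw_def by (metis (no_types, lifting) R_ob imageE)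
    have \<Phi>e: "\<Phi> A X (e \<cdot> Far L a) = a" if a: "a \<in> hom F A ?R" for A a
    proof -
      have La: "Far L a \<in> hom C (Fob L A) (Fob L ?R)" by (rule L_hom [OF a])
      have "\<Phi> A X (Idn C X \<cdot> (e \<cdot> Far L a)) = Far R (Idn C X) \<cdot>\<^bsub>F\<^esub> (\<Phi> ?R X e \<cdot>\<^bsub>F\<^esub> a)"
        by (rule \<Phi>_nat [OF a _ e(1)]) (use X in simp)
      moreover have "Far R (Idn C X) = Idn F ?R"
        using R X unfolding is_functor_def by blast
      ultimately show ?thesis using e La a X by simp
    qed
    have es: "e \<in> Ar C" "Cod C e = X" "Dom C e = Fob L ?R" using e by simp_all
    have "coreflection C ?Q X e"
      unfolding coreflection_def
    proof (intro conjI ballI)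
      show "e \<in> hom C (Dom C e) X" using es by simp
      show "Dom C e \<in> ?Q" using es LQ X by simp
      fix Y h assume "Y \<in> ?Q" and h: "h \<in> hom C Y X"
      then obtain A i j where A: "A \<in> Ob F" and i: "i \<in> Ar C" "Dom C i = Fob L A" "Cod C i = Y"
        and j: "j \<in> Ar C" "Dom C j = Y" "Cod C j = Fob L A"
        and ij: "j \<cdot> i = Idn C (Fob L A)" "i \<cdot> j = Idn C Y"
        using QE [of Y] unfolding hom_iff by blast
      have Y: "Y \<in> Ob C" using h by auto
      have hi: "h \<cdot> i \<in> hom C (Fob L A) X" using h i by simp
      \<comment> \<open>The lift of \<open>h\<close> is the image of its transpose, corrected by the isomorphism \<open>j\<close>.\<close>
      define a where "a = \<Phi> A X (h \<cdot> i)"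
      have a: "a \<in> hom F A ?R"
        using bij_betwE [OF \<Phi> [OF A X]] hi unfolding a_def by blast
      have La: "Far L a \<in> hom C (Fob L A) (Fob L ?R)" by (rule L_hom [OF a])
      have eLa: "e \<cdot> Far L a = h \<cdot> i"
      proof (rule inj_onD [OF bij_betw_imp_inj_on [OF \<Phi> [OF A X]]])
        show "\<Phi> A X (e \<cdot> Far L a) = \<Phi> A X (h \<cdot> i)"
          using \<Phi>e [OF a] by (simp add: a_def)
      qed (use hi La es in simp_all)
      have "e \<cdot> (Far L a \<cdot> j) = (h \<cdot> i) \<cdot> j"
        by (rule comp_cong_left [OF eLa]) (use La es j in simp_all)
      then have k: "e \<cdot> (Far L a \<cdot> j) = h" using h i j ij Y by simp
      show "\<exists>!k. k \<in> hom C Y (Dom C e) \<and> e \<cdot> k = h"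
      proof (rule ex1I [of _ "Far L a \<cdot> j"])
        show "Far L a \<cdot> j \<in> hom C Y (Dom C e) \<and> e \<cdot> (Far L a \<cdot> j) = h"
          using k La es j by simp
        fix k assume "k \<in> hom C Y (Dom C e) \<and> e \<cdot> k = h"
        then have ks: "k \<in> Ar C" "Dom C k = Y" "Cod C k = Fob L ?R" "e \<cdot> k = h" using es by simp_all
        obtain b where b: "b \<in> hom F A ?R" "Far L b = k \<cdot> i"
          using L_full [of "k \<cdot> i" A ?R] ks i A X by auto
        have "e \<cdot> (k \<cdot> i) = h \<cdot> i"
          by (rule comp_cong_left [OF ks(4)]) (use ks(1-3) es i in simp_all)
        then have "b = a" using \<Phi>e [OF b(1)] b(2) a_def by simp
        then have "Far L a \<cdot> j = (k \<cdot> i) \<cdot> j" using b by simp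
        then show "k = Far L a \<cdot> j" using ks(1-3) i j ij Y by simp
      qed
    qed
    then show ?thesis ..
  qed
  show ?thesis
    by unfold_locales (use inQ iso_in one_in pullback_in coreflect in blast)+
qed

end

section \<open>Boolean toposes\<close>

locale classified_boolean_topos = classified_topos C \<Omega> tr + boolean_topos C
  for C :: "('o, 'm) cat" (structure) and \<Omega> tr
begin

text \<open>The degenerate stages: those at which true and false agree.\<close>

definition collapsed :: "'o \<Rightarrow> bool" where
  "collapsed T \<longleftrightarrow> (\<forall>f\<in>Ar C. \<forall>g\<in>Ar C. Dom C f = T \<and> Dom C g = T \<and> Cod C f = Cod C g \<longrightarrow> f = g)"

lemma collapsedD:
  "\<lbrakk>collapsed T; f \<in> Ar C; g \<in> Ar C; Dom C f = T; Dom C g = T; Cod C f = Cod C g\<rbrakk> \<Longrightarrow> f = g"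
  unfolding collapsed_def by blast

text \<open>A morphism \<open>S \<rightarrow> T\<close> makes \<open>S\<close> a retract of \<open>T \<times> S\<close>.\<close>

lemma collapsed_over:
  assumes "h \<in> Ar C" "Cod C h = T" "T \<in> Ob C"
    and prodT: "\<And>X. X \<in> Ob C \<Longrightarrow> collapsed (prod_ob C T X)"
  shows "collapsed (Dom C h)"
  unfolding collapsed_def
proof (intro ballI impI)
  fix f g assume fg: "f \<in> Ar C" "g \<in> Ar C"
    "Dom C f = Dom C h \<and> Dom C g = Dom C h \<and> Cod C f = Cod C g"
  let ?S = "Dom C h"
  have S: "?S \<in> Ob C" using assms by simp
  have "f \<cdot> pr2 C T ?S = g \<cdot> pr2 C T ?S"
    by (rule collapsedD [OF prodT [OF S]]) (use fg S assms in simp_all)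
  then have "(f \<cdot> pr2 C T ?S) \<cdot> pairing C h (Idn C ?S) = (g \<cdot> pr2 C T ?S) \<cdot> pairing C h (Idn C ?S)"
    by simp
  then show "f = g" using fg S assms by simp
qed

text \<open>The least subobject \<open>n\<close> of \<open>1\<close>: two morphisms \<open>U \<times> X \<rightarrow> Z\<close> transpose to
  morphisms \<open>U \<rightarrow> Z\<^sup>X\<close>, whose equalizer is again a subobject of \<open>1\<close>, hence
  all of \<open>U\<close>.\<close>

lemma least_subobject_ex:
  obtains n where "monic C n" "Cod C n = one C"
    "\<And>h. \<lbrakk>h \<in> Ar C; Cod C h = Dom C n\<rbrakk> \<Longrightarrow> collapsed (Dom C h)"
proof -
  have "subobj_of C (one C) (Idn C (one C))"
    by (simp add: subobj_of_def monic_id)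
  then obtain n where "complementary C (one C) (Idn C (one C)) n"
    using complements by blast
  then have n: "monic C n" "Cod C n = one C"
    and least0: "\<And>s t. \<lbrakk>subobj_of C (one C) s; factors_through C s (Idn C (one C));
      factors_through C s n; subobj_of C (one C) t\<rbrakk> \<Longrightarrow> factors_through C s t"
    unfolding complementary_def subobj_of_def by blast+
  let ?U = "Dom C n"
  have U: "?U \<in> Ob C" using n by simp
  have least: "factors_through C n t" if "monic C t" "Cod C t = one C" for t
  proof (rule least0)
    show "factors_through C n (Idn C (one C))"
      by (rule factors_throughI [of _ n]) (use n in simp_all)
    show "factors_through C n n"
      by (rule factors_throughI [of _ "Idn C ?U"]) (use n in simp_all)
  qed (use n that in \<open>simp_all add: subobj_of_def\<close>)
  have collapsedU: "collapsed ?U"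
    unfolding collapsed_def
  proof (intro ballI impI)
    fix f g assume fg: "f \<in> Ar C" "g \<in> Ar C" "Dom C f = ?U \<and> Dom C g = ?U \<and> Cod C f = Cod C g"
    obtain e where e: "monic C e" "Cod C e = Dom C f" "f \<cdot> e = g \<cdot> e"
      by (rule equalizer_ex [of f g]) (use fg in auto)
    have "factors_through C n (n \<cdot> e)"
      by (rule least) (use monic_comp [OF e(1) n(1)] n e fg in simp_all)
    then obtain k where k: "k \<in> Ar C" "Dom C k = ?U" "Cod C k = Dom C (n \<cdot> e)" "(n \<cdot> e) \<cdot> k = n"
      by (rule factors_throughE)
    have ks: "Cod C k = Dom C e" using k n e fg by simp
    have "n \<cdot> (e \<cdot> k) = n \<cdot> Idn C ?U" using k ks n e fg by simp
    then have ek: "e \<cdot> k = Idn C ?U"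
      by - (rule monicD [OF n(1)], use k ks n e fg in simp_all)
    have "f \<cdot> (e \<cdot> k) = (g \<cdot> e) \<cdot> k"
      by (rule comp_cong_left [OF e(3)]) (use k ks e fg in simp_all)
    then have "f \<cdot> (e \<cdot> k) = g \<cdot> (e \<cdot> k)" using k ks e fg by simp
    then show "f = g" unfolding ek using fg by simp
  qed
  have prodU: "collapsed (prod_ob C ?U X)" if X: "X \<in> Ob C" for X
    unfolding collapsed_def
  proof (intro ballI impI)
    fix f g assume fg: "f \<in> Ar C" "g \<in> Ar C"
      "Dom C f = prod_ob C ?U X \<and> Dom C g = prod_ob C ?U X \<and> Cod C f = Cod C g"
    obtain Z ev where ex: "is_exponential C X (Cod C g) Z ev"
      using exponentials [of X "Cod C g"] X fg by auto
    have tr: "\<exists>!a. a \<in> hom C ?U Z \<and> ev \<cdot> prod_map C a (Idn C X) = f"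
      if "f \<in> hom C (prod_ob C ?U X) (Cod C g)" for f
      using ex U that unfolding is_exponential_def by blast
    obtain a where a: "a \<in> hom C ?U Z" "ev \<cdot> prod_map C a (Idn C X) = f"
      using tr [of f] fg by auto
    obtain b where b: "b \<in> hom C ?U Z" "ev \<cdot> prod_map C b (Idn C X) = g"
      using tr [of g] fg by auto
    have "a = b" by (rule collapsedD [OF collapsedU]) (use a b in simp_all)
    then show "f = g" using a b by simp
  qed
  show ?thesis
    by (rule that [OF n]) (rule collapsed_over [OF _ _ U prodU])
qed

text \<open>Case distinction on a truth value \<open>\<omega>\<close>: it is true on a subobject \<open>m\<close> of its domain and false
  on the complement of \<open>m\<close>, because the intersection of the two is the least subobject, hence
  collapsed. A subobject that contains all stages of both kinds contains \<open>m\<close> and its complement,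
  so it is everything.\<close>

lemma boolean_cases:
  obtains ff where "ff \<in> Ar C" "Dom C ff = one C" "Cod C ff = \<Omega>"
    "\<And>T. \<lbrakk>T \<in> Ob C; ff \<cdot> bang C T = tr \<cdot> bang C T\<rbrakk> \<Longrightarrow> collapsed T"
    "\<And>\<omega> s. \<lbrakk>\<omega> \<in> Ar C; Cod C \<omega> = \<Omega>; monic C s; Cod C s = Dom C \<omega>;
        \<And>h. \<lbrakk>h \<in> Ar C; Cod C h = Dom C \<omega>; \<omega> \<cdot> h = tr \<cdot> bang C (Dom C h)\<rbrakk>
          \<Longrightarrow> factors_through C h s;
        \<And>h. \<lbrakk>h \<in> Ar C; Cod C h = Dom C \<omega>; \<omega> \<cdot> h = ff \<cdot> bang C (Dom C h)\<rbrakk>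
          \<Longrightarrow> factors_through C h s\<rbrakk>
      \<Longrightarrow> factors_through C (Idn C (Dom C \<omega>)) s"
proof -
  obtain n where n: "monic C n" "Cod C n = one C"
    and collapse: "\<And>h. \<lbrakk>h \<in> Ar C; Cod C h = Dom C n\<rbrakk> \<Longrightarrow> collapsed (Dom C h)"
    using least_subobject_ex by blast
  define ff where "ff = char_of C tr n"
  have ff: "ff \<in> Ar C" "Dom C ff = one C" "Cod C ff = \<Omega>"
    using n by (simp_all add: ff_def)
  have ff_collapsed: "collapsed T" if T: "T \<in> Ob C" "ff \<cdot> bang C T = tr \<cdot> bang C T" for T
  proof -
    have "factors_through C (bang C T) n"
      using char_true_iff [of n "bang C T"] n T by (simp add: ff_def)
    then obtain k where "k \<in> Ar C" "Dom C k = Dom C (bang C T)" "Cod C k = Dom C n"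
      by (rule factors_throughE)
    then show ?thesis using collapse [of k] T by simp
  qed
  show ?thesis
  proof (rule that [OF ff ff_collapsed])
    fix \<omega> s
    assume \<omega>: "\<omega> \<in> Ar C" "Cod C \<omega> = \<Omega>" and s: "monic C s" "Cod C s = Dom C \<omega>"
      and true: "\<And>h. \<lbrakk>h \<in> Ar C; Cod C h = Dom C \<omega>; \<omega> \<cdot> h = tr \<cdot> bang C (Dom C h)\<rbrakk>
          \<Longrightarrow> factors_through C h s"
      and false: "\<And>h. \<lbrakk>h \<in> Ar C; Cod C h = Dom C \<omega>; \<omega> \<cdot> h = ff \<cdot> bang C (Dom C h)\<rbrakk>
          \<Longrightarrow> factors_through C h s"
    let ?T = "Dom C \<omega>"
    have T: "?T \<in> Ob C" using \<omega> by simp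
    obtain m where m: "monic C m" "Cod C m = ?T" "char_of C tr m = \<omega>"
      using subobject_of_char \<omega> by metis
    obtain n' where "complementary C ?T m n'"
      using complements [of ?T m] m by (auto simp: subobj_of_def)
    then have n': "monic C n'" "Cod C n' = ?T"
      and least: "\<And>s t. \<lbrakk>subobj_of C ?T s; factors_through C s m; factors_through C s n';
        subobj_of C ?T t\<rbrakk> \<Longrightarrow> factors_through C s t"
      and greatest: "\<And>s t. \<lbrakk>subobj_of C ?T s; factors_through C m s; factors_through C n' s;
        subobj_of C ?T t\<rbrakk> \<Longrightarrow> factors_through C t s"
      unfolding complementary_def subobj_of_def by blast+
    obtain p q where pb: "is_pullback C m n' p q"
      by (rule pullback_ex [of m n']) (use m n' in simp_all)
    note pbs = pullback_simps [OF pb]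
    \<comment> \<open>The intersection of \<open>m\<close> and its complement lies below every subobject of \<open>T\<close>,
      in particular below the pullback of the least subobject of \<open>1\<close>.\<close>
    have disjoint: "collapsed (Dom C h)" if h: "h \<in> Ar C" "Cod C h = Dom C p" for h
    proof -
      obtain e b where eb: "is_pullback C (bang C ?T) n e b"
        by (rule pullback_ex [of "bang C ?T" n]) (use n T in simp_all)
      note ebs = pullback_simps [OF eb]
      have "factors_through C (m \<cdot> p) e"
      proof (rule least)
        show "subobj_of C ?T (m \<cdot> p)"
          using monic_comp [OF pullback_monic [OF pb n'(1)] m(1)] m pbs
          by (simp add: subobj_of_def)
        show "factors_through C (m \<cdot> p) m"
          by (rule factors_throughI [of _ p]) (use m pbs(1-8) in simp_all)
        have "n' \<cdot> q = m \<cdot> p" using pbs(9) by simp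
        then show "factors_through C (m \<cdot> p) n'"
          by (rule factors_throughI) (use m pbs(1-8) in simp_all)
        show "subobj_of C ?T e"
          using pullback_monic [OF eb n(1)] ebs T by (simp add: subobj_of_def)
      qed
      then obtain k where "k \<in> Ar C" "Dom C k = Dom C (m \<cdot> p)" "Cod C k = Dom C e"
        by (rule factors_throughE)
      then have k: "k \<in> Ar C" "Dom C k = Dom C p" "Cod C k = Dom C e"
        using m pbs by simp_all
      then show ?thesis using collapse [of "b \<cdot> (k \<cdot> h)"] h ebs by simp
    qed
    have "\<omega> \<cdot> n' = ff \<cdot> bang C (Dom C n')"
    proof (rule omega_ext)
      fix h assume "h \<in> Ar C" "Cod C h = Dom C (\<omega> \<cdot> n')"
      then have h: "h \<in> Ar C" "Cod C h = Dom C n'" using n' \<omega> by simp_all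
      have "\<omega> \<cdot> (n' \<cdot> h) = tr \<cdot> bang C (Dom C h) \<longleftrightarrow> ff \<cdot> bang C (Dom C h) = tr \<cdot> bang C (Dom C h)"
      proof
        assume "\<omega> \<cdot> (n' \<cdot> h) = tr \<cdot> bang C (Dom C h)"
        then have "factors_through C (n' \<cdot> h) m"
          using char_true_iff [of m "n' \<cdot> h"] m n' h by simp
        then obtain a where a: "a \<in> Ar C" "Dom C a = Dom C (n' \<cdot> h)" "Cod C a = Dom C m"
            "m \<cdot> a = n' \<cdot> h"
          by (rule factors_throughE)
        then obtain u where u: "u \<in> Ar C" "Dom C u = Dom C a" "Cod C u = Dom C p"
          by - (rule pullback_lift [OF pb, of a h], use h n' m in simp_all)
        then have "collapsed (Dom C h)" using disjoint [of u] a n' h by simp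
        then show "ff \<cdot> bang C (Dom C h) = tr \<cdot> bang C (Dom C h)"
          by (rule collapsedD) (use ff h in simp_all)
      next
        assume "ff \<cdot> bang C (Dom C h) = tr \<cdot> bang C (Dom C h)"
        then have "collapsed (Dom C h)" using ff_collapsed h by simp
        then show "\<omega> \<cdot> (n' \<cdot> h) = tr \<cdot> bang C (Dom C h)"
          by (rule collapsedD) (use \<omega> n' h in simp_all)
      qed
      then show "(\<omega> \<cdot> n') \<cdot> h = tr \<cdot> bang C (Dom C h)
          \<longleftrightarrow> (ff \<cdot> bang C (Dom C n')) \<cdot> h = tr \<cdot> bang C (Dom C h)"
        using \<omega> n' h ff by simp
    qed (use \<omega> n' ff in simp_all)
    then have n's: "factors_through C n' s" using false [of n'] n' by simp
    have "\<omega> \<cdot> m = tr \<cdot> bang C (Dom C m)"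
      using char_factor_true [of m "Idn C (Dom C m)"] m by simp
    then have ms: "factors_through C m s" using true [of m] m by simp
    show "factors_through C (Idn C ?T) s"
      by (rule greatest [OF _ ms n's]) (use s T monic_id in \<open>simp_all add: subobj_of_def\<close>)
  qed
qed

text \<open>In a Boolean topos \<open>\<Omega>\<close> is the coproduct \<open>1 + 1\<close>, and a coreflective
  subcategory is closed under coproducts. Concretely, let \<open>e : R \<rightarrow> \<Omega>\<close> be the coreflection, and
  lift true and false to points \<open>t\<close> and \<open>f\<close> of \<open>R\<close>. A section of \<open>e\<close> that sends true to
  \<open>t\<close> and false to \<open>f\<close> is an inverse of \<open>e\<close>, as endomorphisms of \<open>R\<close> are determined by
  their composites with \<open>e\<close>. To construct it, restrict the characteristic morphism of \<open>t\<close> to the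
  subobject \<open>s\<close> of those \<open>z\<close> for which exactly one of \<open>z = t\<close> and \<open>z = f\<close> holds. By case
  distinction this restriction \<open>c\<close> is monic, and its image, containing true and false, is all of
  \<open>\<Omega>\<close>.\<close>

lemma Omega_in:
  assumes "lex_coreflective C Q"
  shows "\<Omega> \<in> Q"
proof -
  interpret Q: lex_coreflective C Q by fact
  obtain ff where ff [simp]: "ff \<in> Ar C" "Dom C ff = one C" "Cod C ff = \<Omega>"
    and ff_collapsed: "\<And>T. \<lbrakk>T \<in> Ob C; ff \<cdot> bang C T = tr \<cdot> bang C T\<rbrakk> \<Longrightarrow> collapsed T"
    and cases: "\<And>\<omega> s. \<lbrakk>\<omega> \<in> Ar C; Cod C \<omega> = \<Omega>; monic C s; Cod C s = Dom C \<omega>;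
        \<And>h. \<lbrakk>h \<in> Ar C; Cod C h = Dom C \<omega>; \<omega> \<cdot> h = tr \<cdot> bang C (Dom C h)\<rbrakk>
          \<Longrightarrow> factors_through C h s;
        \<And>h. \<lbrakk>h \<in> Ar C; Cod C h = Dom C \<omega>; \<omega> \<cdot> h = ff \<cdot> bang C (Dom C h)\<rbrakk>
          \<Longrightarrow> factors_through C h s\<rbrakk>
      \<Longrightarrow> factors_through C (Idn C (Dom C \<omega>)) s"
    using boolean_cases by blast
  have cases_eq: "f = g"
    if \<omega>: "\<omega> \<in> Ar C" "Cod C \<omega> = \<Omega>" and fg: "f \<in> Ar C" "g \<in> Ar C" "Dom C f = Dom C \<omega>"
        "Dom C g = Dom C \<omega>" "Cod C f = Cod C g"
      and true: "\<And>h. \<lbrakk>h \<in> Ar C; Cod C h = Dom C \<omega>; \<omega> \<cdot> h = tr \<cdot> bang C (Dom C h)\<rbrakk> \<Longrightarrow> f \<cdot> h = g \<cdot> h"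
      and false: "\<And>h. \<lbrakk>h \<in> Ar C; Cod C h = Dom C \<omega>; \<omega> \<cdot> h = ff \<cdot> bang C (Dom C h)\<rbrakk> \<Longrightarrow> f \<cdot> h = g \<cdot> h"
    for \<omega> f g
  proof -
    obtain e where e: "monic C e" "Cod C e = Dom C f" "f \<cdot> e = g \<cdot> e"
      and eq: "\<And>h. \<lbrakk>h \<in> Ar C; Cod C h = Dom C f; f \<cdot> h = g \<cdot> h\<rbrakk> \<Longrightarrow> factors_through C h e"
      using equalizer_ex [of f g] fg by metis
    have "factors_through C (Idn C (Dom C \<omega>)) e"
      by (rule cases) (use \<omega> e eq true false fg in simp_all)
    then obtain k where k: "k \<in> Ar C" "Dom C k = Dom C (Idn C (Dom C \<omega>))" "Cod C k = Dom C e"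
        "e \<cdot> k = Idn C (Dom C \<omega>)"
      by (rule factors_throughE)
    have "f \<cdot> (e \<cdot> k) = (g \<cdot> e) \<cdot> k"
      by (rule comp_cong_left [OF e(3)]) (use k(1-3) e(1,2) fg in simp_all)
    then have "f \<cdot> (e \<cdot> k) = g \<cdot> (e \<cdot> k)" using k(1-3) e(1,2) fg by simp
    then show "f = g" unfolding k(4) using fg by simp
  qed
  obtain e where e: "coreflection C Q \<Omega> e"
    using Q.coreflect tr_simps(1) by blast
  note es = coreflection_simps [OF e]
  let ?R = "Dom C e"
  obtain t where t: "t \<in> Ar C" "Dom C t = one C" "Cod C t = ?R" "e \<cdot> t = tr"
    by (rule coreflection_lift [OF e, of tr]) (use Q.one_in in simp_all)
  obtain f where f: "f \<in> Ar C" "Dom C f = one C" "Cod C f = ?R" "e \<cdot> f = ff"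
    by (rule coreflection_lift [OF e, of ff]) (use Q.one_in in simp_all)
  have mt: "monic C t" and mf: "monic C f" and mff: "monic C ff"
    using t f ff by (simp_all add: monic_from_one)
  define ct where "ct = char_of C tr t"
  define cf where "cf = char_of C tr f"
  define neg where "neg = char_of C tr ff"
  have c [simp]: "ct \<in> Ar C" "Dom C ct = ?R" "Cod C ct = \<Omega>"
      "cf \<in> Ar C" "Dom C cf = ?R" "Cod C cf = \<Omega>"
      "neg \<in> Ar C" "Dom C neg = \<Omega>" "Cod C neg = \<Omega>"
    using mt mf mff t f by (simp_all add: ct_def cf_def neg_def)
  have char_point: "char_of C tr a \<cdot> x = tr \<cdot> bang C (Dom C x) \<longleftrightarrow> x = a \<cdot> bang C (Dom C x)"
    if a: "a \<in> Ar C" "Dom C a = one C" and x: "x \<in> Ar C" "Cod C x = Cod C a" for a x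
  proof -
    have "factors_through C x a \<longleftrightarrow> x = a \<cdot> bang C (Dom C x)"
    proof
      assume "factors_through C x a"
      then obtain u where u: "u \<in> Ar C" "Dom C u = Dom C x" "Cod C u = Dom C a" "a \<cdot> u = x"
        by (rule factors_throughE)
      then have "u = bang C (Dom C x)" using to_one_eq [of u] a by simp
      then show "x = a \<cdot> bang C (Dom C x)" using u by simp
    next
      assume "x = a \<cdot> bang C (Dom C x)"
      then show "factors_through C x a"
        by - (rule factors_throughI [of _ "bang C (Dom C x)"], use a x in simp_all)
    qed
    then show ?thesis using char_true_iff [of a x] monic_from_one [of a] a x by simp
  qed
  have ct_true: "ct \<cdot> x = tr \<cdot> bang C (Dom C x) \<longleftrightarrow> x = t \<cdot> bang C (Dom C x)"
    and cf_true: "cf \<cdot> x = tr \<cdot> bang C (Dom C x) \<longleftrightarrow> x = f \<cdot> bang C (Dom C x)"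
    if "x \<in> Ar C" "Cod C x = ?R" for x
    unfolding ct_def cf_def by (rule char_point, use that t f in simp_all)+
  have neg_true: "neg \<cdot> x = tr \<cdot> bang C (Dom C x) \<longleftrightarrow> x = ff \<cdot> bang C (Dom C x)"
    if "x \<in> Ar C" "Cod C x = \<Omega>" for x
    unfolding neg_def by (rule char_point) (use that in simp_all)
  \<comment> \<open>A stage at which true and false agree, whether in \<open>\<Omega>\<close> or in its coreflection, is
    collapsed.\<close>
  have tf_collapsed: "collapsed T"
    if T: "T \<in> Ob C" and eq: "f \<cdot> bang C T = t \<cdot> bang C T" for T
  proof -
    have "e \<cdot> (f \<cdot> bang C T) = ff \<cdot> bang C T"
      by (rule comp_cong_left [OF f(4)]) (use f(1-3) es T in simp_all)
    moreover have "e \<cdot> (t \<cdot> bang C T) = tr \<cdot> bang C T"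
      by (rule comp_cong_left [OF t(4)]) (use t(1-3) es T in simp_all)
    ultimately show ?thesis using ff_collapsed [OF T] eq by simp
  qed
  \<comment> \<open>At a collapsed stage any two parallel morphisms agree, so \<open>a\<close> and \<open>b\<close> become true at the
    same stages.\<close>
  have eq_by_collapse: "a = b"
    if a: "a \<in> Ar C" "Dom C a = one C" "Cod C a = \<Omega>" and b: "b \<in> Ar C" "Dom C b = one C" "Cod C b = \<Omega>"
      and ca: "\<And>T. \<lbrakk>T \<in> Ob C; a \<cdot> bang C T = tr \<cdot> bang C T\<rbrakk> \<Longrightarrow> collapsed T"
      and cb: "\<And>T. \<lbrakk>T \<in> Ob C; b \<cdot> bang C T = tr \<cdot> bang C T\<rbrakk> \<Longrightarrow> collapsed T" for a b
  proof (rule omega_ext)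
    fix h assume "h \<in> Ar C" "Cod C h = Dom C a"
    then have h: "h \<in> Ar C" "Cod C h = one C" "h = bang C (Dom C h)" "Dom C h \<in> Ob C"
      using a to_one_eq [of h] by simp_all
    have "a \<cdot> bang C (Dom C h) = tr \<cdot> bang C (Dom C h) \<longleftrightarrow> b \<cdot> bang C (Dom C h) = tr \<cdot> bang C (Dom C h)"
    proof
      assume "a \<cdot> bang C (Dom C h) = tr \<cdot> bang C (Dom C h)"
      then show "b \<cdot> bang C (Dom C h) = tr \<cdot> bang C (Dom C h)"
        by - (rule collapsedD [OF ca [OF h(4)]], use b h(4) in simp_all)
    next
      assume "b \<cdot> bang C (Dom C h) = tr \<cdot> bang C (Dom C h)"
      then show "a \<cdot> bang C (Dom C h) = tr \<cdot> bang C (Dom C h)"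
        by - (rule collapsedD [OF cb [OF h(4)]], use a h(4) in simp_all)
    qed
    then show "a \<cdot> h = tr \<cdot> bang C (Dom C h) \<longleftrightarrow> b \<cdot> h = tr \<cdot> bang C (Dom C h)"
      using h(3) by metis
  qed (use a b in simp_all)
  have cft: "cf \<cdot> t = ff"
  proof (rule eq_by_collapse)
    show "collapsed T" if "T \<in> Ob C" "(cf \<cdot> t) \<cdot> bang C T = tr \<cdot> bang C T" for T
      using tf_collapsed [of T] cf_true [of "t \<cdot> bang C T"] that t by simp
  qed (use t ff_collapsed in simp_all)
  have ctf: "ct \<cdot> f = ff"
  proof (rule eq_by_collapse)
    show "collapsed T" if "T \<in> Ob C" "(ct \<cdot> f) \<cdot> bang C T = tr \<cdot> bang C T" for T
      using tf_collapsed [of T] ct_true [of "f \<cdot> bang C T"] that f by simp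
  qed (use f ff_collapsed in simp_all)
  have negt: "neg \<cdot> tr = ff"
  proof (rule eq_by_collapse)
    show "collapsed T" if "T \<in> Ob C" "(neg \<cdot> tr) \<cdot> bang C T = tr \<cdot> bang C T" for T
      using ff_collapsed [of T] neg_true [of "tr \<cdot> bang C T"] that by simp
  qed (use ff_collapsed in simp_all)
  have ctt: "ct \<cdot> t = tr" and cff: "cf \<cdot> f = tr" and negf: "neg \<cdot> ff = tr"
    using ct_true [of t] cf_true [of f] neg_true [of ff] t f by (simp_all add: bang_one)
  \<comment> \<open>The part of the coreflection on which exactly one of \<open>z = t\<close> and \<open>z = f\<close> holds.\<close>
  obtain s where s: "monic C s" "Cod C s = ?R" "cf \<cdot> s = (neg \<cdot> ct) \<cdot> s"
    and s_max: "\<And>h. \<lbrakk>h \<in> Ar C; Cod C h = ?R; cf \<cdot> h = (neg \<cdot> ct) \<cdot> h\<rbrakk> \<Longrightarrow> factors_through C h s"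
    using equalizer_ex [of cf "neg \<cdot> ct"] by (metis c comp_simps)
  have s' [simp]: "s \<in> Ar C" "Cod C s = ?R" using s by simp_all
  define c where "c = ct \<cdot> s"
  have cs [simp]: "c \<in> Ar C" "Dom C c = Dom C s" "Cod C c = \<Omega>"
    by (simp_all add: c_def)
  have at_true: "s \<cdot> x = t \<cdot> bang C (Dom C x)"
    if "x \<in> Ar C" "Cod C x = Dom C s" "c \<cdot> x = tr \<cdot> bang C (Dom C x)" for x
    using ct_true [of "s \<cdot> x"] that by (simp add: c_def)
  have at_false: "s \<cdot> x = f \<cdot> bang C (Dom C x)"
    if x: "x \<in> Ar C" "Cod C x = Dom C s" "c \<cdot> x = ff \<cdot> bang C (Dom C x)" for x
  proof -
    have "cf \<cdot> (s \<cdot> x) = ((neg \<cdot> ct) \<cdot> s) \<cdot> x"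
      by (rule comp_cong_left [OF s(3)]) (use x in simp_all)
    also have "\<dots> = neg \<cdot> (c \<cdot> x)" using x(1,2) by (simp add: c_def)
    also have "\<dots> = neg \<cdot> (ff \<cdot> bang C (Dom C x))" using x(3) by simp
    also have "\<dots> = tr \<cdot> bang C (Dom C x)"
      by (rule comp_cong_left [OF negf]) (use x in simp_all)
    finally show ?thesis using cf_true [of "s \<cdot> x"] x by simp
  qed
  have "monic C c"
  proof (rule monicI)
    fix a b
    assume ab: "a \<in> Ar C" "b \<in> Ar C" "Cod C a = Dom C c" "Cod C b = Dom C c" "Dom C a = Dom C b"
      "c \<cdot> a = c \<cdot> b"
    have eq: "a \<cdot> h = b \<cdot> h"
      if "h \<in> Ar C" "Cod C h = Dom C b" "s \<cdot> (a \<cdot> h) = s \<cdot> (b \<cdot> h)" for h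
      by (rule monicD [OF s(1)]) (use that ab(1-5) in simp_all)
    have cab: "c \<cdot> (a \<cdot> h) = (c \<cdot> b) \<cdot> h" if "h \<in> Ar C" "Cod C h = Dom C b" for h
      by (rule comp_cong_left [OF ab(6)]) (use that ab(1-5) in simp_all)
    show "a = b"
    proof (rule cases_eq [of "c \<cdot> b"])
      fix h assume "h \<in> Ar C" "Cod C h = Dom C (c \<cdot> b)" and tru: "(c \<cdot> b) \<cdot> h = tr \<cdot> bang C (Dom C h)"
      then have h: "h \<in> Ar C" "Cod C h = Dom C b" using ab by simp_all
      have "s \<cdot> (a \<cdot> h) = t \<cdot> bang C (Dom C h)"
        using at_true [of "a \<cdot> h"] cab [OF h] tru h ab(1-5) by simp
      moreover have "s \<cdot> (b \<cdot> h) = t \<cdot> bang C (Dom C h)"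
        using at_true [of "b \<cdot> h"] tru h ab(1-5) by simp
      ultimately show "a \<cdot> h = b \<cdot> h" using eq [OF h] by simp
    next
      fix h assume "h \<in> Ar C" "Cod C h = Dom C (c \<cdot> b)" and fls: "(c \<cdot> b) \<cdot> h = ff \<cdot> bang C (Dom C h)"
      then have h: "h \<in> Ar C" "Cod C h = Dom C b" using ab by simp_all
      have "s \<cdot> (a \<cdot> h) = f \<cdot> bang C (Dom C h)"
        using at_false [of "a \<cdot> h"] cab [OF h] fls h ab(1-5) by simp
      moreover have "s \<cdot> (b \<cdot> h) = f \<cdot> bang C (Dom C h)"
        using at_false [of "b \<cdot> h"] fls h ab(1-5) by simp
      ultimately show "a \<cdot> h = b \<cdot> h" using eq [OF h] by simp
    qed (use ab(1-5) in simp_all)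
  qed simp
  have "factors_through C t s"
  proof (rule s_max)
    have "(neg \<cdot> ct) \<cdot> t = ff" using ctt negt t by simp
    then show "cf \<cdot> t = (neg \<cdot> ct) \<cdot> t" using cft by simp
  qed (use t in simp_all)
  then obtain t0 where t0: "t0 \<in> Ar C" "Dom C t0 = Dom C t" "Cod C t0 = Dom C s" "s \<cdot> t0 = t"
    by (rule factors_throughE)
  have "factors_through C f s"
  proof (rule s_max)
    have "(neg \<cdot> ct) \<cdot> f = tr" using ctf negf f by simp
    then show "cf \<cdot> f = (neg \<cdot> ct) \<cdot> f" using cff by simp
  qed (use f in simp_all)
  then obtain f0 where f0: "f0 \<in> Ar C" "Dom C f0 = Dom C f" "Cod C f0 = Dom C s" "s \<cdot> f0 = f"
    by (rule factors_throughE)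
  have ct0: "c \<cdot> t0 = tr" and cf0: "c \<cdot> f0 = ff"
    using t0 f0 ctt ctf by (simp_all add: c_def)
  have "factors_through C (Idn C (Dom C (Idn C \<Omega>))) c"
  proof (rule cases)
    fix h assume h: "h \<in> Ar C" "Cod C h = Dom C (Idn C \<Omega>)" and tru: "Idn C \<Omega> \<cdot> h = tr \<cdot> bang C (Dom C h)"
    have "c \<cdot> (t0 \<cdot> bang C (Dom C h)) = tr \<cdot> bang C (Dom C h)"
      by (rule comp_cong_left [OF ct0]) (use t0(1-3) t(2) h in simp_all)
    then show "factors_through C h c"
      using tru h t0(1-3) t(2) by - (rule factors_throughI [of _ "t0 \<cdot> bang C (Dom C h)"], simp_all)
  next
    fix h assume h: "h \<in> Ar C" "Cod C h = Dom C (Idn C \<Omega>)" and fls: "Idn C \<Omega> \<cdot> h = ff \<cdot> bang C (Dom C h)"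
    have "c \<cdot> (f0 \<cdot> bang C (Dom C h)) = ff \<cdot> bang C (Dom C h)"
      by (rule comp_cong_left [OF cf0]) (use f0(1-3) f(2) h in simp_all)
    then show "factors_through C h c"
      using fls h f0(1-3) f(2) by - (rule factors_throughI [of _ "f0 \<cdot> bang C (Dom C h)"], simp_all)
  qed (use \<open>monic C c\<close> in simp_all)
  then obtain k where "k \<in> Ar C" "Dom C k = Dom C (Idn C (Dom C (Idn C \<Omega>)))" "Cod C k = Dom C c"
      "c \<cdot> k = Idn C (Dom C (Idn C \<Omega>))"
    by (rule factors_throughE)
  then have k: "k \<in> Ar C" "Dom C k = \<Omega>" "Cod C k = Dom C s" and ck: "c \<cdot> k = Idn C \<Omega>"
    by simp_all
  let ?\<sigma> = "s \<cdot> k"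
  have ckh: "c \<cdot> (k \<cdot> h) = h" if "h \<in> Ar C" "Cod C h = \<Omega>" for h
    using comp_cong_left [OF ck, of h] k that by simp
  have e_sigma: "e \<cdot> ?\<sigma> = Idn C \<Omega>"
  proof (rule cases_eq [of "Idn C \<Omega>"])
    fix h assume "h \<in> Ar C" "Cod C h = Dom C (Idn C \<Omega>)" and "Idn C \<Omega> \<cdot> h = tr \<cdot> bang C (Dom C h)"
    then have h: "h \<in> Ar C" "Cod C h = \<Omega>" and tru: "h = tr \<cdot> bang C (Dom C h)" by simp_all
    have "s \<cdot> (k \<cdot> h) = t \<cdot> bang C (Dom C h)"
      using at_true [of "k \<cdot> h"] ckh [OF h] tru h k by simp
    moreover have "e \<cdot> (t \<cdot> bang C (Dom C h)) = tr \<cdot> bang C (Dom C h)"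
      by (rule comp_cong_left [OF t(4)]) (use t(1-3) es h in simp_all)
    ultimately have "(e \<cdot> ?\<sigma>) \<cdot> h = tr \<cdot> bang C (Dom C h)" using h k es by simp
    then show "(e \<cdot> ?\<sigma>) \<cdot> h = Idn C \<Omega> \<cdot> h" using tru h by simp
  next
    fix h assume "h \<in> Ar C" "Cod C h = Dom C (Idn C \<Omega>)" and "Idn C \<Omega> \<cdot> h = ff \<cdot> bang C (Dom C h)"
    then have h: "h \<in> Ar C" "Cod C h = \<Omega>" and fls: "h = ff \<cdot> bang C (Dom C h)" by simp_all
    have "s \<cdot> (k \<cdot> h) = f \<cdot> bang C (Dom C h)"
      using at_false [of "k \<cdot> h"] ckh [OF h] fls h k by simp
    moreover have "e \<cdot> (f \<cdot> bang C (Dom C h)) = ff \<cdot> bang C (Dom C h)"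
      by (rule comp_cong_left [OF f(4)]) (use f(1-3) es h in simp_all)
    ultimately have "(e \<cdot> ?\<sigma>) \<cdot> h = ff \<cdot> bang C (Dom C h)" using h k es by simp
    then show "(e \<cdot> ?\<sigma>) \<cdot> h = Idn C \<Omega> \<cdot> h" using fls h by simp
  qed (use k es in simp_all)
  have "e \<cdot> (?\<sigma> \<cdot> e) = Idn C \<Omega> \<cdot> e"
    by (rule comp_cong_left [OF e_sigma]) (use k es in simp_all)
  then have "?\<sigma> \<cdot> e = Idn C ?R"
    by - (rule coreflection_unique [OF e], use k es category_axioms in simp_all)
  then have "isomorphic C ?R \<Omega>"
    by - (rule isomorphicI [of e _ _ ?\<sigma>], use e_sigma k es in simp_all)
  then show ?thesis using Q.iso_in es by blast
qed

text \<open>Subobjects are pullbacks of \<open>true : 1 \<rightarrow> \<Omega>\<close>, and both \<open>1\<close> and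
  \<open>\<Omega>\<close> lie in \<open>Q\<close>.\<close>

lemma hereditary_if_lex_coreflective:
  assumes lex: "lex_coreflective C Q"
  shows "hereditary_coreflective C Q"
proof -
  interpret Q: lex_coreflective C Q by fact
  show ?thesis
  proof
    show "Q \<subseteq> Ob C" "one C \<in> Q" by (rule Q.sub_ob, rule Q.one_in)
    show "\<exists>e. coreflection C Q X e" if "X \<in> Ob C" for X by (rule Q.coreflect [OF that])
    show "Dom C m \<in> Q" if m: "monic C m" "Cod C m \<in> Q" for m
      by (rule Q.pullback_in [OF char_is_char [OF m(1), unfolded is_char_def]])
        (use m Q.one_in Omega_in [OF lex] in simp_all)
    show "prod_ob C X Y \<in> Q" if XY: "X \<in> Q" "Y \<in> Q" for X Y
    proof -
      have ob: "X \<in> Ob C" "Y \<in> Ob C" using XY Q.sub_ob by blast+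
      have "is_pullback C (bang C X) (bang C Y) (pr1 C X Y) (pr2 C X Y)"
        unfolding is_pullback_def
      proof (intro conjI allI ballI impI)
        fix T a b
        assume ab: "a \<in> hom C T (Dom C (bang C X))" "b \<in> hom C T (Dom C (bang C Y))"
        show "\<exists>!u. u \<in> hom C T (Dom C (pr1 C X Y)) \<and> pr1 C X Y \<cdot> u = a \<and> pr2 C X Y \<cdot> u = b"
          using projections [OF ob] ab ob unfolding is_product_def by simp
      qed (use ob in simp_all)
      then have "Dom C (pr1 C X Y) \<in> Q"
        by (rule Q.pullback_in) (use ob XY Q.one_in in simp_all)
      then show ?thesis using ob by simp
    qed
  qed
qed

end

section \<open>The correspondences\<close>

context local_state_topos
begin

text \<open>Monomorphisms into \<open>\<Xi>\<close> are isomorphic exactly when they have the same characteristic morphism,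
  so each class in \<open>filters\<close> is a fibre of the passage to characteristic morphisms.\<close>

lemma filters_iff_class:
  "F \<in> filters C Xi \<longleftrightarrow> (\<exists>h. semilattice_hom C Xi (Omega_slat C \<Omega> tr) h \<and>
     F = {n. subobj_of C \<Xi> n \<and> char_of C tr n = h})"
proof -
  have cls: "subobj_eq C `` {m} = {n. subobj_of C \<Xi> n \<and> char_of C tr n = char_of C tr m}"
    if m: "monic C m" "Cod C m = \<Xi>" for m
  proof -
    have "(m, n) \<in> subobj_eq C \<longleftrightarrow> subobj_of C \<Xi> n \<and> char_of C tr n = char_of C tr m" for n
    proof (cases "subobj_of C \<Xi> n")
      case True
      then show ?thesis using char_eq_iff [of m n] m by (auto simp: subobj_of_def)
    next
      case False
      then show ?thesis using m unfolding subobj_eq_def subobj_of_def by auto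
    qed
    then show ?thesis by auto
  qed
  have mono: "monic C m" "Cod C m = \<Xi>" if "internal_filter C Xi m" for m
    using that by (simp_all add: internal_filter_def subobj_of_def)
  show ?thesis
  proof
    assume "F \<in> filters C Xi"
    then obtain m where m: "internal_filter C Xi m" "F = subobj_eq C `` {m}"
      unfolding filters_def quotient_def by blast
    then show "\<exists>h. semilattice_hom C Xi (Omega_slat C \<Omega> tr) h \<and>
        F = {n. subobj_of C \<Xi> n \<and> char_of C tr n = h}"
      using cls [OF mono] mono [OF m(1)] filter_iff_char_hom [OF Xi_semilattice, of m]
      by (intro exI [of _ "char_of C tr m"]) simp
  next
    assume "\<exists>h. semilattice_hom C Xi (Omega_slat C \<Omega> tr) h \<and>
        F = {n. subobj_of C \<Xi> n \<and> char_of C tr n = h}"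
    then obtain h where h: "semilattice_hom C Xi (Omega_slat C \<Omega> tr) h"
        "F = {n. subobj_of C \<Xi> n \<and> char_of C tr n = h}" by blast
    have "h \<in> Ar C" "Dom C h = \<Xi>" "Cod C h = \<Omega>"
      using h(1) by (simp_all add: semilattice_hom_def Omega_slat_def)
    then obtain m where m: "monic C m" "Cod C m = \<Xi>" "char_of C tr m = h"
      using subobject_of_char by metis
    then have "internal_filter C Xi m"
      using filter_iff_char_hom [OF Xi_semilattice, of m] h by simp
    moreover have "F = subobj_eq C `` {m}" using cls [of m] m h by simp
    ultimately show "F \<in> filters C Xi" unfolding filters_def quotient_def by blast
  qed
qed

lemma filter_class_properties:
  assumes h: "semilattice_hom C Xi (Omega_slat C \<Omega> tr) h"
  defines "F \<equiv> {n. subobj_of C \<Xi> n \<and> char_of C tr n = h}"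
  shows "char_of_filter C tr F = h"
    and "filter_objects C \<xi> F = {X \<in> Ob C. h \<cdot> \<xi> X = tr \<cdot> bang C X}"
    and "hereditary_coreflective C (filter_objects C \<xi> F)"
proof -
  have hs: "h \<in> Ar C" "Dom C h = \<Xi>" "Cod C h = \<Omega>"
    using h by (simp_all add: semilattice_hom_def Omega_slat_def)
  then obtain m where m: "monic C m" "Cod C m = \<Xi>" "char_of C tr m = h"
    using subobject_of_char by metis
  then have "m \<in> F" by (simp add: F_def subobj_of_def)
  then have "char_of C tr ` F = {h}" unfolding F_def by blast
  then show "char_of_filter C tr F = h" by (simp add: char_of_filter_def)
  have iff: "factors_through C (\<xi> X) k \<longleftrightarrow> h \<cdot> \<xi> X = tr \<cdot> bang C X" if "X \<in> Ob C" "k \<in> F" for X k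
    using char_true_iff [of k "\<xi> X"] that unfolding F_def subobj_of_def by auto
  then show eq: "filter_objects C \<xi> F = {X \<in> Ob C. h \<cdot> \<xi> X = tr \<cdot> bang C X}"
    unfolding filter_objects_def using \<open>m \<in> F\<close> by blast
  have "internal_filter C Xi m"
    using filter_iff_char_hom [OF Xi_semilattice, of m] h m by simp
  then have "hereditary_coreflective C {X \<in> Ob C. factors_through C (\<xi> X) m}"
    by (rule hereditary_coreflective_of_filter)
  moreover have "{X \<in> Ob C. factors_through C (\<xi> X) m} = filter_objects C \<xi> F"
    unfolding eq using iff \<open>m \<in> F\<close> by blast
  ultimately show "hereditary_coreflective C (filter_objects C \<xi> F)" by simp
qed

text \<open>The stages of \<open>X\<close> at which \<open>h \<xi>\<^sub>X\<close> holds are those that factor through a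
  subobject \<open>m\<close> of \<open>X\<close>, and \<open>h \<xi>\<^sub>X m = h \<xi>\<^sub>U\<close>, with \<open>U\<close> the domain of \<open>m\<close>.\<close>

lemma hom_determined_by_objects:
  assumes h: "h \<in> Ar C" "Dom C h = \<Xi>" "Cod C h = \<Omega>"
    and h': "h' \<in> Ar C" "Dom C h' = \<Xi>" "Cod C h' = \<Omega>"
    and eq: "\<And>X. X \<in> Ob C \<Longrightarrow> h \<cdot> \<xi> X = tr \<cdot> bang C X \<longleftrightarrow> h' \<cdot> \<xi> X = tr \<cdot> bang C X"
  shows "h = h'"
proof (rule xi_ext)
  fix X assume X: "X \<in> Ob C"
  have imp: "k' \<cdot> (\<xi> X \<cdot> f) = tr \<cdot> bang C (Dom C f)"
    if k: "k \<in> Ar C" "Dom C k = \<Xi>" "Cod C k = \<Omega>" and k': "k' \<in> Ar C" "Dom C k' = \<Xi>" "Cod C k' = \<Omega>"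
      and kk': "\<And>X. X \<in> Ob C \<Longrightarrow> k \<cdot> \<xi> X = tr \<cdot> bang C X \<Longrightarrow> k' \<cdot> \<xi> X = tr \<cdot> bang C X"
      and f: "f \<in> Ar C" "Cod C f = X" "k \<cdot> (\<xi> X \<cdot> f) = tr \<cdot> bang C (Dom C f)" for k k' f
  proof -
    obtain m where m: "monic C m" "Cod C m = X" "char_of C tr m = k \<cdot> \<xi> X"
      using subobject_of_char [of "k \<cdot> \<xi> X"] k X by auto
    have xm: "\<xi> X \<cdot> m = \<xi> (Dom C m)" using xi_mono [OF m(1)] m by simp
    have "(k \<cdot> \<xi> X) \<cdot> m = tr \<cdot> bang C (Dom C m)"
      using char_factor_true [of m "Idn C (Dom C m)"] m by simp
    then have "k \<cdot> \<xi> (Dom C m) = tr \<cdot> bang C (Dom C m)" using k X m xm by simp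
    then have k'm: "k' \<cdot> \<xi> (Dom C m) = tr \<cdot> bang C (Dom C m)" using kk' m by simp
    have "factors_through C f m"
      using char_true_iff [of m f] m f k X by simp
    then obtain u where u: "u \<in> Ar C" "Dom C u = Dom C f" "Cod C u = Dom C m" "m \<cdot> u = f"
      by (rule factors_throughE)
    have "\<xi> X \<cdot> (m \<cdot> u) = \<xi> (Dom C m) \<cdot> u"
      by (rule comp_cong_left [OF xm]) (use X m u in simp_all)
    then have "k' \<cdot> (\<xi> X \<cdot> f) = k' \<cdot> (\<xi> (Dom C m) \<cdot> u)" using u by simp
    also have "\<dots> = (tr \<cdot> bang C (Dom C m)) \<cdot> u"
      by (rule comp_cong_left [OF k'm]) (use k' m u in simp_all)
    also have "\<dots> = tr \<cdot> bang C (Dom C f)" using u m by simp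
    finally show ?thesis .
  qed
  show "h \<cdot> \<xi> X = h' \<cdot> \<xi> X"
  proof (rule omega_ext)
    fix f assume "f \<in> Ar C" "Cod C f = Dom C (h \<cdot> \<xi> X)"
    then have f: "f \<in> Ar C" "Cod C f = X" using h X by simp_all
    have "h \<cdot> (\<xi> X \<cdot> f) = tr \<cdot> bang C (Dom C f) \<longleftrightarrow> h' \<cdot> (\<xi> X \<cdot> f) = tr \<cdot> bang C (Dom C f)"
      using imp [OF h h' iffD1 [OF eq] f] imp [OF h' h iffD2 [OF eq] f] by blast
    then show "(h \<cdot> \<xi> X) \<cdot> f = tr \<cdot> bang C (Dom C f) \<longleftrightarrow> (h' \<cdot> \<xi> X) \<cdot> f = tr \<cdot> bang C (Dom C f)"
      using f h h' X by simp
  qed (use h h' X in simp_all)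
qed (use h h' in simp_all)

end

theorem corollary5p4:
  fixes E :: "('o, 'm) cat" and \<Xi> \<Omega> :: 'o and \<xi> :: "'o \<Rightarrow> 'm" and tr :: 'm
  assumes "boolean_topos E"
    and "local_state_classifier E \<Xi> \<xi>"
    and "subobject_classifier E \<Omega> tr"
  shows "bij_betw (quotient_of_filter E \<xi>) (filters E (Xi_slat E \<Xi> \<xi>)) (quotients E) \<and>
    bij_betw (char_of_filter E tr) (filters E (Xi_slat E \<Xi> \<xi>))
      {h. semilattice_hom E (Xi_slat E \<Xi> \<xi>) (Omega_slat E \<Omega> tr) h} \<and>
    (\<forall>g :: ('o, 'm, 'p, 'q) geom. connected_geometric E g \<longrightarrow>
      (\<exists>f :: ('o, 'm, 'o, 'm) geom. connected_geometric E f \<and>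
         quotient_image E f = quotient_image E g))"
proof -
  interpret boolean_topos E by fact
  interpret classified_boolean_topos E \<Omega> tr by unfold_locales (rule assms(3))
  interpret local_state_topos E \<Omega> tr \<Xi> \<xi> by unfold_locales (rule assms(2))
  let ?cls = "\<lambda>h. {n. subobj_of E \<Xi> n \<and> char_of E tr n = h}"
  let ?H = "{h. semilattice_hom E Xi (Omega_slat E \<Omega> tr) h}"
  have filters: "filters E Xi = ?cls ` ?H"
    using filters_iff_class by blast
  have Hs: "h \<in> Ar E" "Dom E h = \<Xi>" "Cod E h = \<Omega>" if "h \<in> ?H" for h
    using that by (simp_all add: semilattice_hom_def Omega_slat_def)
  have char: "char_of_filter E tr (?cls h) = h" if "h \<in> ?H" for h
    using filter_class_properties(1) that by blast
  have objects: "filter_objects E \<xi> (?cls h) = {X \<in> Ob E. h \<cdot>\<^bsub>E\<^esub> \<xi> X = tr \<cdot>\<^bsub>E\<^esub> bang E X}"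
    if "h \<in> ?H" for h
    using filter_class_properties(2) that by blast
  have realized: "\<exists>f :: ('o, 'm, 'o, 'm) geom. connected_geometric E f \<and>
      quotient_image E f = filter_objects E \<xi> (?cls h)" if "h \<in> ?H" for h
    using hereditary_coreflective.quotient_of_subcategory filter_class_properties(3) that by blast
  have hereditary: "hereditary_coreflective E (quotient_image E g)"
    if "connected_geometric E g" for g :: "('o, 'm, 'r, 's) geom"
    by (rule hereditary_if_lex_coreflective [OF lex_coreflective_quotient_image [OF that]])
  have "bij_betw (quotient_of_filter E \<xi>) (filters E Xi) (quotients E)"
    unfolding bij_betw_def
  proof
    show "inj_on (quotient_of_filter E \<xi>) (filters E Xi)"
    proof (rule inj_onI)
      fix F F' assume "F \<in> filters E Xi" "F' \<in> filters E Xi"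
        and eq: "quotient_of_filter E \<xi> F = quotient_of_filter E \<xi> F'"
      then obtain h h' where h: "h \<in> ?H" "F = ?cls h" and h': "h' \<in> ?H" "F' = ?cls h'"
        unfolding filters by blast
      obtain f where "f \<in> quotient_of_filter E \<xi> F"
        using realized [OF h(1)] h(2) unfolding quotient_of_filter_def by blast
      then have "filter_objects E \<xi> F = filter_objects E \<xi> F'"
        using eq unfolding quotient_of_filter_def by blast
      then have objs: "{X \<in> Ob E. h \<cdot>\<^bsub>E\<^esub> \<xi> X = tr \<cdot>\<^bsub>E\<^esub> bang E X}
          = {X \<in> Ob E. h' \<cdot>\<^bsub>E\<^esub> \<xi> X = tr \<cdot>\<^bsub>E\<^esub> bang E X}"
        unfolding h(2) h'(2) objects [OF h(1)] objects [OF h'(1)] .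
      have "h = h'"
        by (rule hom_determined_by_objects) (use Hs [OF h(1)] Hs [OF h'(1)] objs in blast)+
      then show "F = F'" using h h' by simp
    qed
    have class_eq: "quotient_eq E `` {f} = quotient_of_filter E \<xi> F"
      if "connected_geometric E f" "quotient_image E f = filter_objects E \<xi> F"
      for f :: "('o, 'm, 'o, 'm) geom" and F
      using that unfolding quotient_eq_def quotient_of_filter_def by auto
    show "quotient_of_filter E \<xi> ` filters E Xi = quotients E"
    proof (intro subset_antisym subsetI)
      fix K assume "K \<in> quotient_of_filter E \<xi> ` filters E Xi"
      then obtain h where h: "h \<in> ?H" "K = quotient_of_filter E \<xi> (?cls h)"
        unfolding filters by blast
      obtain f :: "('o, 'm, 'o, 'm) geom" where f: "connected_geometric E f"
          "quotient_image E f = filter_objects E \<xi> (?cls h)"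
        using realized [OF h(1)] by blast
      then show "K \<in> quotients E"
        using class_eq [OF f] h(2) unfolding quotients_def quotient_def by blast
    next
      fix K :: "('o, 'm, 'o, 'm) geom set" assume "K \<in> quotients E"
      then obtain f where f: "connected_geometric E f" "K = quotient_eq E `` {f}"
        unfolding quotients_def quotient_def by blast
      obtain h where h: "semilattice_hom E Xi (Omega_slat E \<Omega> tr) h"
          "quotient_image E f = {X \<in> Ob E. h \<cdot>\<^bsub>E\<^esub> \<xi> X = tr \<cdot>\<^bsub>E\<^esub> bang E X}"
        by (rule hom_of_hereditary_coreflective [OF hereditary [OF f(1)]])
      then have "K = quotient_of_filter E \<xi> (?cls h)"
        using class_eq [OF f(1)] f(2) objects by simp
      then show "K \<in> quotient_of_filter E \<xi> ` filters E Xi"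
        unfolding filters using h(1) by blast
    qed
  qed
  moreover have "bij_betw (char_of_filter E tr) (filters E Xi) ?H"
    unfolding filters
    by (rule bij_betw_byWitness [where f' = ?cls]) (use char in auto)
  moreover have "\<exists>f :: ('o, 'm, 'o, 'm) geom. connected_geometric E f \<and>
      quotient_image E f = quotient_image E g"
    if "connected_geometric E g" for g :: "('o, 'm, 'p, 'q) geom"
    using hereditary_coreflective.quotient_of_subcategory [OF hereditary [OF that]] .
  ultimately show ?thesis by blast
qed

end
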